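(* There is a slowly varying function $f_2$ such that, as $n\to\infty$, \[ \frac{\Delta_2(\mathsf{T}_n^\Omega)}{f_2(n) n^{1/\alpha}} \] converges in distribution to the Fr\'echet$(\alpha)$ distribution.
   Context: Setting. $\xi$ is a random variable with values in $\mathbb{N}_0=\{0,1,2,\dots\}$ such that $\mathbb{P}(\xi=0)>0$, $\mathbb{P}(\xi\le 1)<1$, $\mathbb{E}[\xi]<1$, and there are a slowly varying function $f$ and a constant $\alpha>1$ with $\mathbb{P}(\xi=n)=f(n)n^{-1-\alpha}$ for all large enough integers $n$. $\Omega\subset\mathbb{N}_0$ is a fixed non-empty set with $\mathbb{P}(\xi\in\Omega)>0$ such that $\Omega$ or its complement $\mathbb{N}_0\setminus\Omega$ is finite. $\mathsf{T}$ is a Galton--Watson tree with offspring distribution $\xi$. The outdegree of a vertex is its number of children. For $n$ large enough, $\mathsf{T}_n^\Omega$ denotes $\mathsf{T}$ conditioned on having exactly $n$ vertices with outdegree in $\Omega$. $\Delta_1(\mathsf{T}_n^\Omega)\ge\Delta_2(\mathsf{T}_n^\Omega)\ge\dots$ are the outdegrees of the vertices of $\mathsf{T}_n^\Omega$ in descending order (with multiplicity). The Fr\'echet$(\alpha)$ distribution has distribution function $x\mapsto\exp(-x^{-\alpha})$ for $x>0$ (and $0$ for $x\le 0$). *)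

theory Defs
  imports "HOL-Probability.Probability" "HOL-Library.Multiset" "HOL-Real_Asymp.Real_Asymp"
begin

text \<open>Karamata's definition: a measurable positive function on some neighbourhood
  of infinity; the values of f outside that neighbourhood are irrelevant.\<close>

definition slowly_varying :: "(real \<Rightarrow> real) \<Rightarrow> bool" where
  "slowly_varying f \<longleftrightarrow>
     (\<exists>X. f \<in> borel_measurable (restrict_space borel {X..}) \<and> (\<forall>x\<ge>X. f x > 0)) \<and>
     (\<forall>t>0. ((\<lambda>x. f (t * x) / f x) \<longlongrightarrow> 1) at_top)"

text \<open>Rooted plane trees, possibly infinite, are sets of vertices in the Ulam--Harris encoding:
  the root is the empty word, and the children of a vertex v are words v @ [i].\<close>

type_synonym plane_tree = "nat list set"

definition outdegree :: "plane_tree \<Rightarrow> nat list \<Rightarrow> nat" where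
  "outdegree t v = card {i. v @ [i] \<in> t}"

definition outdegree_vertices :: "nat set \<Rightarrow> plane_tree \<Rightarrow> nat list set" where
  "outdegree_vertices \<Omega> t = {v \<in> t. outdegree t v \<in> \<Omega>}"

text \<open>Outdegrees of a finite tree, with multiplicity, in descending order.\<close>

definition outdegrees_desc :: "plane_tree \<Rightarrow> nat list" where
  "outdegrees_desc t = rev (sorted_list_of_multiset (image_mset (outdegree t) (mset_set t)))"

text \<open>The k-th largest outdegree, k = 1, 2, ...; by convention 0 if the tree has fewer than
  k vertices (or is infinite, which has probability 0 for the trees considered here).\<close>

definition kth_outdegree :: "nat \<Rightarrow> plane_tree \<Rightarrow> nat" where
  "kth_outdegree k t =
     (if 1 \<le> k \<and> k \<le> length (outdegrees_desc t) then outdegrees_desc t ! (k - 1) else 0)"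

text \<open>The Galton--Watson tree is built from independent copies of the offspring variable, one
  for each Ulam--Harris word; a vertex v of the tree has \<open>\<omega> v\<close> children.\<close>

definition gw_space :: "nat pmf \<Rightarrow> (nat list \<Rightarrow> nat) measure" where
  "gw_space \<xi> = PiM UNIV (\<lambda>_. measure_pmf \<xi>)"

inductive_set gw_tree :: "(nat list \<Rightarrow> nat) \<Rightarrow> plane_tree" for \<omega> where
  root: "[] \<in> gw_tree \<omega>"
| child: "v \<in> gw_tree \<omega> \<Longrightarrow> i < \<omega> v \<Longrightarrow> v @ [i] \<in> gw_tree \<omega>"

text \<open>The Galton--Watson tree conditioned on having exactly n vertices with outdegree in
  \<open>\<Omega>\<close>: \<open>gw_tree\<close> under the conditional measure \<open>gw_cond_space\<close>.
  The finiteness condition matters only for n = 0, since infinite sets have cardinality 0.\<close>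

definition gw_cond_space :: "nat pmf \<Rightarrow> nat set \<Rightarrow> nat \<Rightarrow> (nat list \<Rightarrow> nat) measure" where
  "gw_cond_space \<xi> \<Omega> n =
     uniform_measure (gw_space \<xi>)
       {\<omega> \<in> space (gw_space \<xi>).
          finite (outdegree_vertices \<Omega> (gw_tree \<omega>)) \<and>
          card (outdegree_vertices \<Omega> (gw_tree \<omega>)) = n}"

definition frechet_cdf :: "real \<Rightarrow> real \<Rightarrow> real" where
  "frechet_cdf \<alpha> x = (if x > 0 then exp (- (x powr (- \<alpha>))) else 0)"

definition frechet :: "real \<Rightarrow> real measure" where
  "frechet \<alpha> = interval_measure (frechet_cdf \<alpha>)"

lemma
  assumes "\<alpha> > 0"
  shows real_distribution_frechet: "real_distribution (frechet \<alpha>)"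
    and cdf_frechet: "cdf (frechet \<alpha>) = frechet_cdf \<alpha>"
proof -
  have mono: "frechet_cdf \<alpha> x \<le> frechet_cdf \<alpha> y" if "x \<le> y" for x y
    using that assms by (auto simp: frechet_cdf_def powr_mono2')
  have cont: "continuous (at_right a) (frechet_cdf \<alpha>)" for a
  proof -
    consider "a > 0" | "a = 0" | "a < 0" by linarith
    then show ?thesis
    proof cases
      case 1
      have "((\<lambda>x. exp (- (x powr (- \<alpha>)))) \<longlongrightarrow> exp (- (a powr (- \<alpha>)))) (at_right a)"
        using 1 by (auto intro!: tendsto_intros)
      moreover have "\<forall>\<^sub>F x in at_right a. exp (- (x powr (- \<alpha>))) = frechet_cdf \<alpha> x"
        using 1 by (auto simp: eventually_at_right_field frechet_cdf_def intro!: exI[of _ "a + 1"])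
      ultimately show ?thesis
        using 1 by (auto simp: continuous_within frechet_cdf_def elim: Lim_transform_eventually)
    next
      case 2
      have "((\<lambda>x. exp (- (x powr (- \<alpha>)))) \<longlongrightarrow> 0) (at_right 0)"
        using assms by real_asymp
      moreover have "\<forall>\<^sub>F x in at_right 0. exp (- (x powr (- \<alpha>))) = frechet_cdf \<alpha> x"
        by (auto simp: eventually_at_right_field frechet_cdf_def intro!: exI[of _ 1])
      ultimately show ?thesis
        using 2 by (auto simp: continuous_within frechet_cdf_def elim: Lim_transform_eventually)
    next
      case 3
      have "\<forall>\<^sub>F x in at_right a. 0 = frechet_cdf \<alpha> x"
        using 3 by (auto simp: eventually_at_right_field frechet_cdf_def intro!: exI[of _ 0])
      then show ?thesis
        using 3 by (auto simp: continuous_within frechet_cdf_def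
            intro: Lim_transform_eventually[OF tendsto_const])
    qed
  qed
  have bot: "(frechet_cdf \<alpha> \<longlongrightarrow> 0) at_bot"
    by (rule Lim_transform_eventually[OF tendsto_const])
       (auto simp: frechet_cdf_def eventually_at_bot_linorder intro!: exI[of _ 0])
  have "((\<lambda>x. exp (- (x powr (- \<alpha>)))) \<longlongrightarrow> 1) at_top"
    using assms by real_asymp
  then have top: "(frechet_cdf \<alpha> \<longlongrightarrow> 1) at_top"
    by (rule Lim_transform_eventually)
       (auto simp: frechet_cdf_def intro!: eventually_mono[OF eventually_gt_at_top[of 0]])
  show "real_distribution (frechet \<alpha>)"
    unfolding frechet_def by (intro real_distribution_interval_measure mono cont bot top)
  show "cdf (frechet \<alpha>) = frechet_cdf \<alpha>"
    unfolding frechet_def by (intro cdf_interval_measure mono cont bot)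
qed

end

theory Submission
  imports Defs
begin

text \<open>The second largest outdegree of the conditioned tree is asymptotically the maximum of an
unconditioned sample. Let p be the probability that the offspring number lies in \<Omega>.

By the cycle lemma (\<open>luk_sum_cycle\<close>), the probability that the tree is finite and that its
outdegrees form a multiset in some family is the sum, over all words whose letters have sum equal to
the length minus one and whose multiset of letters lies in the family, of the product of the
offspring probabilities of the letters divided by the length (\<open>emeasure_gw_tree_event\<close>). As the mean
is below 1, a typical word with n letters in \<Omega> has letter sum smaller than its length by about
c n with c > 0. The cheapest way of repairing this is a single letter of size about c n.
There are as many positions for this letter as the word has letters, which cancels the
division by the length, and its value is forced by the other letters. This leaves a sum
over words without any constraint on the letter sum, in which each word M carries the extra factor
P(\<xi> = length M - sum M) (\<open>tree_sum_select_letter\<close>). By the law of large numbers and the uniform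
convergence theorem for slowly varying functions, this factor is asymptotically the constant
\<open>rho n\<close> (\<open>jump_deviation\<close>). So the letters other than the big one become free.

The free words with n letters in \<Omega> have a negative binomial generating function
(\<open>all_words_count\<close>). It shows that the proportion of those whose letters are all at most y n
tends to exp(-l/p) whenever n P(\<xi> > y n) tends to l (\<open>truncated_mass\<close>). The tail of \<xi>
is regularly varying with index -\<alpha>, so its generalised inverse yields a norming sequence
of the form \<open>f\<^sub>2 n * n powr (1 / \<alpha>)\<close> with slowly varying \<open>f\<^sub>2\<close>, for which l = p x^(-\<alpha>) at level x
(\<open>pmf_tail_regularly_varying\<close>, \<open>regularly_varying_inverse\<close>).

It remains to exclude words in which no letter exceeds \<delta> n. The letter weights are cut
off at \<delta> n and tilted by exp(s (d - 1)) with s = K ln n / n. If K \<delta> is small, the first-order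
expansion of the weights in s is not disturbed by the heavy tail
(\<open>tilted_mass_expansion\<close>), and if K is large, Markov's inequality gives a bound of smaller
order than \<open>rho n\<close> (\<open>no_big_mass_small\<close>). The same tilt, in both directions, gives the law of
large numbers used above (\<open>excess_deviation\<close>).\<close>

section \<open>Slowly varying functions\<close>

text \<open>The uniform convergence theorem in additive form. By dominated convergence, the points t of
the window [x, x + 2A] at which h t is far from h x form a set of small measure once x is large. The
windows of x and x + u overlap in a set of measure at least A, so some t in the overlap is good for
both, and h (x + u) is compared with h x through h t.\<close>

lemma additive_uniform_convergence:
  fixes h :: "real \<Rightarrow> real"
  assumes [measurable]: "h \<in> borel_measurable borel"
    and lim: "\<And>u. ((\<lambda>x. h (x + u) - h x) \<longlongrightarrow> 0) at_top"
    and "A > 0" "e > 0"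
  shows "\<exists>X. \<forall>x\<ge>X. \<forall>u\<in>{0..A}. \<bar>h (x + u) - h x\<bar> < e"
proof -
  define E where "E x = {v\<in>{0..2*A}. \<bar>h (x + v) - h x\<bar> \<ge> e / 2}" for x
  have [measurable]: "E x \<in> sets borel" for x
    unfolding E_def by measurable
  have fin: "emeasure lborel (E x) < \<infinity>" for x
    by (rule le_less_trans[OF emeasure_mono[of _ "{0..2*A}"]]) (auto simp: E_def assms(3) less_imp_le)
  have "((\<lambda>x. \<integral>v. indicator (E x) v \<partial>lborel) \<longlongrightarrow> (\<integral>v. (0::real) \<partial>(lborel :: real measure))) at_top"
  proof (rule integral_dominated_convergence_at_top[where s = "\<lambda>x v. indicator (E x) v" and f = "\<lambda>_. 0" and w = "indicator {0..2*A}"])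
    show "integrable lborel (\<lambda>v. indicator {0..2*A} v :: real)"
      using assms(3) by (simp add: integrable_indicator_iff)
    show "\<forall>\<^sub>F x in at_top. AE v in lborel. norm (indicator (E x) v :: real) \<le> indicator {0..2*A} v"
      by (intro always_eventually allI AE_I2) (auto simp: E_def indicator_def)
    show "AE v in lborel. ((\<lambda>x. indicator (E x) v :: real) \<longlongrightarrow> 0) at_top"
    proof (intro AE_I2 tendsto_eventually)
      fix v
      have "\<forall>\<^sub>F x in at_top. dist (h (x + v) - h x) 0 < e / 2"
        by (rule tendstoD[OF lim]) (use assms in auto)
      then show "\<forall>\<^sub>F x in at_top. indicator (E x) v = (0::real)"
        by eventually_elim (auto simp: E_def indicator_def)
    qed
  qed simp_all
  then have "((\<lambda>x. measure lborel (E x)) \<longlongrightarrow> 0) at_top" by simp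
  then have "\<forall>\<^sub>F x in at_top. measure lborel (E x) < A / 2"
    using assms(3) by (intro order_tendstoD(2)) auto
  then obtain X where X: "\<And>x. x \<ge> X \<Longrightarrow> measure lborel (E x) < A / 2"
    by (auto simp: eventually_at_top_linorder)
  have "\<bar>h (x + u) - h x\<bar> < e" if x: "x \<ge> X" and u: "u \<in> {0..A}" for x u
  proof -
    \<comment> \<open>the bad set of the window starting at x + u, in the coordinates of the window starting at x\<close>
    define S where "S = (+) (- u) -` E (x + u)"
    have [measurable]: "S \<in> sets borel"
      unfolding S_def by (rule measurable_sets_borel[OF _ \<open>E (x + u) \<in> sets borel\<close>]) auto
    have "emeasure lborel (E (x + u)) = emeasure (distr lborel borel ((+) (- u))) (E (x + u))"
      by (simp add: lborel_distr_plus)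
    also have "\<dots> = emeasure lborel S"
      by (subst emeasure_distr) (auto simp: S_def)
    finally have S: "emeasure lborel S = emeasure lborel (E (x + u))" ..
    have "\<not> {u..2*A} \<subseteq> E x \<union> S"
    proof
      assume "{u..2*A} \<subseteq> E x \<union> S"
      then have "emeasure lborel {u..2*A} \<le> emeasure lborel (E x \<union> S)"
        by (intro emeasure_mono) auto
      also have "\<dots> \<le> emeasure lborel (E x) + emeasure lborel S"
        by (rule emeasure_subadditive) auto
      also have "\<dots> = ennreal (measure lborel (E x)) + ennreal (measure lborel (E (x + u)))"
        unfolding S using fin by (simp add: emeasure_eq_ennreal_measure less_top)
      also have "\<dots> = ennreal (measure lborel (E x) + measure lborel (E (x + u)))" by simp
      finally have "2 * A - u \<le> measure lborel (E x) + measure lborel (E (x + u))"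
        using u by (simp add: ennreal_le_iff del: ennreal_plus)
      with X[of x] X[of "x + u"] x u show False by auto
    qed
    then obtain v where v: "v \<in> {u..2 * A}" "v \<notin> E x" "v \<notin> S" by blast
    then have "\<bar>h (x + v) - h x\<bar> < e / 2" "\<bar>h (x + v) - h (x + u)\<bar> < e / 2"
      using u by (auto simp: E_def S_def)
    then show ?thesis by linarith
  qed
  then show ?thesis by blast
qed

text \<open>The substitution h x = ln (f (exp x)) turns multiplicative increments into additive ones.\<close>

lemma slowly_varying_uniform:
  assumes f: "slowly_varying f" and "\<Lambda> > 1" "e > 0"
  shows "\<exists>X>0. \<forall>x\<ge>X. f x > 0 \<and> (\<forall>t\<in>{1..\<Lambda>}. \<bar>ln (f (t * x)) - ln (f x)\<bar> < e)"
proof -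
  obtain X0 where m: "f \<in> borel_measurable (restrict_space borel {X0..})" and pos: "\<And>x. x \<ge> X0 \<Longrightarrow> f x > 0"
    and lim: "\<And>t. t > 0 \<Longrightarrow> ((\<lambda>x. f (t * x) / f x) \<longlongrightarrow> 1) at_top"
    using f by (auto simp: slowly_varying_def)
  define g where "g x = (if x \<in> {X0..} then f x else 1)" for x
  have [measurable]: "g \<in> borel_measurable borel"
    unfolding g_def using m by (subst measurable_If_restrict_space_iff) (auto simp: atLeast_def)
  define h where "h x = ln (g (exp x))" for x
  have [measurable]: "h \<in> borel_measurable borel" unfolding h_def by measurable
  have "((\<lambda>x. h (x + u) - h x) \<longlongrightarrow> 0) at_top" for u
  proof -
    have "((\<lambda>x. ln (f (exp u * exp x) / f (exp x))) \<longlongrightarrow> ln 1) at_top"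
      by (intro tendsto_ln filterlim_compose[OF lim exp_at_top]) auto
    moreover have "\<forall>\<^sub>F x in at_top. ln (f (exp u * exp x) / f (exp x)) = h (x + u) - h x"
    proof -
      have ge: "\<forall>\<^sub>F x in at_top. y \<le> exp x" for y :: real
        using exp_at_top unfolding filterlim_at_top by blast
      have "\<forall>\<^sub>F x in at_top. exp u * exp x \<ge> X0"
        using ge[of "X0 / exp u"] by eventually_elim (simp add: field_simps)
      with ge[of X0] show ?thesis
      proof eventually_elim
        case (elim x)
        with pos[of "exp x"] pos[of "exp u * exp x"] show ?case
          by (simp add: h_def g_def exp_add mult.commute ln_div)
      qed
    qed
    ultimately show ?thesis by (auto elim: Lim_transform_eventually)
  qed
  from additive_uniform_convergence[OF _ this, of "ln \<Lambda>" e] assms(2,3)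
  have "\<exists>X. \<forall>x\<ge>X. \<forall>u\<in>{0..ln \<Lambda>}. \<bar>h (x + u) - h x\<bar> < e" by simp
  then obtain X where X: "\<And>x u. x \<ge> X \<Longrightarrow> u \<in> {0..ln \<Lambda>} \<Longrightarrow> \<bar>h (x + u) - h x\<bar> < e"
    by blast
  have "f x > 0 \<and> \<bar>ln (f (t * x)) - ln (f x)\<bar> < e" if x: "x \<ge> max (exp X) (max X0 1)" and t: "t \<in> {1..\<Lambda>}" for x t
  proof -
    have "x > 0" using x by auto
    have "X \<le> ln x" using x \<open>x > 0\<close> by (simp add: ln_ge_iff)
    have "x * 1 \<le> x * t" using t \<open>x > 0\<close> by (intro mult_left_mono) auto
    moreover have "exp (ln x + ln t) = t * x" using t \<open>x > 0\<close> by (simp add: exp_add)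
    moreover have "t * x \<ge> X0" using \<open>x * 1 \<le> x * t\<close> x unfolding mult.commute[of t x] by linarith
    ultimately show ?thesis
      using X[OF \<open>X \<le> ln x\<close>, of "ln t"] t x \<open>x > 0\<close> pos[of x]
      by (simp add: h_def g_def)
  qed
  moreover have "f x > 0" if "x \<ge> max (exp X) (max X0 1)" for x using pos that by auto
  moreover have "max (exp X) (max X0 1) > 0" by (simp add: less_max_iff_disj)
  ultimately show ?thesis by blast
qed

text \<open>Potter's bounds. Doubling the argument changes the logarithm of f by at most \<eta> ln 2; between x and
y there are about log 2 (y / x) doublings.\<close>

lemma slowly_varying_potter:
  assumes f: "slowly_varying f" and "\<eta> > 0"
  shows "\<exists>X>0. \<exists>C>0. \<forall>x\<ge>X. \<forall>y\<ge>x. f x > 0 \<and> f y \<le> C * f x * (y / x) powr \<eta> \<and> f x \<le> C * f y * (y / x) powr \<eta>"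
proof -
  define e where "e = \<eta> * ln 2"
  have "e > 0" using assms(2) by (simp add: e_def)
  obtain X where X: "X > 0" "\<And>x t. x \<ge> X \<Longrightarrow> t \<in> {1..2} \<Longrightarrow> f x > 0 \<and> \<bar>ln (f (t * x)) - ln (f x)\<bar> < e"
    using slowly_varying_uniform[OF f, of 2 e] \<open>e > 0\<close> by force
  have it: "\<bar>ln (f (2 ^ k * t * x)) - ln (f x)\<bar> \<le> e * (real k + 1)" if "x \<ge> X" "t \<in> {1..2}" for k t x
  proof (induction k)
    case 0
    from X(2)[OF that] show ?case by simp
  next
    case (Suc k)
    have "1 * 1 \<le> 2 ^ k * t" using that by (intro mult_mono) auto
    then have "x * 1 \<le> x * (2 ^ k * t)" using that X(1) by (intro mult_left_mono) auto
    then have "2 ^ k * t * x \<ge> X" using that(1) by (simp add: mult_ac)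
    with X(2)[OF this, of 2] have "\<bar>ln (f (2 ^ Suc k * t * x)) - ln (f (2 ^ k * t * x))\<bar> < e"
      by (simp add: mult.assoc)
    moreover have "e * (real (Suc k) + 1) = e * (real k + 1) + e" by (simp add: algebra_simps)
    ultimately show ?case using Suc.IH by linarith
  qed
  define C where "C = exp (2 * e)"
  have "f x > 0 \<and> f y \<le> C * f x * (y / x) powr \<eta> \<and> f x \<le> C * f y * (y / x) powr \<eta>"
    if "x \<ge> X" "y \<ge> x" for x y
  proof -
    have xy: "x > 0" "y > 0" "y \<ge> X" using that X(1) by auto
    have pos: "f x > 0" "f y > 0" using X(2)[of x 1] X(2)[of y 1] that xy by auto
    define r where "r = y / x"
    have r: "r \<ge> 1" using that xy by (simp add: r_def)
    \<comment> \<open>k full doublings and a remaining factor t between 1 and 2\<close>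
    define k where "k = nat \<lfloor>log 2 r\<rfloor>"
    have k: "real k \<le> log 2 r" "log 2 r < real k + 1"
      using r by (auto simp: k_def)
    define t where "t = r / 2 ^ k"
    have "2 ^ k \<le> r" "r \<le> 2 ^ (k + 1)"
      using k r by (auto simp: le_log_iff log_less_iff powr_realpow powr_add algebra_simps)
    then have "t \<in> {1..2}" by (auto simp: t_def field_simps)
    from it[OF that(1) this, of k] have "\<bar>ln (f y) - ln (f x)\<bar> \<le> e * (real k + 1)"
      using xy by (simp add: t_def r_def)
    also have "\<dots> \<le> e * (log 2 r + 2)" using k \<open>e > 0\<close> by (intro mult_left_mono) auto
    also have "\<dots> = \<eta> * ln r + 2 * e" by (simp add: e_def log_def algebra_simps)
    finally have le: "\<bar>ln (f y) - ln (f x)\<bar> \<le> \<eta> * ln r + 2 * e" .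
    have Cr: "C * r powr \<eta> = exp (\<eta> * ln r + 2 * e)"
      using r by (simp add: C_def powr_def exp_add)
    have "f y \<le> f x * exp (\<eta> * ln r + 2 * e)" "f x \<le> f y * exp (\<eta> * ln r + 2 * e)"
    proof -
      have "f y = f x * exp (ln (f y) - ln (f x))" using pos by (simp add: exp_diff)
      also have "\<dots> \<le> f x * exp (\<eta> * ln r + 2 * e)" using le pos by (intro mult_left_mono) auto
      finally show "f y \<le> f x * exp (\<eta> * ln r + 2 * e)" .
      have "f x = f y * exp (ln (f x) - ln (f y))" using pos by (simp add: exp_diff)
      also have "\<dots> \<le> f y * exp (\<eta> * ln r + 2 * e)" using le pos by (intro mult_left_mono) auto
      finally show "f x \<le> f y * exp (\<eta> * ln r + 2 * e)" .
    qed
    moreover have "C * z * r powr \<eta> = z * exp (\<eta> * ln r + 2 * e)" for z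
      unfolding Cr[symmetric] by simp
    ultimately show ?thesis using pos by (simp only: r_def[symmetric])
  qed
  moreover have "C > 0" by (simp add: C_def)
  ultimately show ?thesis using X(1) by blast
qed

section \<open>Regularly varying tails and their inverses\<close>

text \<open>A pointwise limit along fixed multiples does not suffice here, since the ratio of u to its floor
varies with u; this is where uniformity is needed.\<close>

lemma slowly_varying_floor:
  assumes f: "slowly_varying f"
  shows "((\<lambda>u. f (real (nat \<lfloor>u\<rfloor>)) / f u) \<longlongrightarrow> 1) at_top"
proof -
  have pos: "\<forall>\<^sub>F u in at_top. f u > 0"
    using f by (auto simp: slowly_varying_def eventually_at_top_linorder)
  have "((\<lambda>u. ln (f (real (nat \<lfloor>u\<rfloor>))) - ln (f u)) \<longlongrightarrow> 0) at_top"
  proof (rule tendstoI)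
    fix e :: real assume "e > 0"
    from slowly_varying_uniform[OF f, of 2 e] this obtain X where
      X: "X > 0" "\<And>x t. x \<ge> X \<Longrightarrow> t \<in> {1..2} \<Longrightarrow> \<bar>ln (f (t * x)) - ln (f x)\<bar> < e" by auto
    show "\<forall>\<^sub>F u in at_top. dist (ln (f (real (nat \<lfloor>u\<rfloor>))) - ln (f u)) 0 < e"
      using eventually_ge_at_top[of "X + 1"] eventually_ge_at_top[of 2]
    proof eventually_elim
      case (elim u)
      define x where "x = real (nat \<lfloor>u\<rfloor>)"
      have x: "x \<le> u" "u < x + 1" using elim by (auto simp: x_def)
      with elim have "x \<ge> X" "x \<ge> 1" by auto
      moreover have "u / x \<in> {1..2}" using x elim by (auto simp: field_simps)
      moreover have "u / x * x = u" using \<open>x \<ge> 1\<close> by simp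
      ultimately have "\<bar>ln (f u) - ln (f x)\<bar> < e" using X(2)[of x "u / x"] by metis
      then show ?case by (simp add: x_def dist_real_def abs_minus_commute)
    qed
  qed
  then have "((\<lambda>u. exp (ln (f (real (nat \<lfloor>u\<rfloor>))) - ln (f u))) \<longlongrightarrow> exp 0) at_top"
    by (intro tendsto_exp)
  moreover have "\<forall>\<^sub>F u in at_top. exp (ln (f (real (nat \<lfloor>u\<rfloor>))) - ln (f u)) = f (real (nat \<lfloor>u\<rfloor>)) / f u"
  proof -
    have "filterlim (\<lambda>u::real. real (nat \<lfloor>u\<rfloor>)) at_top at_top" by real_asymp
    from eventually_compose_filterlim[OF pos this] pos
    show ?thesis by eventually_elim (simp add: exp_diff)
  qed
  ultimately show ?thesis by (simp add: Lim_transform_eventually)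
qed

text \<open>The easy half of Karamata's theorem. Let g be the step function whose value on [k, k + 1) is the
k-th probability, and G y its integral over [y, \<infinity>). The substitution u = s v turns G (s y) into s
times the integral of g (s v) over [y, \<infinity>), and g (s v) is asymptotically s^(-1-\<alpha>) g v. The tail F
agrees with G at the next integer, so it is squeezed between G (\<theta> y) and G y for every \<theta> > 1 once y is large.\<close>

lemma pmf_tail_regularly_varying:
  fixes \<xi> :: "nat pmf"
  defines "F \<equiv> \<lambda>y. measure_pmf.prob \<xi> {k. y < real k}"
  assumes f: "slowly_varying f" and \<alpha>: "\<alpha> > 0"
    and pmf: "\<forall>\<^sub>F n in sequentially. pmf \<xi> n = f (real n) * real n powr (- 1 - \<alpha>)"
    and t: "t > 0"
  shows "((\<lambda>y. F (t * y) / F y) \<longlongrightarrow> t powr (- \<alpha>)) at_top"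
proof -
  define \<rho> where "\<rho> x = f x * x powr (- 1 - \<alpha>)" for x
  define g where "g u = pmf \<xi> (nat \<lfloor>u\<rfloor>)" for u :: real
  have fpos: "\<forall>\<^sub>F u in at_top. f u > 0"
    using f by (auto simp: slowly_varying_def eventually_at_top_linorder)
  have \<rho>pos: "\<forall>\<^sub>F u in at_top. \<rho> u > 0"
    using fpos eventually_gt_at_top[of 0] by eventually_elim (simp add: \<rho>_def)
  have g\<rho>: "((\<lambda>u. g u / \<rho> u) \<longlongrightarrow> 1) at_top"
  proof -
    have "((\<lambda>u. real (nat \<lfloor>u\<rfloor>) / u) \<longlongrightarrow> 1) at_top" by real_asymp
    then have "((\<lambda>u. f (real (nat \<lfloor>u\<rfloor>)) / f u * (real (nat \<lfloor>u\<rfloor>) / u) powr (- 1 - \<alpha>)) \<longlongrightarrow> 1 * 1 powr (- 1 - \<alpha>)) at_top"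
      by (rule tendsto_mult[OF slowly_varying_floor[OF f] tendsto_powr[OF _ tendsto_const]]) auto
    moreover have "\<forall>\<^sub>F u in at_top. f (real (nat \<lfloor>u\<rfloor>)) / f u * (real (nat \<lfloor>u\<rfloor>) / u) powr (- 1 - \<alpha>) = g u / \<rho> u"
    proof -
      have "filterlim (\<lambda>u::real. nat \<lfloor>u\<rfloor>) sequentially at_top"
        by (intro filterlim_compose[OF filterlim_nat_sequentially filterlim_floor_sequentially])
      from eventually_compose_filterlim[OF pmf this] eventually_gt_at_top[of 0]
      show ?thesis by eventually_elim (simp add: g_def \<rho>_def powr_divide)
    qed
    ultimately show ?thesis by (simp add: Lim_transform_eventually)
  qed
  have gpos: "\<forall>\<^sub>F u in at_top. g u > 0"
  proof -
    have "\<forall>\<^sub>F u in at_top. g u / \<rho> u > 0" using g\<rho> by (intro order_tendstoD(1)) auto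
    then show ?thesis using \<rho>pos by eventually_elim (simp add: zero_less_divide_iff)
  qed
  have gratio: "((\<lambda>u. g (s * u) / g u) \<longlongrightarrow> s powr (- 1 - \<alpha>)) at_top" if s: "s > 0" for s
  proof -
    \<comment> \<open>g is compared with \<rho> at both arguments, and the ratio of \<rho> is known from slow variation\<close>
    have st: "filterlim (\<lambda>u. s * u) at_top at_top"
      using s by (intro filterlim_tendsto_pos_mult_at_top[OF tendsto_const _ filterlim_ident])
    have "((\<lambda>u. (g (s * u) / \<rho> (s * u)) * (f (s * u) / f u * s powr (- 1 - \<alpha>)) * inverse (g u / \<rho> u)) \<longlongrightarrow> 1 * (1 * s powr (- 1 - \<alpha>)) * inverse 1) at_top"
      using f s by (intro tendsto_intros g\<rho> filterlim_compose[OF g\<rho> st]) (auto simp: slowly_varying_def)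
    moreover have "\<forall>\<^sub>F u in at_top. (g (s * u) / \<rho> (s * u)) * (f (s * u) / f u * s powr (- 1 - \<alpha>)) * inverse (g u / \<rho> u) = g (s * u) / g u"
      using eventually_compose_filterlim[OF fpos st] fpos eventually_gt_at_top[of 0]
      by eventually_elim (use s in \<open>simp add: \<rho>_def powr_mult field_simps\<close>)
    ultimately show ?thesis by (simp add: Lim_transform_eventually)
  qed
  have [measurable]: "g \<in> borel_measurable borel" unfolding g_def by measurable
  define G where "G y = (\<integral>\<^sup>+u. ennreal (g u) * indicator {y..} u \<partial>lborel)" for y
  have G_anti: "G y \<le> G x" if "x \<le> y" for x y
    unfolding G_def using that by (intro nn_integral_mono mult_left_mono) (auto simp: indicator_def)
  have G_scale: "G (s * y) = ennreal s * (\<integral>\<^sup>+v. ennreal (g (s * v)) * indicator {y..} v \<partial>lborel)" if "s > 0" for s y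
    unfolding G_def using that
    by (subst nn_integral_real_affine[where c = s and t = 0])
       (auto intro!: arg_cong[where f = "\<lambda>x. _ * x"] nn_integral_cong simp: indicator_def)
  have G_int: "G (real K) = emeasure (measure_pmf \<xi>) {K..}" for K
  proof -
    have "G (real K) = (\<integral>\<^sup>+u. (\<Sum>k. ennreal (pmf \<xi> k) * indicator {K..} k * indicator {real k..<real k + 1} u) \<partial>lborel)"
      unfolding G_def
    proof (rule nn_integral_cong)
      fix u :: real
      have "(\<Sum>k. ennreal (pmf \<xi> k) * indicator {K..} k * indicator {real k..<real k + 1} u) =
        (\<Sum>k\<in>{nat \<lfloor>u\<rfloor>}. ennreal (pmf \<xi> k) * indicator {K..} k * indicator {real k..<real k + 1} u)"
      proof (rule suminf_finite)
        fix k assume "k \<notin> {nat \<lfloor>u\<rfloor>}"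
        then have "\<not> (real k \<le> u \<and> u < real k + 1)" by (auto, linarith)
        then show "ennreal (pmf \<xi> k) * indicator {K..} k * indicator {real k..<real k + 1} u = 0" by simp
      qed simp
      also have "\<dots> = ennreal (g u) * indicator {real K..} u"
      proof (cases "u \<ge> 0")
        case True
        then have "K \<le> nat \<lfloor>u\<rfloor> \<longleftrightarrow> real K \<le> u" by linarith
        with True show ?thesis by (auto simp: g_def indicator_def)
      qed (auto simp: g_def indicator_def)
      finally show "ennreal (g u) * indicator {real K..} u = (\<Sum>k. ennreal (pmf \<xi> k) * indicator {K..} k * indicator {real k..<real k + 1} u)" ..
    qed
    also have "\<dots> = (\<Sum>k. ennreal (pmf \<xi> k) * indicator {K..} k)"
      by (subst nn_integral_suminf) (auto simp: nn_integral_cmult)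
    also have "\<dots> = emeasure (measure_pmf \<xi>) {K..}"
      by (simp add: nn_integral_indicator[symmetric] nn_integral_measure_pmf nn_integral_count_space_nat del: nn_integral_indicator)
    finally show ?thesis .
  qed
  have F_eq: "ennreal (F y) = G (real (nat \<lfloor>y\<rfloor>) + 1)" if "y \<ge> 0" for y
  proof -
    have "{k. y < real k} = {nat \<lfloor>y\<rfloor> + 1..}" using that by (auto, linarith+)
    then show ?thesis using G_int[of "nat \<lfloor>y\<rfloor> + 1"] by (simp add: F_def measure_pmf.emeasure_eq_measure add.commute)
  qed
  have F_le: "ennreal (F y) \<le> G y" if "y \<ge> 0" for y
    unfolding F_eq[OF that] using that by (intro G_anti) linarith
  have F_ge: "ennreal (F y) \<ge> G (\<theta> * y)" if "\<theta> > 1" "y \<ge> 1 / (\<theta> - 1)" for y \<theta>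
  proof -
    have "y \<ge> 0" using that by (meson diff_gt_0_iff_gt less_eq_real_def order_trans zero_le_divide_1_iff)
    have "real (nat \<lfloor>y\<rfloor>) + 1 \<le> y + 1" using \<open>y \<ge> 0\<close> by linarith
    also have "\<dots> \<le> \<theta> * y" using that by (simp add: field_simps)
    finally show ?thesis unfolding F_eq[OF \<open>y \<ge> 0\<close>] by (rule G_anti)
  qed
  have G_le: "\<forall>\<^sub>F y in at_top. G (s * y) \<le> ennreal ((1 + \<eta>) * s powr (-\<alpha>)) * G y" if "s > 0" "\<eta> > 0" for s \<eta>
  proof -
    have "\<forall>\<^sub>F u in at_top. g (s * u) / g u < (1 + \<eta>) * s powr (- 1 - \<alpha>)"
      using that by (intro order_tendstoD(2)[OF gratio]) auto
    with gpos have "\<forall>\<^sub>F u in at_top. g (s * u) \<le> (1 + \<eta>) * s powr (- 1 - \<alpha>) * g u"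
      by eventually_elim (simp add: field_simps)
    then obtain Y where Y: "\<And>u. u \<ge> Y \<Longrightarrow> g (s * u) \<le> (1 + \<eta>) * s powr (- 1 - \<alpha>) * g u"
      by (auto simp: eventually_at_top_linorder)
    have "G (s * y) \<le> ennreal ((1 + \<eta>) * s powr (-\<alpha>)) * G y" if "y \<ge> Y" for y
    proof -
      have "G (s * y) \<le> ennreal s * (\<integral>\<^sup>+v. ennreal ((1 + \<eta>) * s powr (- 1 - \<alpha>)) * (ennreal (g v) * indicator {y..} v) \<partial>lborel)"
        unfolding G_scale[OF \<open>s > 0\<close>]
      proof (intro mult_left_mono nn_integral_mono)
        fix v
        show "ennreal (g (s * v)) * indicator {y..} v \<le> ennreal ((1 + \<eta>) * s powr (- 1 - \<alpha>)) * (ennreal (g v) * indicator {y..} v)"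
          using Y[of v] that \<open>\<eta> > 0\<close> by (auto simp: indicator_def ennreal_mult[symmetric] g_def intro!: ennreal_leI)
      qed simp
      also have "\<dots> = ennreal (s * ((1 + \<eta>) * s powr (- 1 - \<alpha>))) * G y"
        using \<open>\<eta> > 0\<close> \<open>s > 0\<close> by (simp add: nn_integral_cmult G_def ennreal_mult mult.assoc)
      also have "s * ((1 + \<eta>) * s powr (- 1 - \<alpha>)) = (1 + \<eta>) * s powr (-\<alpha>)"
        using \<open>s > 0\<close> by (simp add: powr_mult_base)
      finally show ?thesis .
    qed
    then show ?thesis by (auto simp: eventually_at_top_linorder)
  qed
  have upper: "\<forall>\<^sub>F y in at_top. F (s * y) \<le> (1 + \<eta>) * (s / (1 + \<eta>)) powr (-\<alpha>) * F y" if s: "s > 0" and \<eta>: "\<eta> > 0" for s \<eta>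
  proof -
    have "\<forall>\<^sub>F y in at_top. G (s / (1 + \<eta>) * y) \<le> ennreal ((1 + \<eta>) * (s / (1 + \<eta>)) powr (-\<alpha>)) * G y"
      using s \<eta> by (intro G_le) auto
    moreover have "filterlim (\<lambda>y. (1 + \<eta>) * y) at_top at_top"
      using \<eta> by (intro filterlim_tendsto_pos_mult_at_top[OF tendsto_const _ filterlim_ident]) auto
    ultimately have "\<forall>\<^sub>F y in at_top. G (s / (1 + \<eta>) * ((1 + \<eta>) * y)) \<le> ennreal ((1 + \<eta>) * (s / (1 + \<eta>)) powr (-\<alpha>)) * G ((1 + \<eta>) * y)"
      by (rule eventually_compose_filterlim)
    with eventually_ge_at_top[of "1 / \<eta>"] eventually_ge_at_top[of 0] show ?thesis
    proof eventually_elim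
      case (elim y)
      have "ennreal (F (s * y)) \<le> G (s * y)" using s elim by (intro F_le) auto
      also have "\<dots> \<le> ennreal ((1 + \<eta>) * (s / (1 + \<eta>)) powr (-\<alpha>)) * G ((1 + \<eta>) * y)"
        using elim \<eta> by simp
      also have "\<dots> \<le> ennreal ((1 + \<eta>) * (s / (1 + \<eta>)) powr (-\<alpha>)) * ennreal (F y)"
        using elim \<eta> by (intro mult_left_mono F_ge) auto
      also have "\<dots> = ennreal ((1 + \<eta>) * (s / (1 + \<eta>)) powr (-\<alpha>) * F y)"
        using \<eta> by (simp add: ennreal_mult F_def)
      finally show ?case using \<eta> by (subst (asm) ennreal_le_iff) (auto simp: F_def)
    qed
  qed
  have Fpos: "F y > 0" for y
  proof -
    have "\<forall>\<^sub>F u in at_top. g u > 0 \<and> u > y + 1 \<and> u > 0"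
      using gpos eventually_gt_at_top[of "y + 1"] eventually_gt_at_top[of 0] by eventually_elim auto
    then obtain u where u: "g u > 0" "u > y + 1" "u > 0"
      using eventually_happens'[OF trivial_limit_at_top_linorder] by blast
    have "0 < measure_pmf.prob \<xi> {nat \<lfloor>u\<rfloor>}" using u by (simp add: g_def measure_pmf_single)
    also have "\<dots> \<le> F y" unfolding F_def using u by (intro measure_pmf.finite_measure_mono) (auto, linarith)
    finally show ?thesis .
  qed
  show ?thesis
  proof (rule tendstoI)
    fix e :: real assume "e > 0"
    have "((\<lambda>\<eta>. (1 + \<eta>) * (t / (1 + \<eta>)) powr (-\<alpha>)) \<longlongrightarrow> (1 + 0) * (t / (1 + 0)) powr (-\<alpha>)) (at_right 0)"
      using t by (intro tendsto_intros) auto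
    then have 1: "\<forall>\<^sub>F \<eta> in at_right 0. (1 + \<eta>) * (t / (1 + \<eta>)) powr (-\<alpha>) < t powr (-\<alpha>) + e"
      using \<open>e > 0\<close> by (intro order_tendstoD(2)) auto
    have "((\<lambda>\<eta>. inverse ((1 + \<eta>) * (inverse t / (1 + \<eta>)) powr (-\<alpha>))) \<longlongrightarrow> inverse ((1 + 0) * (inverse t / (1 + 0)) powr (-\<alpha>))) (at_right 0)"
      using t by (intro tendsto_intros) auto
    also have "inverse ((1 + 0) * (inverse t / (1 + 0)) powr (-\<alpha>)) = t powr (-\<alpha>)"
      using t by (simp add: powr_minus inverse_powr)
    finally have 2: "\<forall>\<^sub>F \<eta> in at_right 0. inverse ((1 + \<eta>) * (inverse t / (1 + \<eta>)) powr (-\<alpha>)) > t powr (-\<alpha>) - e"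
      using \<open>e > 0\<close> by (intro order_tendstoD(1)) auto
    have "\<forall>\<^sub>F \<eta> in at_right 0. \<eta> > 0 \<and> (1 + \<eta>) * (t / (1 + \<eta>)) powr (-\<alpha>) < t powr (-\<alpha>) + e \<and>
        inverse ((1 + \<eta>) * (inverse t / (1 + \<eta>)) powr (-\<alpha>)) > t powr (-\<alpha>) - e"
      using 1 2 eventually_at_right_less[of 0] by eventually_elim simp
    then obtain \<eta> where \<eta>: "\<eta> > 0" "(1 + \<eta>) * (t / (1 + \<eta>)) powr (-\<alpha>) < t powr (-\<alpha>) + e"
        "inverse ((1 + \<eta>) * (inverse t / (1 + \<eta>)) powr (-\<alpha>)) > t powr (-\<alpha>) - e"
      using eventually_happens'[OF trivial_limit_at_right_real] by blast
    define c where "c = (1 + \<eta>) * (inverse t / (1 + \<eta>)) powr (-\<alpha>)"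
    have "c > 0" using \<eta> t by (simp add: c_def)
    have "filterlim (\<lambda>y. t * y) at_top at_top"
      using t by (intro filterlim_tendsto_pos_mult_at_top[OF tendsto_const _ filterlim_ident]) auto
    from eventually_compose_filterlim[OF upper[of "inverse t" \<eta>] this]
    have "\<forall>\<^sub>F y in at_top. F (inverse t * (t * y)) \<le> c * F (t * y)" using t \<eta> by (simp add: c_def)
    with upper[OF t \<eta>(1)] show "\<forall>\<^sub>F y in at_top. dist (F (t * y) / F y) (t powr (-\<alpha>)) < e"
    proof eventually_elim
      case (elim y)
      have "F y \<le> c * F (t * y)" using elim t by (simp flip: mult.assoc)
      then have "inverse c \<le> F (t * y) / F y"
        using \<open>c > 0\<close> Fpos[of y] by (simp add: field_simps)
      moreover have "F (t * y) / F y \<le> (1 + \<eta>) * (t / (1 + \<eta>)) powr (-\<alpha>)"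
        using elim Fpos[of y] by (simp add: field_simps)
      ultimately show ?case using \<eta> by (simp add: dist_real_def c_def[symmetric])
    qed
  qed
qed

text \<open>The generalised inverse a u = Inf {y. F y \<le> p / u} satisfies u F (a u) \<longrightarrow> p even though F may
jump, because regular variation makes the values of F at z a and at a / z comparable for z near 1.
Comparing F (z a u) with the level p / (t u) then shows that a (t u) / a u tends to t^(1/\<alpha>).\<close>

lemma regularly_varying_inverse:
  fixes F :: "real \<Rightarrow> real"
  assumes anti: "\<And>x y. x \<le> y \<Longrightarrow> F y \<le> F x" and pos: "\<And>x. F x > 0" and F0: "(F \<longlongrightarrow> 0) at_top"
    and RV: "\<And>t. t > 0 \<Longrightarrow> ((\<lambda>y. F (t * y) / F y) \<longlongrightarrow> t powr (-\<alpha>)) at_top"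
    and "\<alpha> > 0" "p > 0"
  shows "\<exists>f\<^sub>2. slowly_varying f\<^sub>2 \<and> filterlim (\<lambda>u. f\<^sub>2 u * u powr (1 / \<alpha>)) at_top at_top \<and>
     (\<forall>x>0. ((\<lambda>u. u * F (x * (f\<^sub>2 u * u powr (1 / \<alpha>)))) \<longlongrightarrow> p * x powr (-\<alpha>)) at_top)"
proof -
  define S where "S u = {y. y \<ge> 1 \<and> F y \<le> p / u}" for u
  define a where "a u = Inf (S u)" for u
  have ne: "S u \<noteq> {}" if "u > 0" for u
  proof -
    have "\<forall>\<^sub>F y in at_top. F y < p / u" using that assms by (intro order_tendstoD(2)[OF F0]) auto
    then have "\<forall>\<^sub>F y in at_top. y \<in> S u"
      using eventually_ge_at_top[of 1] by eventually_elim (simp add: S_def)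
    then show ?thesis by (metis empty_iff eventually_False trivial_limit_at_top_linorder eventually_mono)
  qed
  have bdd: "bdd_below (S u)" for u by (rule bdd_belowI[of _ 1]) (simp add: S_def)
  have a1: "a u \<ge> 1" if "u > 0" for u
    unfolding a_def using ne[OF that] by (intro cInf_greatest) (auto simp: S_def)
  have a_le: "a u \<le> y" if "y \<ge> 1" "F y \<le> p / u" for u y
    unfolding a_def using that bdd by (intro cInf_lower) (auto simp: S_def)
  have a_ge: "a u \<ge> y" if "u > 0" "F y > p / u" for u y
    unfolding a_def
  proof (rule cInf_greatest[OF ne[OF that(1)]])
    fix z assume "z \<in> S u"
    then have "F z < F y" using that by (simp add: S_def)
    then show "y \<le> z" using anti[of z y] by linarith
  qed
  have F_gt: "F y \<le> p / u" if "u > 0" "y > a u" for u y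
  proof -
    from that(2) have "\<exists>z\<in>S u. z < y" unfolding a_def by (subst (asm) cInf_less_iff[OF ne[OF that(1)] bdd])
    then obtain z where "z < y" "F z \<le> p / u" by (auto simp: S_def)
    then show ?thesis using anti[of z y] by linarith
  qed
  have a_top: "filterlim a at_top at_top"
    unfolding filterlim_at_top
  proof
    fix Y
    show "\<forall>\<^sub>F u in at_top. Y \<le> a u"
      using eventually_gt_at_top[of "p / F Y"] eventually_gt_at_top[of 0]
    proof eventually_elim
      case (elim u)
      then show ?case using pos[of Y] by (intro a_ge) (auto simp: field_simps)
    qed
  qed
  have RVa: "((\<lambda>u. F (t * a u) / F (a u)) \<longlongrightarrow> t powr (-\<alpha>)) at_top" if "t > 0" for t
    by (rule filterlim_compose[OF RV[OF that] a_top])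
  have lim1: "((\<lambda>u. u * F (a u)) \<longlongrightarrow> p) at_top"
  proof (rule tendstoI)
    fix e :: real assume "e > 0"
    have "((\<lambda>z. p * z powr \<alpha>) \<longlongrightarrow> p * 1 powr \<alpha>) (at_right 1)" "((\<lambda>z. p * z powr (-\<alpha>)) \<longlongrightarrow> p * 1 powr (-\<alpha>)) (at_right 1)"
      by (intro tendsto_intros; simp)+
    then have "\<forall>\<^sub>F z in at_right 1. p * z powr \<alpha> < p + e" "\<forall>\<^sub>F z in at_right 1. p * z powr (-\<alpha>) > p - e"
      using \<open>e > 0\<close> by (auto intro: order_tendstoD)
    moreover have "\<forall>\<^sub>F z in at_right (1::real). z > 1" by (rule eventually_at_right_less)
    ultimately have "\<forall>\<^sub>F z in at_right 1. z > 1 \<and> p * z powr \<alpha> < p + e \<and> p * z powr (-\<alpha>) > p - e"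
      by eventually_elim simp
    then obtain z where z: "z > 1" "p * z powr \<alpha> < p + e" "p * z powr (-\<alpha>) > p - e"
      using eventually_happens'[OF trivial_limit_at_right_real] by blast
    have "\<forall>\<^sub>F u in at_top. p * inverse (F (z * a u) / F (a u)) < p + e"
    proof (rule order_tendstoD(2))
      show "((\<lambda>u. p * inverse (F (z * a u) / F (a u))) \<longlongrightarrow> p * inverse (z powr (-\<alpha>))) at_top"
        using z by (intro tendsto_intros RVa) auto
      show "p * inverse (z powr (-\<alpha>)) < p + e" using z by (simp add: powr_minus)
    qed
    moreover have "\<forall>\<^sub>F u in at_top. p * inverse (F (inverse z * a u) / F (a u)) > p - e"
    proof (rule order_tendstoD(1))
      show "((\<lambda>u. p * inverse (F (inverse z * a u) / F (a u))) \<longlongrightarrow> p * inverse (inverse z powr (-\<alpha>))) at_top"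
        using z by (intro tendsto_intros RVa) auto
      show "p - e < p * inverse (inverse z powr (-\<alpha>))" using z by (simp add: powr_minus inverse_powr)
    qed
    moreover have "\<forall>\<^sub>F u in at_top. a u > z" using a_top by (simp add: filterlim_at_top_dense)
    ultimately show "\<forall>\<^sub>F u in at_top. dist (u * F (a u)) p < e"
      using eventually_gt_at_top[of 0]
    proof eventually_elim
      case (elim u)
      have au: "a u > 0" using a1[of u] elim by linarith
      have "F (z * a u) \<le> p / u" using z elim au by (intro F_gt) auto
      then have "u * F (a u) \<le> p * inverse (F (z * a u) / F (a u))"
        using elim pos[of "a u"] pos[of "z * a u"] by (simp add: field_simps)
      moreover have "F (inverse z * a u) > p / u"
      proof (rule ccontr)
        assume "\<not> ?thesis"
        then have "a u \<le> inverse z * a u" using z elim by (intro a_le) (auto simp: field_simps)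
        then show False using z au by (simp add: field_simps)
      qed
      then have "u * F (a u) \<ge> p * inverse (F (inverse z * a u) / F (a u))"
        using elim pos[of "a u"] pos[of "inverse z * a u"] by (simp add: field_simps)
      ultimately show ?case using elim by (simp add: dist_real_def)
    qed
  qed
  have lim: "((\<lambda>u. u * F (x * a u)) \<longlongrightarrow> p * x powr (-\<alpha>)) at_top" if "x > 0" for x
  proof -
    have "((\<lambda>u. (u * F (a u)) * (F (x * a u) / F (a u))) \<longlongrightarrow> p * x powr (-\<alpha>)) at_top"
      by (intro tendsto_mult lim1 RVa that)
    moreover have "(u * F (a u)) * (F (x * a u) / F (a u)) = u * F (x * a u)" for u
      using pos[of "a u"] by simp
    ultimately show ?thesis by simp
  qed
  have ratio: "((\<lambda>u. a (t * u) / a u) \<longlongrightarrow> t powr (1 / \<alpha>)) at_top" if t: "t > 0" for t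
  proof (rule order_tendstoI)
    fix z assume z: "z > t powr (1 / \<alpha>)"
    obtain z' where z': "t powr (1 / \<alpha>) < z'" "z' < z" using dense[OF z] by blast
    have "z' > 0" using z'(1) powr_ge_zero[of t "1 / \<alpha>"] by linarith
    have "t < z' powr \<alpha>" using powr_less_mono2[OF \<open>\<alpha> > 0\<close> _ z'(1)] t \<open>\<alpha> > 0\<close> by (simp add: powr_powr)
    then have "t * (p * z' powr (-\<alpha>)) < p"
      using \<open>p > 0\<close> \<open>z' > 0\<close> by (simp add: powr_minus field_simps)
    moreover have "((\<lambda>u. t * (u * F (z' * a u))) \<longlongrightarrow> t * (p * z' powr (-\<alpha>))) at_top"
      by (intro tendsto_intros lim \<open>z' > 0\<close>)
    ultimately have "\<forall>\<^sub>F u in at_top. t * (u * F (z' * a u)) < p" by (rule order_tendstoD(2)[rotated])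
    moreover have "\<forall>\<^sub>F u in at_top. a u > 1 / z'" using a_top by (simp add: filterlim_at_top_dense)
    ultimately show "\<forall>\<^sub>F u in at_top. a (t * u) / a u < z"
      using eventually_gt_at_top[of 0]
    proof eventually_elim
      case (elim u)
      have au: "a u > 0" using a1[of u] elim by linarith
      have "a (t * u) \<le> z' * a u"
        using elim t \<open>z' > 0\<close> by (intro a_le) (auto simp: field_simps)
      then show ?case using au z' by (simp add: pos_divide_less_eq) (metis mult_less_cancel_right_pos order_le_less_trans)
    qed
  next
    fix z assume z: "z < t powr (1 / \<alpha>)"
    show "\<forall>\<^sub>F u in at_top. z < a (t * u) / a u"
    proof (cases "z > 0")
      case False
      show ?thesis
        using eventually_gt_at_top[of 0]
      proof eventually_elim
        case (elim u)
        then have "a u > 0" "a (t * u) > 0" using a1[of u] a1[of "t * u"] t by fastforce+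
        then have "a (t * u) / a u > 0" by simp
        then show ?case using False by linarith
      qed
    next
      case True
      obtain z' where z': "z < z'" "z' < t powr (1 / \<alpha>)" using dense[OF z] by blast
      have "z' > 0" using z' True by linarith
      have "z' powr \<alpha> < t" using powr_less_mono2[OF \<open>\<alpha> > 0\<close> _ z'(2)] t \<open>\<alpha> > 0\<close> \<open>z' > 0\<close> by (simp add: powr_powr)
      then have "t * (p * z' powr (-\<alpha>)) > p"
        using \<open>p > 0\<close> \<open>z' > 0\<close> by (simp add: powr_minus field_simps)
      moreover have "((\<lambda>u. t * (u * F (z' * a u))) \<longlongrightarrow> t * (p * z' powr (-\<alpha>))) at_top"
        by (intro tendsto_intros lim \<open>z' > 0\<close>)
      ultimately have "\<forall>\<^sub>F u in at_top. t * (u * F (z' * a u)) > p" by (rule order_tendstoD(1)[rotated])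
      then show ?thesis
        using eventually_gt_at_top[of 0]
      proof eventually_elim
        case (elim u)
        have au: "a u > 0" using a1[of u] elim by linarith
        have "a (t * u) \<ge> z' * a u"
          using elim t by (intro a_ge) (auto simp: field_simps)
        then show ?case using au z' by (simp add: pos_less_divide_eq) (metis mult_less_cancel_right_pos order_less_le_trans)
      qed
    qed
  qed
  define f2 where "f2 u = a u * u powr (- 1 / \<alpha>)" for u
  have f2a: "f2 u * u powr (1 / \<alpha>) = a u" if "u > 0" for u
    using that by (simp add: f2_def mult.assoc flip: powr_add)
  have ev: "\<forall>\<^sub>F u in at_top. f2 u * u powr (1 / \<alpha>) = a u"
    using eventually_gt_at_top[of 0] by eventually_elim (rule f2a)
  have "slowly_varying f2"
    unfolding slowly_varying_def
  proof (intro conjI exI[of _ 1] allI impI)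
    have "mono_on {1..} a"
    proof (rule mono_onI)
      fix u v :: real assume uv: "u \<in> {1..}" "v \<in> {1..}" "u \<le> v"
      then have "p / v \<le> p / u" using \<open>p > 0\<close> by (intro divide_left_mono) auto
      then have "S v \<subseteq> S u" by (auto simp: S_def)
      then show "a u \<le> a v" unfolding a_def using ne[of v] uv bdd by (intro cInf_superset_mono) auto
    qed
    from borel_measurable_mono_on_fnc[OF this]
    have [measurable]: "a \<in> borel_measurable (restrict_space borel {1..})" .
    have [measurable]: "(\<lambda>u. u) \<in> borel_measurable (restrict_space borel {1::real..})"
      by (rule measurable_restrict_space1) simp
    show "f2 \<in> borel_measurable (restrict_space borel {1..})"
      unfolding f2_def by measurable
    fix x :: real assume "1 \<le> x"
    then have "x > 0" "a x \<ge> 1" using a1[of x] by auto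
    then show "f2 x > 0" by (auto simp: f2_def)
  next
    fix t :: real assume t: "t > 0"
    have "((\<lambda>u. a (t * u) / a u * t powr (- 1 / \<alpha>)) \<longlongrightarrow> t powr (1 / \<alpha>) * t powr (- 1 / \<alpha>)) at_top"
      by (intro tendsto_mult ratio t tendsto_const)
    also have "t powr (1 / \<alpha>) * t powr (- 1 / \<alpha>) = 1" using t by (simp flip: powr_add)
    finally show "((\<lambda>u. f2 (t * u) / f2 u) \<longlongrightarrow> 1) at_top"
    proof (rule Lim_transform_eventually)
      show "\<forall>\<^sub>F u in at_top. a (t * u) / a u * t powr (- 1 / \<alpha>) = f2 (t * u) / f2 u"
        using eventually_gt_at_top[of 0] by eventually_elim (use t in \<open>simp add: f2_def powr_mult\<close>)
    qed
  qed
  moreover have "filterlim (\<lambda>u. f2 u * u powr (1 / \<alpha>)) at_top at_top"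
    using a_top by (rule filterlim_cong[THEN iffD2, rotated 3]) (auto simp: ev)
  moreover have "((\<lambda>u. u * F (x * (f2 u * u powr (1 / \<alpha>)))) \<longlongrightarrow> p * x powr (-\<alpha>)) at_top" if "x > 0" for x
    by (rule Lim_transform_eventually[OF lim[OF that]]) (use ev in eventually_elim, simp)
  ultimately show ?thesis by blast
qed

section \<open>Sums over words and the cycle lemma\<close>

abbreviation nat_sum :: "(nat \<Rightarrow> ennreal) \<Rightarrow> ennreal" where
  "nat_sum f \<equiv> \<integral>\<^sup>+d. f d \<partial>count_space UNIV"

text \<open>The sum over all words of length m of a function of the multiset of their letters. Using
multisets as arguments builds exchangeability into the summands.\<close>

primrec word_sum :: "nat \<Rightarrow> (nat multiset \<Rightarrow> ennreal) \<Rightarrow> ennreal" where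
  "word_sum 0 g = g {#}"
| "word_sum (Suc m) g = nat_sum (\<lambda>d. word_sum m (\<lambda>M. g (add_mset d M)))"

lemma nat_sum_swap: "nat_sum (\<lambda>x. nat_sum (\<lambda>y. f x y)) = nat_sum (\<lambda>y. nat_sum (\<lambda>x. f x y))"
  using nn_integral_fst_count_space[of "\<lambda>(x,y). f x y"]
    nn_integral_snd_count_space[of "\<lambda>(x,y). f x y"] by simp

lemma nat_sum_single: "nat_sum (\<lambda>d. if d + s = m then F d else 0) = (if s \<le> m then F (m - s) else 0)"
proof (cases "s \<le> m")
  case True
  have "nat_sum (\<lambda>d. if d + s = m then F d else 0) = (\<Sum>d\<in>{m - s}. if d + s = m then F d else 0)"
    by (rule nn_integral_count_space') (use True in auto)
  with True show ?thesis by simp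
next
  case False
  then have "(\<lambda>d. if d + s = m then F d else 0) = (\<lambda>d. 0)" by auto
  with False show ?thesis by simp
qed

lemma word_sum_cong:
  "(\<And>M. size M = m \<Longrightarrow> f M = g M) \<Longrightarrow> word_sum m f = word_sum m g"
proof (induction m arbitrary: f g)
  case (Suc m)
  have "word_sum m (\<lambda>M. f (add_mset d M)) = word_sum m (\<lambda>M. g (add_mset d M))" for d
    by (rule Suc.IH) (simp add: Suc.prems)
  then show ?case by simp
qed simp

lemma word_sum_mono:
  "(\<And>M. size M = m \<Longrightarrow> f M \<le> g M) \<Longrightarrow> word_sum m f \<le> word_sum m g"
proof (induction m arbitrary: f g)
  case (Suc m)
  have "word_sum m (\<lambda>M. f (add_mset d M)) \<le> word_sum m (\<lambda>M. g (add_mset d M))" for d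
    by (rule Suc.IH) (simp add: Suc.prems)
  then show ?case by (auto intro!: nn_integral_mono)
qed simp

lemma word_sum_add: "word_sum m (\<lambda>M. f M + g M) = word_sum m f + word_sum m g"
  by (induction m arbitrary: f g) (simp_all add: nn_integral_add)

lemma word_sum_cmult: "word_sum m (\<lambda>M. c * f M) = c * word_sum m f"
  by (induction m arbitrary: f) (simp_all add: nn_integral_cmult)

lemma word_sum_zero [simp]: "word_sum m (\<lambda>M. 0) = 0"
  by (induction m) simp_all

lemma word_sum_nat_sum: "word_sum m (\<lambda>M. nat_sum (\<lambda>d. g d M)) = nat_sum (\<lambda>d. word_sum m (g d))"
proof (induction m arbitrary: g)
  case (Suc m)
  have "word_sum (Suc m) (\<lambda>M. nat_sum (\<lambda>d. g d M)) = nat_sum (\<lambda>e. nat_sum (\<lambda>d. word_sum m (\<lambda>M. g d (add_mset e M))))"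
    by (simp add: Suc.IH)
  also have "\<dots> = nat_sum (\<lambda>d. word_sum (Suc m) (g d))"
    by (subst nat_sum_swap) simp
  finally show ?case .
qed simp

text \<open>By exchangeability, each of the Suc m positions contributes as much as the first one.\<close>

lemma word_sum_select_letter:
  "word_sum (Suc m) (\<lambda>M. (\<Sum>d\<in>#M. \<phi> d) * g M) =
    of_nat (Suc m) * nat_sum (\<lambda>d. \<phi> d * word_sum m (\<lambda>M. g (add_mset d M)))"
proof (induction m arbitrary: g)
  case (Suc m)
  have "word_sum (Suc (Suc m)) (\<lambda>M. (\<Sum>d\<in>#M. \<phi> d) * g M) =
      nat_sum (\<lambda>e. word_sum (Suc m) (\<lambda>M. \<phi> e * g (add_mset e M) + (\<Sum>d\<in>#M. \<phi> d) * g (add_mset e M)))"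
    by (subst word_sum.simps) (simp add: distrib_right del: word_sum.simps)
  also have "\<dots> = nat_sum (\<lambda>e. \<phi> e * word_sum (Suc m) (\<lambda>M. g (add_mset e M)) +
      of_nat (Suc m) * nat_sum (\<lambda>d. \<phi> d * word_sum m (\<lambda>M. g (add_mset e (add_mset d M)))))"
    by (simp only: word_sum_add word_sum_cmult Suc.IH)
  also have "\<dots> = nat_sum (\<lambda>e. \<phi> e * word_sum (Suc m) (\<lambda>M. g (add_mset e M))) +
      of_nat (Suc m) * nat_sum (\<lambda>e. nat_sum (\<lambda>d. \<phi> d * word_sum m (\<lambda>M. g (add_mset e (add_mset d M)))))"
    by (simp add: nn_integral_add nn_integral_cmult del: word_sum.simps of_nat_Suc)
  also have "nat_sum (\<lambda>e. nat_sum (\<lambda>d. \<phi> d * word_sum m (\<lambda>M. g (add_mset e (add_mset d M))))) =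
      nat_sum (\<lambda>d. \<phi> d * word_sum (Suc m) (\<lambda>M. g (add_mset d M)))"
    by (subst nat_sum_swap) (simp add: nn_integral_cmult add_mset_commute)
  finally show ?case by (simp add: distrib_right del: word_sum.simps)
qed (simp add: nn_integral_cmult)

text \<open>The sum over Lukasiewicz words started at height j: reading a letter d changes the height by d - 1,
and the word ends when the height reaches 0 for the first time.\<close>

fun luk_sum :: "nat \<Rightarrow> nat \<Rightarrow> (nat multiset \<Rightarrow> ennreal) \<Rightarrow> ennreal" where
  "luk_sum 0 0 g = g {#}"
| "luk_sum 0 (Suc m) g = 0"
| "luk_sum (Suc j) 0 g = 0"
| "luk_sum (Suc j) (Suc m) g = nat_sum (\<lambda>d. luk_sum (j + d) m (\<lambda>M. g (add_mset d M)))"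

text \<open>The cycle lemma: among the orderings of a word of length m whose steps add up to -j, the proportion
j / m stays positive until the end. No rotation is needed: conditioning on the first letter d
leads to height j - 1 + d, and averaging this over the letters gives the sum of j - 1 + d over the word,
which equals (m - 1) j when the word has length m.\<close>

lemma luk_sum_cycle:
  "of_nat m * luk_sum j m g = of_nat j * word_sum m (\<lambda>M. if sum_mset M + j = m then g M else 0)"
proof (induction m arbitrary: j g)
  case 0
  then show ?case by (cases j) auto
next
  case (Suc m)
  show ?case
  proof (cases j)
    case 0
    then show ?thesis by simp
  next
    case j: (Suc j')
    show ?thesis
    proof (cases "m = 0")
      case True
      have "luk_sum (j' + d) 0 (\<lambda>M. g (add_mset d M)) = of_nat j * (if d + j' = 0 then g {#d#} else 0)" for d
        by (cases "j' + d") (auto simp: j)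
      then show ?thesis using True j by (simp add: nn_integral_cmult)
    next
      case False
      define h where "h M = (if sum_mset M + j' = m then g M else 0)" for M
      have "of_nat m * (of_nat (Suc m) * luk_sum j (Suc m) g) =
          of_nat (Suc m) * nat_sum (\<lambda>d. of_nat m * luk_sum (j' + d) m (\<lambda>M. g (add_mset d M)))"
        by (simp add: j nn_integral_cmult mult_ac)
      also have "\<dots> = of_nat (Suc m) * nat_sum (\<lambda>d. of_nat (j' + d) * word_sum m (\<lambda>M. h (add_mset d M)))"
        unfolding Suc.IH by (simp add: h_def add_ac)
      also have "\<dots> = word_sum (Suc m) (\<lambda>M. (\<Sum>d\<in>#M. of_nat (j' + d)) * h M)"
        by (rule word_sum_select_letter[symmetric])
      also have "\<dots> = word_sum (Suc m) (\<lambda>M. of_nat (m * j) * h M)"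
      proof (rule word_sum_cong)
        fix M :: "nat multiset" assume M: "size M = Suc m"
        have sum: "(\<Sum>d\<in>#M. of_nat (j' + d)) = (of_nat (size M * j' + sum_mset M) :: ennreal)"
          by (induction M) (simp_all add: algebra_simps)
        show "(\<Sum>d\<in>#M. of_nat (j' + d)) * h M = of_nat (m * j) * h M"
        proof (cases "sum_mset M + j' = m")
          case True
          then have "size M * j' + sum_mset M = m * j"
            using M j by (auto simp: algebra_simps)
          with sum show ?thesis by (simp only:)
        qed (simp add: h_def)
      qed
      also have "\<dots> = of_nat m * (of_nat j * word_sum (Suc m) h)"
        unfolding word_sum_cmult by (simp add: mult_ac)
      finally have "of_nat m * (of_nat (Suc m) * luk_sum j (Suc m) g) = of_nat m * (of_nat j * word_sum (Suc m) h)" .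
      moreover have "h = (\<lambda>M. if sum_mset M + j = Suc m then g M else 0)"
        by (auto simp: h_def j)
      ultimately show ?thesis
        using False by (subst (asm) ennreal_mult_cancel_left) auto
    qed
  qed
qed

definition all_words :: "(nat multiset \<Rightarrow> ennreal) \<Rightarrow> ennreal" where
  "all_words g = (\<Sum>m. word_sum m g)"

text \<open>The contents of finite trees, each tree being represented by the orderings of its outdegrees
through the cycle lemma with j = 1; the index m is the number of edges.\<close>

definition tree_sum :: "(nat multiset \<Rightarrow> ennreal) \<Rightarrow> ennreal" where
  "tree_sum g = (\<Sum>m. word_sum (Suc m) (\<lambda>M. if sum_mset M = m then g M else 0) / of_nat (Suc m))"

lemma divide_of_nat_SucI: "x = of_nat (Suc m) * y \<Longrightarrow> x / of_nat (Suc m) = (y :: ennreal)"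
  using ennreal_mult_divide_eq[of "of_nat (Suc m)" y] by (simp add: mult.commute del: of_nat_Suc)

lemma luk_sum_tree_sum: "(\<Sum>m. luk_sum 1 m g) = tree_sum g"
proof -
  have "luk_sum 1 (Suc m) g = word_sum (Suc m) (\<lambda>M. if sum_mset M = m then g M else 0) / of_nat (Suc m)" for m
  proof -
    have "of_nat (Suc m) * luk_sum 1 (Suc m) g = word_sum (Suc m) (\<lambda>M. if sum_mset M = m then g M else 0)"
      unfolding luk_sum_cycle by simp
    then show ?thesis
      by (metis divide_of_nat_SucI)
  qed
  moreover have "(\<Sum>m. luk_sum 1 m g) = luk_sum 1 0 g + (\<Sum>m. luk_sum 1 (Suc m) g)"
    by (subst suminf_offset[of _ 1]) (auto simp: numeral_eq_Suc)
  ultimately show ?thesis by (simp add: tree_sum_def)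
qed

lemma all_words_mono: "(\<And>M. f M \<le> g M) \<Longrightarrow> all_words f \<le> all_words g"
  unfolding all_words_def by (intro suminf_le word_sum_mono) auto

lemma all_words_add: "all_words (\<lambda>M. f M + g M) = all_words f + all_words g"
  unfolding all_words_def word_sum_add by (rule suminf_add[symmetric]) auto

lemma all_words_cmult: "all_words (\<lambda>M. c * f M) = c * all_words f"
  unfolding all_words_def word_sum_cmult by (rule ennreal_suminf_cmult)

lemma tree_sum_mono: "(\<And>M. size M = Suc (sum_mset M) \<Longrightarrow> f M \<le> g M) \<Longrightarrow> tree_sum f \<le> tree_sum g"
  unfolding tree_sum_def by (intro suminf_le divide_right_mono_ennreal word_sum_mono) auto

lemma tree_sum_add: "tree_sum (\<lambda>M. f M + g M) = tree_sum f + tree_sum g"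
proof -
  have "word_sum m (\<lambda>M. if sum_mset M = m' then f M + g M else 0) =
     word_sum m (\<lambda>M. if sum_mset M = m' then f M else 0) + word_sum m (\<lambda>M. if sum_mset M = m' then g M else 0)" for m m'
    unfolding word_sum_add[symmetric] by (rule word_sum_cong) auto
  then show ?thesis
    unfolding tree_sum_def by (simp add: add_divide_distrib_ennreal suminf_add[symmetric] del: word_sum.simps of_nat_Suc)
qed

lemma tree_sum_le_all_words: "tree_sum g \<le> all_words g"
proof -
  have "word_sum (Suc m) (\<lambda>M. if sum_mset M = m then g M else 0) / of_nat (Suc m) \<le> word_sum (Suc m) g" for m
  proof -
    have "word_sum (Suc m) (\<lambda>M. if sum_mset M = m then g M else 0) \<le> 1 * word_sum (Suc m) g"
      by (simp del: word_sum.simps) (rule word_sum_mono, auto)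
    also have "\<dots> \<le> of_nat (Suc m) * word_sum (Suc m) g"
      by (rule mult_right_mono) (auto simp: add_increasing2)
    finally show ?thesis
      by (intro divide_le_posI_ennreal) (metis of_nat_0_eq_iff nat.distinct(1) zero_less_iff_neq_zero)
  qed
  then have "tree_sum g \<le> (\<Sum>m. word_sum (Suc m) g)"
    unfolding tree_sum_def by (intro suminf_le) auto
  also have "\<dots> \<le> word_sum 0 g + (\<Sum>m. word_sum (Suc m) g)" by (simp del: word_sum.simps)
  also have "\<dots> = all_words g"
    unfolding all_words_def by (subst (2) suminf_offset[of _ 1]) (auto simp: numeral_eq_Suc)
  finally show ?thesis .
qed

definition word_weight :: "(nat \<Rightarrow> ennreal) \<Rightarrow> nat multiset \<Rightarrow> ennreal" where
  "word_weight w M = (\<Prod>d\<in>#M. w d)"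

lemma word_weight_simps [simp]: "word_weight w {#} = 1" "word_weight w (add_mset d M) = w d * word_weight w M"
  by (simp_all add: word_weight_def)

text \<open>Distinguishing one letter cancels the factor 1 / length, and the constraint on the letter sum
determines the distinguished letter from the others.\<close>

lemma tree_sum_select_letter:
  "tree_sum (\<lambda>M. (\<Sum>d\<in>#M. \<phi> d) * (word_weight w M * g M)) =
    all_words (\<lambda>M. word_weight w M * (if sum_mset M \<le> size M then 
       (\<lambda>d. \<phi> d * w d * g (add_mset d M)) (size M - sum_mset M) else 0))"
proof -
  have "word_sum (Suc m) (\<lambda>M. if sum_mset M = m then (\<Sum>d\<in>#M. \<phi> d) * (word_weight w M * g M) else 0) / of_nat (Suc m) =
      word_sum m (\<lambda>M. word_weight w M * (if sum_mset M \<le> size M then 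
       (\<lambda>d. \<phi> d * w d * g (add_mset d M)) (size M - sum_mset M) else 0))" for m
  proof -
    have "word_sum (Suc m) (\<lambda>M. if sum_mset M = m then (\<Sum>d\<in>#M. \<phi> d) * (word_weight w M * g M) else 0) =
      word_sum (Suc m) (\<lambda>M. (\<Sum>d\<in>#M. \<phi> d) * (if sum_mset M = m then word_weight w M * g M else 0))"
      by (rule word_sum_cong) auto
    also have "\<dots> = of_nat (Suc m) * nat_sum (\<lambda>d. word_sum m (\<lambda>M. if d + sum_mset M = m then \<phi> d * (word_weight w (add_mset d M) * g (add_mset d M)) else 0))"
    proof -
      have "\<phi> d * word_sum m (\<lambda>M. if sum_mset (add_mset d M) = m then word_weight w (add_mset d M) * g (add_mset d M) else 0) =
        word_sum m (\<lambda>M. if d + sum_mset M = m then \<phi> d * (word_weight w (add_mset d M) * g (add_mset d M)) else 0)" for d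
        unfolding word_sum_cmult[symmetric] by (rule word_sum_cong) auto
      then show ?thesis unfolding word_sum_select_letter by (simp only:)
    qed
    also have "\<dots> = of_nat (Suc m) * word_sum m (\<lambda>M. nat_sum (\<lambda>d. if d + sum_mset M = m then \<phi> d * (word_weight w (add_mset d M) * g (add_mset d M)) else 0))"
      unfolding word_sum_nat_sum ..
    also have "\<dots> = of_nat (Suc m) * word_sum m (\<lambda>M. word_weight w M * (if sum_mset M \<le> size M then 
       (\<lambda>d. \<phi> d * w d * g (add_mset d M)) (size M - sum_mset M) else 0))"
    proof -
      have "word_sum m (\<lambda>M. if sum_mset M \<le> m then
           \<phi> (m - sum_mset M) * (word_weight w (add_mset (m - sum_mset M) M) * g (add_mset (m - sum_mset M) M)) else 0) =
         word_sum m (\<lambda>M. word_weight w M * (if sum_mset M \<le> size M then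
           (\<lambda>d. \<phi> d * w d * g (add_mset d M)) (size M - sum_mset M) else 0))"
        by (rule word_sum_cong) (simp add: mult_ac)
      then show ?thesis unfolding nat_sum_single by (simp only:)
    qed
    finally show ?thesis
      by (rule divide_of_nat_SucI)
  qed
  then show ?thesis unfolding tree_sum_def all_words_def by simp
qed

definition letters_in :: "nat set \<Rightarrow> nat multiset \<Rightarrow> nat" where
  "letters_in \<Omega> M = size (filter_mset (\<lambda>d. d \<in> \<Omega>) M)"

lemma letters_in_simps [simp]: "letters_in \<Omega> {#} = 0" 
  "letters_in \<Omega> (add_mset d M) = (if d \<in> \<Omega> then Suc (letters_in \<Omega> M) else letters_in \<Omega> M)"
  by (simp_all add: letters_in_def)

lemma word_sum_count:
  assumes A: "nat_sum (\<lambda>d. w d * indicator \<Omega> d) = ennreal a" and B: "nat_sum (\<lambda>d. w d * indicator (-\<Omega>) d) = ennreal b"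
    and ab: "a \<ge> 0" "b \<ge> 0"
  shows "word_sum m (\<lambda>M. word_weight w M * of_bool (letters_in \<Omega> M = n)) = ennreal (real (m choose n) * a ^ n * b ^ (m - n))"
proof (induction m arbitrary: n)
  case 0
  then show ?case by (cases n) auto
next
  case (Suc m)
  have "word_sum (Suc m) (\<lambda>M. word_weight w M * of_bool (letters_in \<Omega> M = n)) = 
     nat_sum (\<lambda>d. w d * indicator \<Omega> d * word_sum m (\<lambda>M. word_weight w M * of_bool (Suc (letters_in \<Omega> M) = n)) +
           w d * indicator (-\<Omega>) d * word_sum m (\<lambda>M. word_weight w M * of_bool (letters_in \<Omega> M = n)))"
    by (simp, rule nn_integral_cong) (simp add: word_sum_cmult[symmetric] mult.assoc indicator_def)
  also have "\<dots> = ennreal a * word_sum m (\<lambda>M. word_weight w M * of_bool (Suc (letters_in \<Omega> M) = n)) +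
       ennreal b * word_sum m (\<lambda>M. word_weight w M * of_bool (letters_in \<Omega> M = n))"
    by (simp add: nn_integral_add nn_integral_multc A B)
  also have "\<dots> = ennreal (real (Suc m choose n) * a ^ n * b ^ (Suc m - n))"
  proof (cases n)
    case 0
    with 0 Suc[of 0] ab show ?thesis by (simp add: ennreal_mult)
  next
    case (Suc k)
    have "ennreal a * word_sum m (\<lambda>M. word_weight w M * of_bool (Suc (letters_in \<Omega> M) = n)) + ennreal b * word_sum m (\<lambda>M. word_weight w M * of_bool (letters_in \<Omega> M = n))
       = ennreal (a * (real (m choose k) * a ^ k * b ^ (m - k)) + b * (real (m choose Suc k) * a ^ Suc k * b ^ (m - Suc k)))"
      unfolding Suc using Suc.IH[of k] Suc.IH[of "Suc k"] ab by (simp add: ennreal_mult' ennreal_plus)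
    also have "a * (real (m choose k) * a ^ k * b ^ (m - k)) + b * (real (m choose Suc k) * a ^ Suc k * b ^ (m - Suc k)) = 
       real (Suc m choose n) * a ^ n * b ^ (Suc m - n)"
    proof (cases "Suc k \<le> m")
      case True
      then have "b * b ^ (m - Suc k) = b ^ (m - k)" by (metis Suc_diff_Suc Suc_le_lessD power_Suc)
      then have e: "b * (real (m choose Suc k) * a ^ Suc k * b ^ (m - Suc k)) = real (m choose Suc k) * a ^ Suc k * b ^ (m - k)"
        by (metis mult.left_commute)
      show ?thesis unfolding e Suc by (simp add: algebra_simps)
    next
      case False
      then show ?thesis unfolding Suc by (simp add: binomial_eq_0)
    qed
    finally show ?thesis .
  qed
  finally show ?case .
qed

text \<open>With a and b the total weights of letters inside and outside \<Omega>, words of length m contribute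
(m choose n) a^n b^(m-n); the sum over m is a negative binomial series.\<close>

lemma all_words_count:
  assumes A: "nat_sum (\<lambda>d. w d * indicator \<Omega> d) = ennreal a" and B: "nat_sum (\<lambda>d. w d * indicator (-\<Omega>) d) = ennreal b"
    and ab: "a \<ge> 0" "b \<ge> 0" "b < 1"
  shows "all_words (\<lambda>M. word_weight w M * of_bool (letters_in \<Omega> M = n)) = ennreal (a ^ n / (1 - b) ^ Suc n)"
proof -
  define f where "f m = real (m choose n) * a ^ n * b ^ (m - n)" for m
  have f0: "f m \<ge> 0" for m using ab by (simp add: f_def)
  have e: "f (k + n) = a ^ n / (1 - b) ^ Suc n * pmf (neg_binomial_pmf (Suc n) (1 - b)) k" for k
  proof -
    have "pmf (neg_binomial_pmf (Suc n) (1 - b)) k = real (k + n choose k) * (1 - b) ^ Suc n * b ^ k"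
      using ab by (subst pmf_neg_binomial) auto
    moreover have "k + n choose k = (k + n choose n)"
      by (metis add.commute binomial_symmetric diff_add_inverse2 le_add1)
    ultimately show ?thesis using ab by (simp add: f_def)
  qed
  have "all_words (\<lambda>M. word_weight w M * of_bool (letters_in \<Omega> M = n)) = (\<Sum>m. ennreal (f m))"
    unfolding all_words_def f_def by (subst word_sum_count[OF A B]) (use ab in auto)
  also have "\<dots> = (\<Sum>k. ennreal (f (k + n))) + (\<Sum>m<n. ennreal (f m))"
    by (rule suminf_offset) auto
  also have "(\<Sum>m<n. ennreal (f m)) = 0"
    by (simp add: f_def binomial_eq_0)
  also have "(\<Sum>k. ennreal (f (k + n))) = 
     ennreal (a ^ n / (1 - b) ^ Suc n) * (\<Sum>k. ennreal (pmf (neg_binomial_pmf (Suc n) (1 - b)) k))"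
    unfolding e ennreal_suminf_cmult[symmetric]
    by (rule suminf_cong, rule ennreal_mult) (use ab in auto)
  also have "(\<Sum>k. ennreal (pmf (neg_binomial_pmf (Suc n) (1 - b)) k)) = 1"
    using nn_integral_pmf_eq_1[of "neg_binomial_pmf (Suc n) (1 - b)"] by (simp add: nn_integral_count_space_nat)
  finally show ?thesis by simp
qed

section \<open>Finite plane trees\<close>

text \<open>Finite plane trees as a datatype, which provides structural induction and countability; \<open>nodes\<close>
maps them to their Ulam--Harris encoding.\<close>

datatype ptree = Node "ptree list"

instance ptree :: countable by countable_datatype

primrec nodes :: "ptree \<Rightarrow> plane_tree" where
  "nodes (Node ts) = (let Vs = map nodes ts in insert [] (\<Union>i<length Vs. (#) i ` (Vs ! i)))"

lemma nodes_Node: "nodes (Node ts) = insert [] (\<Union>i<length ts. (#) i ` nodes (ts ! i))"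
  by (auto simp: Let_def)

declare nodes.simps [simp del]

lemma Nil_in_nodes [simp]: "[] \<in> nodes t"
  by (cases t) (simp add: nodes_Node)

lemma Cons_in_nodes [simp]: "i # v \<in> nodes (Node ts) \<longleftrightarrow> i < length ts \<and> v \<in> nodes (ts ! i)"
  by (auto simp: nodes_Node)

primrec degrees :: "ptree \<Rightarrow> nat multiset" where
  "degrees (Node ts) = add_mset (length ts) (sum_list (map degrees ts))"

lemma finite_nodes [simp]: "finite (nodes t)"
proof (induction t)
  case (Node ts)
  then show ?case by (auto simp: nodes_Node)
qed

lemma outdegree_nodes_Nil [simp]: "outdegree (nodes (Node ts)) [] = length ts"
proof -
  have "{i. [] @ [i] \<in> nodes (Node ts)} = {..<length ts}" by auto
  then show ?thesis unfolding outdegree_def by (metis card_lessThan)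
qed

lemma outdegree_nodes_Cons [simp]:
  "i < length ts \<Longrightarrow> outdegree (nodes (Node ts)) (i # v) = outdegree (nodes (ts ! i)) v"
  by (simp add: outdegree_def)

lemma snoc_in_nodes: "v @ [i] \<in> nodes t \<longleftrightarrow> v \<in> nodes t \<and> i < outdegree (nodes t) v"
proof (induction v arbitrary: t)
  case Nil
  then show ?case by (cases t) simp
next
  case (Cons j v)
  show ?case by (cases t) (auto simp: Cons)
qed

lemma mset_set_UN:
  "finite I \<Longrightarrow> (\<And>i. i \<in> I \<Longrightarrow> finite (A i)) \<Longrightarrow> disjoint_family_on A I \<Longrightarrow>
    mset_set (\<Union>i\<in>I. A i) = (\<Sum>i\<in>I. mset_set (A i))"
proof (induction I rule: finite_induct)
  case (insert i I)
  have "A i \<inter> (\<Union>i\<in>I. A i) = {}"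
    using insert.hyps insert.prems(2) by (auto simp: disjoint_family_on_def)
  then have "mset_set (A i \<union> (\<Union>i\<in>I. A i)) = mset_set (A i) + mset_set (\<Union>i\<in>I. A i)"
    by (intro mset_set_Union) (use insert in auto)
  moreover have "disjoint_family_on A I"
    using insert.prems(2) by (auto simp: disjoint_family_on_def)
  ultimately show ?case using insert by simp
qed simp

lemma image_mset_sum: "image_mset f (\<Sum>i\<in>I. A i) = (\<Sum>i\<in>I. image_mset f (A i))"
  by (induction I rule: infinite_finite_induct) auto

lemma outdegrees_nodes: "image_mset (outdegree (nodes t)) (mset_set (nodes t)) = degrees t"
proof (induction t)
  case (Node ts)
  have "mset_set (nodes (Node ts)) = add_mset [] (mset_set (\<Union>i<length ts. (#) i ` nodes (ts ! i)))"
    unfolding nodes_Node by (subst mset_set.insert) auto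
  also have "mset_set (\<Union>i<length ts. (#) i ` nodes (ts ! i)) = (\<Sum>i<length ts. image_mset ((#) i) (mset_set (nodes (ts ! i))))"
    by (subst mset_set_UN) (auto simp: disjoint_family_on_def image_mset_mset_set)
  finally have "image_mset (outdegree (nodes (Node ts))) (mset_set (nodes (Node ts))) =
     add_mset (length ts) (image_mset (outdegree (nodes (Node ts))) (\<Sum>i<length ts. image_mset ((#) i) (mset_set (nodes (ts ! i)))))"
    by simp
  also have "image_mset (outdegree (nodes (Node ts))) (\<Sum>i<length ts. image_mset ((#) i) (mset_set (nodes (ts ! i)))) =
     (\<Sum>i<length ts. image_mset (outdegree (nodes (Node ts))) (image_mset ((#) i) (mset_set (nodes (ts ! i)))))"
    by (rule image_mset_sum)
  also have "\<dots> = (\<Sum>i<length ts. degrees (ts ! i))"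
  proof (rule sum.cong)
    fix i assume i: "i \<in> {..<length ts}"
    then have "image_mset (outdegree (nodes (Node ts))) (image_mset ((#) i) (mset_set (nodes (ts ! i)))) =
       image_mset (outdegree (nodes (ts ! i))) (mset_set (nodes (ts ! i)))"
      by (simp add: multiset.map_comp comp_def)
    then show "image_mset (outdegree (nodes (Node ts))) (image_mset ((#) i) (mset_set (nodes (ts ! i)))) = degrees (ts ! i)"
      using Node[of "ts ! i"] i by simp
  qed simp
  also have "\<dots> = sum_list (map degrees ts)"
    by (simp add: sum_list_sum_nth atLeast0LessThan)
  finally show ?case by simp
qed

lemma nodes_inject: "nodes t = nodes t' \<Longrightarrow> t = t'"
proof (induction t arbitrary: t')
  case (Node ts)
  obtain ts' where t': "t' = Node ts'" by (cases t')
  have len: "length ts = length ts'"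
    using Node.prems by (metis outdegree_nodes_Nil t')
  have "ts ! i = ts' ! i" if i: "i < length ts" for i
  proof (rule Node.IH)
    show "ts ! i \<in> set ts" using i by simp
    show "nodes (ts ! i) = nodes (ts' ! i)"
      using Node.prems i len by (metis Cons_in_nodes set_eqI t')
  qed
  with len show ?case by (simp add: t' nth_equalityI)
qed

abbreviation forest_degrees :: "ptree list \<Rightarrow> nat multiset" where
  "forest_degrees ts \<equiv> sum_list (map degrees ts)"

lemma degrees_nonempty: "degrees t \<noteq> {#}"
  by (cases t) simp

text \<open>Depth-first exploration. Removing the root of the first tree of a forest with Suc j trees, where the
root has degree d, leaves a forest with j + d trees and one node less. This is the recursion of
\<open>luk_sum\<close>.\<close>

lemma luk_sum_forests:
  "luk_sum j m g = (\<integral>\<^sup>+ ts. g (forest_degrees ts) \<partial>count_space {ts. length ts = j \<and> size (forest_degrees ts) = m})"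
proof (induction j m g rule: luk_sum.induct)
  case (1 g)
  have "{ts. length ts = 0 \<and> size (forest_degrees ts) = 0} = {[]}" by auto
  then show ?case by (simp add: nn_integral_count_space_finite)
next
  case (2 m g)
  have "{ts. length ts = 0 \<and> size (forest_degrees ts) = Suc m} = {}" by auto
  then show ?case by (simp add: nn_integral_empty)
next
  case (3 j g)
  have "{ts. length ts = Suc j \<and> size (forest_degrees ts) = 0} = {}"
    by (auto simp: length_Suc_conv degrees_nonempty)
  then show ?case by (simp add: nn_integral_empty)
next
  case (4 j m g)
  define A where "A = {(d, us). length us = j + d \<and> size (forest_degrees us) = m}"
  define B where "B = {ts. length ts = Suc j \<and> size (forest_degrees ts) = Suc m}"
  \<comment> \<open>\<open>un\<close> puts the root back: its children are the first d trees\<close>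
  define un where "un = (\<lambda>(d, us). Node (take d us) # drop d us)"
  have fc: "forest_degrees (un (d, us)) = add_mset d (forest_degrees us)" if "length us \<ge> d" for d us
  proof -
    have "forest_degrees us = forest_degrees (take d us @ drop d us)" by simp
    then show ?thesis using that unfolding map_append sum_list_append by (simp add: un_def)
  qed
  have bij: "bij_betw un A B"
  proof (rule bij_betwI[where g = "\<lambda>ts. case hd ts of Node cs \<Rightarrow> (length cs, cs @ tl ts)"])
    show "un \<in> A \<rightarrow> B" by (auto simp: A_def B_def fc) (auto simp: un_def)
    show "(\<lambda>ts. case hd ts of Node cs \<Rightarrow> (length cs, cs @ tl ts)) \<in> B \<rightarrow> A"
    proof
      fix ts assume "ts \<in> B"
      moreover from this obtain cs ys where "ts = Node cs # ys"
        by (auto simp: B_def length_Suc_conv) (metis ptree.exhaust)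
      ultimately show "(case hd ts of Node cs \<Rightarrow> (length cs, cs @ tl ts)) \<in> A"
        by (auto simp: A_def B_def)
    qed
    show "(case hd (un x) of Node cs \<Rightarrow> (length cs, cs @ tl (un x))) = x" if "x \<in> A" for x
      using that by (auto simp: A_def un_def)
    show "un (case hd ts of Node cs \<Rightarrow> (length cs, cs @ tl ts)) = ts" if "ts \<in> B" for ts
      using that by (auto simp: B_def un_def length_Suc_conv split: ptree.split)
  qed
  have "luk_sum (Suc j) (Suc m) g = nat_sum (\<lambda>d. \<integral>\<^sup>+ us. g (add_mset d (forest_degrees us)) \<partial>count_space {us. length us = j + d \<and> size (forest_degrees us) = m})"
    by (simp add: 4)
  also have "\<dots> = nat_sum (\<lambda>d. \<integral>\<^sup>+ us. g (add_mset d (forest_degrees us)) * indicator A (d, us) \<partial>count_space UNIV)"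
    by (intro nn_integral_cong, subst nn_integral_count_space_indicator) (auto intro!: nn_integral_cong simp: A_def indicator_def)
  also have "\<dots> = (\<integral>\<^sup>+ x. (\<lambda>(d, us). g (add_mset d (forest_degrees us)) * indicator A (d, us)) x \<partial>count_space UNIV)"
    by (subst nn_integral_fst_count_space[symmetric]) simp
  also have "\<dots> = (\<integral>\<^sup>+ x. g (forest_degrees (un x)) * indicator A x \<partial>count_space UNIV)"
    by (intro nn_integral_cong) (auto simp: A_def fc indicator_def)
  also have "\<dots> = (\<integral>\<^sup>+ x. g (forest_degrees (un x)) \<partial>count_space A)"
    by (simp add: nn_integral_count_space_indicator)
  also have "\<dots> = (\<integral>\<^sup>+ ts. g (forest_degrees ts) \<partial>count_space B)"
    by (rule nn_integral_bij_count_space[OF bij])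
  finally show ?case by (simp add: B_def)
qed

lemma tree_sum_eq: "tree_sum g = (\<integral>\<^sup>+ t. g (degrees t) \<partial>count_space UNIV)"
proof -
  have "luk_sum 1 m g = (\<integral>\<^sup>+ t. g (degrees t) * of_bool (size (degrees t) = m) \<partial>count_space UNIV)" for m
  proof -
    have bij: "bij_betw (\<lambda>t. [t]) {t. size (degrees t) = m} {ts. length ts = 1 \<and> size (forest_degrees ts) = m}"
      by (rule bij_betwI[where g = hd]) (auto simp: length_Suc_conv)
    have "luk_sum 1 m g = (\<integral>\<^sup>+ t. g (forest_degrees [t]) \<partial>count_space {t. size (degrees t) = m})"
      unfolding luk_sum_forests by (rule nn_integral_bij_count_space[OF bij, symmetric])
    also have "\<dots> = (\<integral>\<^sup>+ t. g (degrees t) * of_bool (size (degrees t) = m) \<partial>count_space UNIV)"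
      by (subst nn_integral_count_space_indicator) (auto intro!: nn_integral_cong simp: indicator_def)
    finally show ?thesis .
  qed
  then have "tree_sum g = (\<Sum>m. \<integral>\<^sup>+ t. g (degrees t) * of_bool (size (degrees t) = m) \<partial>count_space UNIV)"
    using luk_sum_tree_sum[of g] by simp
  also have "\<dots> = (\<integral>\<^sup>+ t. (\<Sum>m. g (degrees t) * of_bool (size (degrees t) = m)) \<partial>count_space UNIV)"
    by (rule nn_integral_suminf[symmetric]) simp
  also have "\<dots> = (\<integral>\<^sup>+ t. g (degrees t) \<partial>count_space UNIV)"
  proof (rule nn_integral_cong)
    fix t
    have "(\<Sum>m. g (degrees t) * of_bool (size (degrees t) = m)) = (\<Sum>m\<in>{size (degrees t)}. g (degrees t) * of_bool (size (degrees t) = m))"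
      by (rule suminf_finite) auto
    then show "(\<Sum>m. g (degrees t) * of_bool (size (degrees t) = m)) = g (degrees t)" by simp
  qed
  finally show ?thesis .
qed

section \<open>The law of the Galton--Watson tree\<close>

lemma snoc_in_gw_tree: "v @ [i] \<in> gw_tree \<omega> \<longleftrightarrow> v \<in> gw_tree \<omega> \<and> i < \<omega> v"
proof
  assume "v @ [i] \<in> gw_tree \<omega>"
  then show "v \<in> gw_tree \<omega> \<and> i < \<omega> v" by (cases rule: gw_tree.cases) auto
qed (auto intro: gw_tree.child)

lemma outdegree_gw_tree: "v \<in> gw_tree \<omega> \<Longrightarrow> outdegree (gw_tree \<omega>) v = \<omega> v"
proof -
  assume "v \<in> gw_tree \<omega>"
  then have "{i. v @ [i] \<in> gw_tree \<omega>} = {..<\<omega> v}" by (auto simp: snoc_in_gw_tree)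
  then show ?thesis by (simp add: outdegree_def)
qed

text \<open>A finite tree prescribes the offspring variables exactly at its own nodes, so that its probability is
a finite product.\<close>

lemma gw_tree_eq_nodes: "gw_tree \<omega> = nodes t \<longleftrightarrow> (\<forall>v\<in>nodes t. \<omega> v = outdegree (nodes t) v)"
proof
  assume "gw_tree \<omega> = nodes t"
  then show "\<forall>v\<in>nodes t. \<omega> v = outdegree (nodes t) v" by (metis outdegree_gw_tree)
next
  assume *: "\<forall>v\<in>nodes t. \<omega> v = outdegree (nodes t) v"
  have "v \<in> gw_tree \<omega> \<longleftrightarrow> v \<in> nodes t" for v
    by (induction v rule: rev_induct) (auto simp: snoc_in_gw_tree snoc_in_nodes gw_tree.root *)
  then show "gw_tree \<omega> = nodes t" by blast
qed

lemma Cons_in_gw_tree: "i # v \<in> gw_tree \<omega> \<longleftrightarrow> i < \<omega> [] \<and> v \<in> gw_tree (\<lambda>u. \<omega> (i # u))"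
proof (induction v rule: rev_induct)
  case Nil
  show ?case using snoc_in_gw_tree[of "[]" i \<omega>] by (simp add: gw_tree.root)
next
  case (snoc j v)
  show ?case using snoc_in_gw_tree[of "i # v" j \<omega>] by (auto simp: snoc snoc_in_gw_tree)
qed

lemma finite_gw_tree_nodes: "finite (gw_tree \<omega>) \<Longrightarrow> \<exists>t. gw_tree \<omega> = nodes t"
proof (induction "card (gw_tree \<omega>)" arbitrary: \<omega> rule: less_induct)
  case less
  have "\<exists>t. gw_tree (\<lambda>u. \<omega> (i # u)) = nodes t" if i: "i < \<omega> []" for i
  proof (rule less.hyps)
    have sub: "(#) i ` gw_tree (\<lambda>u. \<omega> (i # u)) \<subset> gw_tree \<omega>"
      using i gw_tree.root[of \<omega>] by (auto simp: Cons_in_gw_tree)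
    then show "finite (gw_tree (\<lambda>u. \<omega> (i # u)))"
      by (metis finite_imageD finite_subset less.prems inj_on_Cons1 psubset_imp_subset)
    from psubset_card_mono[OF less.prems sub]
    show "card (gw_tree (\<lambda>u. \<omega> (i # u))) < card (gw_tree \<omega>)"
      by (simp add: card_image)
  qed
  then obtain T where T: "\<And>i. i < \<omega> [] \<Longrightarrow> gw_tree (\<lambda>u. \<omega> (i # u)) = nodes (T i)" by metis
  have "gw_tree \<omega> = nodes (Node (map T [0..<\<omega> []]))"
  proof (rule set_eqI)
    fix v show "v \<in> gw_tree \<omega> \<longleftrightarrow> v \<in> nodes (Node (map T [0..<\<omega> []]))"
      by (cases v) (auto simp: Cons_in_gw_tree T gw_tree.root)
  qed
  then show ?case by blast
qed

lemma space_gw_space [simp]: "space (gw_space \<xi>) = UNIV"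
  by (simp add: gw_space_def space_PiM PiE_def)

lemma measurable_gw_component [measurable]: "(\<lambda>\<omega>. \<omega> v) \<in> measurable (gw_space \<xi>) (count_space UNIV)"
proof -
  have "(\<lambda>\<omega>. \<omega> v) \<in> measurable (gw_space \<xi>) (measure_pmf \<xi>)"
    unfolding gw_space_def by (rule measurable_component_singleton) simp
  then show ?thesis by (simp cong: measurable_cong_sets)
qed

lemma prob_space_gw_space: "prob_space (gw_space \<xi>)"
  unfolding gw_space_def by (rule prob_space_PiM) (rule prob_space_measure_pmf)

lemma emeasure_gw_space_cylinder:
  assumes "finite J"
  shows "emeasure (gw_space \<xi>) {\<omega>. \<forall>v\<in>J. \<omega> v \<in> X v} = (\<Prod>v\<in>J. emeasure (measure_pmf \<xi>) (X v))"
proof -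
  interpret product_prob_space "\<lambda>_::nat list. measure_pmf \<xi>" UNIV
    by unfold_locales
  show ?thesis
    using emeasure_PiM_Collect[of J X] assms by (simp add: gw_space_def space_PiM PiE_def)
qed

lemma sets_gw_tree_eq [measurable]: "{\<omega>. gw_tree \<omega> = nodes t} \<in> sets (gw_space \<xi>)"
proof -
  have "{\<omega> \<in> space (gw_space \<xi>). \<forall>v\<in>nodes t. \<omega> v = outdegree (nodes t) v} \<in> sets (gw_space \<xi>)"
  proof (rule sets.sets_Collect_finite_All')
    show "{\<omega> \<in> space (gw_space \<xi>). \<omega> v = outdegree (nodes t) v} \<in> sets (gw_space \<xi>)" for v
      using measurable_sets[OF measurable_gw_component, of "{outdegree (nodes t) v}" v \<xi>]
      by (simp add: vimage_def)
  qed (use Nil_in_nodes[of t] in \<open>auto simp del: Nil_in_nodes\<close>)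
  then show ?thesis by (simp add: gw_tree_eq_nodes)
qed

lemma emeasure_gw_tree_eq:
  "emeasure (gw_space \<xi>) {\<omega>. gw_tree \<omega> = nodes t} = word_weight (\<lambda>d. ennreal (pmf \<xi> d)) (degrees t)"
proof -
  have "emeasure (gw_space \<xi>) {\<omega>. gw_tree \<omega> = nodes t} =
     (\<Prod>v\<in>nodes t. ennreal (pmf \<xi> (outdegree (nodes t) v)))"
    unfolding gw_tree_eq_nodes
    using emeasure_gw_space_cylinder[of "nodes t" \<xi> "\<lambda>v. {outdegree (nodes t) v}"]
    by (simp add: emeasure_pmf_single)
  also have "\<dots> = (\<Prod>d\<in>#image_mset (outdegree (nodes t)) (mset_set (nodes t)). ennreal (pmf \<xi> d))"
    by (simp add: prod_unfold_prod_mset multiset.map_comp comp_def)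
  finally show ?thesis by (simp add: outdegrees_nodes word_weight_def)
qed

lemma emeasure_finite_gw_tree:
  "emeasure (gw_space \<xi>) {\<omega>. finite (gw_tree \<omega>) \<and> R (image_mset (outdegree (gw_tree \<omega>)) (mset_set (gw_tree \<omega>)))} =
     tree_sum (\<lambda>M. word_weight (\<lambda>d. ennreal (pmf \<xi> d)) M * of_bool (R M))"
  (is "emeasure _ ?E = _")
proof -
  have E: "?E = (\<Union>t\<in>{t. R (degrees t)}. {\<omega>. gw_tree \<omega> = nodes t})"
    using finite_gw_tree_nodes by (fastforce simp: outdegrees_nodes)
  have "emeasure (gw_space \<xi>) ?E = (\<integral>\<^sup>+ t. emeasure (gw_space \<xi>) {\<omega>. gw_tree \<omega> = nodes t} \<partial>count_space {t. R (degrees t)})"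
    unfolding E by (rule emeasure_UN_countable) (auto simp: disjoint_family_on_def dest: nodes_inject)
  then show ?thesis
    by (simp add: tree_sum_eq emeasure_gw_tree_eq nn_integral_count_space_indicator indicator_def of_bool_def
      cong: if_cong)
qed

lemma sets_finite_gw_tree:
  "{\<omega>. finite (gw_tree \<omega>) \<and> R (gw_tree \<omega>)} \<in> sets (gw_space \<xi>)"
proof -
  have "{\<omega>. finite (gw_tree \<omega>) \<and> R (gw_tree \<omega>)} = (\<Union>t\<in>{t. R (nodes t)}. {\<omega>. gw_tree \<omega> = nodes t})"
    using finite_gw_tree_nodes by fastforce
  also have "\<dots> \<in> sets (gw_space \<xi>)" by (intro sets.countable_UN') auto
  finally show ?thesis .
qed

text \<open>The conditions concern distinct prefixes of v and are therefore independent, so that the probability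
of v being a node is a product of tail probabilities.\<close>

lemma in_gw_tree_iff: "v \<in> gw_tree \<omega> \<longleftrightarrow> (\<forall>i<length v. v ! i < \<omega> (take i v))"
proof (induction v rule: rev_induct)
  case Nil
  show ?case by (simp add: gw_tree.root)
next
  case (snoc j v)
  show ?case by (auto simp: snoc_in_gw_tree snoc less_Suc_eq nth_append)
qed

lemma pred_in_gw_tree [measurable]: "Measurable.pred (gw_space \<xi>) (\<lambda>\<omega>. v \<in> gw_tree \<omega>)"
  unfolding in_gw_tree_iff by measurable

lemma sets_in_gw_tree [measurable]: "{\<omega>. v \<in> gw_tree \<omega>} \<in> sets (gw_space \<xi>)"
  using predE[OF pred_in_gw_tree] by simp

lemma emeasure_in_gw_tree:
  "emeasure (gw_space \<xi>) {\<omega>. v \<in> gw_tree \<omega>} = prod_list (map (\<lambda>j. emeasure (measure_pmf \<xi>) {j<..}) v)"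
proof -
  define J where "J = (\<lambda>i. take i v) ` {..<length v}"
  have inj: "inj_on (\<lambda>i. take i v) {..<length v}"
    by (rule inj_onI) (metis length_take lessThan_iff min.absorb4)
  have "{\<omega>. v \<in> gw_tree \<omega>} = {\<omega>. \<forall>u\<in>J. \<omega> u \<in> {v ! length u<..}}"
    by (auto simp: in_gw_tree_iff J_def)
  also have "emeasure (gw_space \<xi>) \<dots> = (\<Prod>u\<in>J. emeasure (measure_pmf \<xi>) {v ! length u<..})"
    by (rule emeasure_gw_space_cylinder) (simp add: J_def)
  also have "\<dots> = (\<Prod>i<length v. emeasure (measure_pmf \<xi>) {v ! i<..})"
    unfolding J_def by (subst prod.reindex[OF inj]) simp
  also have "\<dots> = prod_list (map (\<lambda>j. emeasure (measure_pmf \<xi>) {j<..}) v)"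
    by (simp add: prod.list_conv_set_nth atLeast0LessThan)
  finally show ?thesis .
qed

lemma sum_lists_prod_list:
  "(\<integral>\<^sup>+ v. prod_list (map a v) \<partial>count_space {v. length v = k}) = (nat_sum a) ^ k"
proof (induction k)
  case 0
  have "{v :: nat list. length v = 0} = {[]}" by auto
  then show ?case by (simp add: nn_integral_count_space_finite)
next
  case (Suc k)
  define A where "A = (UNIV :: nat set) \<times> {v :: nat list. length v = k}"
  have bij: "bij_betw (\<lambda>(d, v). d # v) A {v :: nat list. length v = Suc k}"
    by (rule bij_betwI[where g = "\<lambda>v. (hd v, tl v)"]) (auto simp: A_def length_Suc_conv)
  have "(\<integral>\<^sup>+ v. prod_list (map a v) \<partial>count_space {v. length v = Suc k}) =
     (\<integral>\<^sup>+ x. prod_list (map a ((\<lambda>(d, v). d # v) x)) \<partial>count_space A)"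
    by (rule nn_integral_bij_count_space[OF bij, symmetric])
  also have "\<dots> = (\<integral>\<^sup>+ x. (\<lambda>(d, v). a d * (prod_list (map a v) * indicator {v. length v = k} v)) x \<partial>count_space UNIV)"
    by (subst nn_integral_count_space_indicator) (auto intro!: nn_integral_cong simp: A_def indicator_def)
  also have "\<dots> = nat_sum (\<lambda>d. \<integral>\<^sup>+ v. a d * (prod_list (map a v) * indicator {v. length v = k} v) \<partial>count_space UNIV)"
    by (subst nn_integral_fst_count_space[symmetric]) simp
  also have "\<dots> = nat_sum (\<lambda>d. a d * (nat_sum a) ^ k)"
    by (simp add: nn_integral_cmult Suc.IH[symmetric] nn_integral_count_space_indicator)
  also have "\<dots> = (nat_sum a) ^ Suc k" by (simp add: nn_integral_multc)
  finally show ?case .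
qed

text \<open>All offspring numbers are finite, hence so is the part of the tree below any given depth.\<close>

lemma infinite_gw_tree_deep:
  assumes "infinite (gw_tree \<omega>)"
  shows "\<exists>v. length v = k \<and> v \<in> gw_tree \<omega>"
proof (rule ccontr)
  assume none: "\<nexists>v. length v = k \<and> v \<in> gw_tree \<omega>"
  have fin: "finite {v \<in> gw_tree \<omega>. length v = j}" for j
  proof (induction j)
    case (Suc j)
    have "{v \<in> gw_tree \<omega>. length v = Suc j} \<subseteq> (\<Union>v\<in>{v \<in> gw_tree \<omega>. length v = j}. (\<lambda>i. v @ [i]) ` {..<\<omega> v})"
    proof
      fix v assume v: "v \<in> {v \<in> gw_tree \<omega>. length v = Suc j}"
      then obtain u i where "v = u @ [i]" by (cases v rule: rev_cases) auto
      with v show "v \<in> (\<Union>v\<in>{v \<in> gw_tree \<omega>. length v = j}. (\<lambda>i. v @ [i]) ` {..<\<omega> v})"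
        by (auto simp: snoc_in_gw_tree)
    qed
    then show ?case by (rule finite_subset) (use Suc in auto)
  qed (simp add: gw_tree.root)
  have "length v < k" if "v \<in> gw_tree \<omega>" for v
  proof (rule ccontr)
    assume "\<not> length v < k"
    then have "take k v \<in> gw_tree \<omega>" "length (take k v) = k"
      using that by (auto simp: in_gw_tree_iff)
    with none show False by blast
  qed
  then have "gw_tree \<omega> \<subseteq> (\<Union>j<k. {v \<in> gw_tree \<omega>. length v = j})" by auto
  with assms fin show False by (meson finite_UN finite_lessThan finite_subset)
qed

text \<open>The expected number of nodes at depth k is the k-th power of the mean, which tends to 0.\<close>

lemma AE_finite_gw_tree:
  assumes "(\<integral>\<^sup>+x. of_nat x \<partial>measure_pmf \<xi>) < 1"
  shows "AE \<omega> in gw_space \<xi>. finite (gw_tree \<omega>)"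
proof -
  let ?m = "\<integral>\<^sup>+x. of_nat x \<partial>measure_pmf \<xi>"
  have m: "nat_sum (\<lambda>j. emeasure (measure_pmf \<xi>) {j<..}) = ?m"
    by (subst nn_integral_nat_function) (auto simp: nn_integral_count_space_nat greaterThan_def)
  have [measurable]: "{\<omega>. infinite (gw_tree \<omega>)} \<in> sets (gw_space \<xi>)"
    using sets.compl_sets[OF sets_finite_gw_tree[of "\<lambda>_. True" \<xi>]] by (simp add: Compl_eq_Diff_UNIV[symmetric] Collect_neg_eq)
  have "emeasure (gw_space \<xi>) {\<omega>. infinite (gw_tree \<omega>)} \<le> ?m ^ k" for k
  proof -
    define L where "L = {v :: nat list. length v = k}"
    have "emeasure (gw_space \<xi>) {\<omega>. infinite (gw_tree \<omega>)} = (\<integral>\<^sup>+\<omega>. indicator {\<omega>. infinite (gw_tree \<omega>)} \<omega> \<partial>gw_space \<xi>)"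
      by simp
    also have "\<dots> \<le> (\<integral>\<^sup>+\<omega>. \<integral>\<^sup>+v. indicator {\<omega>. v \<in> gw_tree \<omega>} \<omega> \<partial>count_space L \<partial>gw_space \<xi>)"
    proof (rule nn_integral_mono)
      fix \<omega>
      show "indicator {\<omega>. infinite (gw_tree \<omega>)} \<omega> \<le> ((\<integral>\<^sup>+v. indicator {\<omega>. v \<in> gw_tree \<omega>} \<omega> \<partial>count_space L) :: ennreal)"
      proof (cases "infinite (gw_tree \<omega>)")
        case True
        from infinite_gw_tree_deep[OF this, of k] obtain v where "v \<in> L" "v \<in> gw_tree \<omega>"
          by (auto simp: L_def)
        then show ?thesis
          using nn_integral_ge_point[of v L "\<lambda>v. indicator {\<omega>. v \<in> gw_tree \<omega>} \<omega>"] True by simp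
      qed simp
    qed
    also have "\<dots> = (\<integral>\<^sup>+v. \<integral>\<^sup>+\<omega>. indicator {\<omega>. v \<in> gw_tree \<omega>} \<omega> \<partial>gw_space \<xi> \<partial>count_space L)"
      by (rule nn_integral_count_space_nn_integral) (auto simp: L_def)
    also have "\<dots> = (\<integral>\<^sup>+v. prod_list (map (\<lambda>j. emeasure (measure_pmf \<xi>) {j<..}) v) \<partial>count_space L)"
      by (intro nn_integral_cong) (simp add: emeasure_in_gw_tree[symmetric])
    also have "\<dots> = ?m ^ k" unfolding L_def sum_lists_prod_list m ..
    finally show ?thesis .
  qed
  moreover have "(\<lambda>k. ?m ^ k) \<longlonglongrightarrow> 0"
  proof -
    obtain r where r: "r \<ge> 0" "?m = ennreal r" using assms by (cases "?m") auto
    with assms have "r < 1" by simp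
    then have "(\<lambda>k. ennreal (r ^ k)) \<longlonglongrightarrow> ennreal 0"
      using r by (intro tendsto_ennrealI LIMSEQ_realpow_zero) auto
    then show ?thesis using r by (simp add: ennreal_power)
  qed
  ultimately have "emeasure (gw_space \<xi>) {\<omega>. infinite (gw_tree \<omega>)} \<le> 0"
    by (intro LIMSEQ_le_const) auto
  then show ?thesis
    by (intro AE_I[of _ _ "{\<omega>. infinite (gw_tree \<omega>)}"]) auto
qed

abbreviation (input) tree_degrees :: "plane_tree \<Rightarrow> nat multiset" where
  "tree_degrees t \<equiv> image_mset (outdegree t) (mset_set t)"

text \<open>The passage from trees to words. An event needs to be described in terms of the outdegrees only on
finite trees, since infinite trees form a null set.\<close>

lemma emeasure_gw_tree_event:
  assumes "(\<integral>\<^sup>+x. of_nat x \<partial>measure_pmf \<xi>) < 1" and [measurable]: "{\<omega>. Q \<omega>} \<in> sets (gw_space \<xi>)"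
    and R: "\<And>\<omega>. finite (gw_tree \<omega>) \<Longrightarrow> Q \<omega> \<longleftrightarrow> R (tree_degrees (gw_tree \<omega>))"
  shows "emeasure (gw_space \<xi>) {\<omega>. Q \<omega>} = tree_sum (\<lambda>M. word_weight (\<lambda>d. ennreal (pmf \<xi> d)) M * of_bool (R M))"
proof -
  have "emeasure (gw_space \<xi>) {\<omega>. Q \<omega>} = emeasure (gw_space \<xi>) {\<omega>. finite (gw_tree \<omega>) \<and> R (tree_degrees (gw_tree \<omega>))}"
  proof (rule emeasure_eq_AE)
    show "AE \<omega> in gw_space \<xi>. \<omega> \<in> {\<omega>. Q \<omega>} \<longleftrightarrow> \<omega> \<in> {\<omega>. finite (gw_tree \<omega>) \<and> R (tree_degrees (gw_tree \<omega>))}"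
      using AE_finite_gw_tree[OF assms(1)] by eventually_elim (simp add: R)
    show "{\<omega>. finite (gw_tree \<omega>) \<and> R (tree_degrees (gw_tree \<omega>))} \<in> sets (gw_space \<xi>)"
      by (rule sets_finite_gw_tree)
  qed fact
  then show ?thesis by (simp only: emeasure_finite_gw_tree)
qed

definition cond_event :: "nat set \<Rightarrow> nat \<Rightarrow> (nat list \<Rightarrow> nat) set" where
  "cond_event \<Omega> n = {\<omega>. finite (outdegree_vertices \<Omega> (gw_tree \<omega>)) \<and> card (outdegree_vertices \<Omega> (gw_tree \<omega>)) = n}"

text \<open>The outdegrees in question can be read off from the offspring variables, and there are only countably
many finite sets of nodes.\<close>

lemma sets_cond_event [measurable]: "cond_event \<Omega> n \<in> sets (gw_space \<xi>)"
proof -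
  have ov: "outdegree_vertices \<Omega> (gw_tree \<omega>) = {v. v \<in> gw_tree \<omega> \<and> \<omega> v \<in> \<Omega>}" for \<omega>
    by (auto simp: outdegree_vertices_def outdegree_gw_tree)
  have "cond_event \<Omega> n = (\<Union>F\<in>{F. finite F \<and> card F = n}. {\<omega> \<in> space (gw_space \<xi>). \<forall>v. v \<in> F \<longleftrightarrow> v \<in> gw_tree \<omega> \<and> \<omega> v \<in> \<Omega>})"
    (is "_ = ?U")
  proof -
    have "(\<forall>v. v \<in> F \<longleftrightarrow> v \<in> gw_tree \<omega> \<and> \<omega> v \<in> \<Omega>) \<longleftrightarrow> F = {v. v \<in> gw_tree \<omega> \<and> \<omega> v \<in> \<Omega>}" for F \<omega>
      by blast
    then show ?thesis unfolding cond_event_def ov by auto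
  qed
  also have "?U \<in> sets (gw_space \<xi>)"
  proof (rule sets.countable_UN')
    show "countable {F :: nat list set. finite F \<and> card F = n}"
      by (rule countable_subset[OF _ countable_Collect_finite]) auto
  next
    have "{\<omega> \<in> space (gw_space \<xi>). \<forall>v. v \<in> F \<longleftrightarrow> v \<in> gw_tree \<omega> \<and> \<omega> v \<in> \<Omega>} \<in> sets (gw_space \<xi>)" for F
      by measurable
    then show "(\<lambda>F. {\<omega> \<in> space (gw_space \<xi>). \<forall>v. v \<in> F \<longleftrightarrow> v \<in> gw_tree \<omega> \<and> \<omega> v \<in> \<Omega>}) ` {F. finite F \<and> card F = n}
        \<subseteq> sets (gw_space \<xi>)" by blast
  qed
  finally show ?thesis .
qed

lemma measurable_kth_outdegree [measurable]:
  "(\<lambda>\<omega>. kth_outdegree k (gw_tree \<omega>)) \<in> measurable (gw_space \<xi>) (count_space UNIV)"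
proof -
  have inf: "{\<omega>. infinite (gw_tree \<omega>)} \<in> sets (gw_space \<xi>)"
    using sets.compl_sets[OF sets_finite_gw_tree[of "\<lambda>_. True" \<xi>]] by (simp add: Compl_eq_Diff_UNIV[symmetric] Collect_neg_eq)
  have "(\<lambda>\<omega>. kth_outdegree k (gw_tree \<omega>)) -` {j} \<inter> space (gw_space \<xi>) \<in> sets (gw_space \<xi>)" for j
  proof -
    have *: "kth_outdegree k t = 0" if "infinite t" for t
      using that by (simp add: kth_outdegree_def outdegrees_desc_def)
    have "(\<lambda>\<omega>. kth_outdegree k (gw_tree \<omega>)) -` {j} \<inter> space (gw_space \<xi>) =
      {\<omega>. finite (gw_tree \<omega>) \<and> kth_outdegree k (gw_tree \<omega>) = j} \<union> (if j = 0 then {\<omega>. infinite (gw_tree \<omega>)} else {})"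
      by (auto simp: *) (metis * less_numeral_extra(3))
    also have "\<dots> \<in> sets (gw_space \<xi>)"
      using inf by (intro sets.Un sets_finite_gw_tree) auto
    finally show ?thesis .
  qed
  then show ?thesis by (subst measurable_count_space_eq2_countable) auto
qed

lemma second_le_iff:
  fixes xs :: "nat list"
  assumes "sorted_wrt (\<ge>) xs" "y \<ge> (0::real)"
  shows "real (if 2 \<le> length xs then xs ! 1 else 0) \<le> y \<longleftrightarrow> length (filter (\<lambda>d. real d > y) xs) \<le> 1"
proof (cases "2 \<le> length xs")
  case True
  then obtain a b zs where xs: "xs = a # b # zs"
    by (metis One_nat_def Suc_1 Suc_le_length_iff)
  show ?thesis
  proof (cases "real b \<le> y")
    case True
    then have "filter (\<lambda>d. real d > y) zs = []"
      using assms(1) by (auto simp: xs filter_empty_conv)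
    with True show ?thesis by (simp add: xs)
  next
    case False
    with assms(1) have "real a > y" by (auto simp: xs)
    with False show ?thesis by (simp add: xs)
  qed
next
  case False
  have "length (filter (\<lambda>d. real d > y) xs) \<le> length xs" by (rule length_filter_le)
  with False have "length (filter (\<lambda>d. real d > y) xs) \<le> 1" by linarith
  with False assms(2) show ?thesis by simp
qed

lemma second_outdegree_le_iff:
  assumes "y \<ge> (0::real)"
  shows "real (kth_outdegree 2 t) \<le> y \<longleftrightarrow> size (filter_mset (\<lambda>d. real d > y) (tree_degrees t)) \<le> 1"
proof -
  have kth: "kth_outdegree 2 t = (if 2 \<le> length (outdegrees_desc t) then outdegrees_desc t ! 1 else 0)"
    by (simp add: kth_outdegree_def)
  have "sorted_wrt (\<ge>) (outdegrees_desc t)"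
    unfolding outdegrees_desc_def sorted_wrt_rev
    using sorted_sorted_list_of_multiset by simp
  from second_le_iff[OF this assms] have "real (kth_outdegree 2 t) \<le> y \<longleftrightarrow> length (filter (\<lambda>d. real d > y) (outdegrees_desc t)) \<le> 1"
    by (simp only: kth)
  also have "length (filter (\<lambda>d. real d > y) (outdegrees_desc t)) = size (filter_mset (\<lambda>d. real d > y) (mset (outdegrees_desc t)))"
    by (simp flip: mset_filter)
  also have "mset (outdegrees_desc t) = tree_degrees t" by (simp add: outdegrees_desc_def)
  finally show ?thesis .
qed

lemma cdf_second_outdegree:
  assumes m: "(\<integral>\<^sup>+x. of_nat x \<partial>measure_pmf \<xi>) < 1" and a: "a > 0" and x: "x \<ge> 0"
    and pos: "tree_sum (\<lambda>M. word_weight (\<lambda>d. ennreal (pmf \<xi> d)) M * of_bool (letters_in \<Omega> M = n)) > 0"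
  shows "cdf (distr (gw_cond_space \<xi> \<Omega> n) borel (\<lambda>\<omega>. real (kth_outdegree 2 (gw_tree \<omega>)) / a)) x =
    enn2real (tree_sum (\<lambda>M. word_weight (\<lambda>d. ennreal (pmf \<xi> d)) M *
        of_bool (letters_in \<Omega> M = n \<and> size (filter_mset (\<lambda>d. real d > x * a) M) \<le> 1))) /
    enn2real (tree_sum (\<lambda>M. word_weight (\<lambda>d. ennreal (pmf \<xi> d)) M * of_bool (letters_in \<Omega> M = n)))"
proof -
  interpret prob_space "gw_space \<xi>" by (rule prob_space_gw_space)
  have N: "\<omega> \<in> cond_event \<Omega> n \<longleftrightarrow> letters_in \<Omega> (tree_degrees (gw_tree \<omega>)) = n" if "finite (gw_tree \<omega>)" for \<omega>
    using that by (simp add: cond_event_def outdegree_vertices_def letters_in_def filter_mset_image_mset conj_commute)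
  have c: "gw_cond_space \<xi> \<Omega> n = uniform_measure (gw_space \<xi>) (cond_event \<Omega> n)"
    by (simp add: gw_cond_space_def cond_event_def)
  have den: "emeasure (gw_space \<xi>) (cond_event \<Omega> n) = tree_sum (\<lambda>M. word_weight (\<lambda>d. ennreal (pmf \<xi> d)) M * of_bool (letters_in \<Omega> M = n))"
    using emeasure_gw_tree_event[OF m, of "\<lambda>\<omega>. \<omega> \<in> cond_event \<Omega> n" "\<lambda>M. letters_in \<Omega> M = n"] N by simp
  define B where "B = {\<omega>. real (kth_outdegree 2 (gw_tree \<omega>)) / a \<le> x}"
  have B [measurable]: "B \<in> sets (gw_space \<xi>)"
  proof -
    have "{\<omega> \<in> space (gw_space \<xi>). real (kth_outdegree 2 (gw_tree \<omega>)) / a \<le> x} \<in> sets (gw_space \<xi>)" by measurable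
    then show ?thesis by (simp add: B_def)
  qed
  have num: "emeasure (gw_space \<xi>) (cond_event \<Omega> n \<inter> B) = tree_sum (\<lambda>M. word_weight (\<lambda>d. ennreal (pmf \<xi> d)) M *
        of_bool (letters_in \<Omega> M = n \<and> size (filter_mset (\<lambda>d. real d > x * a) M) \<le> 1))"
  proof -
    have "\<omega> \<in> cond_event \<Omega> n \<inter> B \<longleftrightarrow> letters_in \<Omega> (tree_degrees (gw_tree \<omega>)) = n \<and> size (filter_mset (\<lambda>d. real d > x * a) (tree_degrees (gw_tree \<omega>))) \<le> 1"
      if "finite (gw_tree \<omega>)" for \<omega>
      using N[OF that] second_outdegree_le_iff[of "x * a" "gw_tree \<omega>"] a x by (simp add: B_def field_simps)
    with emeasure_gw_tree_event[where Q = "\<lambda>\<omega>. \<omega> \<in> cond_event \<Omega> n \<inter> B" and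
        R = "\<lambda>M. letters_in \<Omega> M = n \<and> size (filter_mset (\<lambda>d. real d > x * a) M) \<le> 1", OF m]
    show ?thesis by (simp add: Int_def)
  qed
  have "cdf (distr (gw_cond_space \<xi> \<Omega> n) borel (\<lambda>\<omega>. real (kth_outdegree 2 (gw_tree \<omega>)) / a)) x =
     measure (gw_cond_space \<xi> \<Omega> n) B"
    unfolding cdf_def c by (subst measure_distr) (auto simp: B_def vimage_def)
  also have "\<dots> = measure (gw_space \<xi>) (cond_event \<Omega> n \<inter> B) / measure (gw_space \<xi>) (cond_event \<Omega> n)"
    unfolding c using pos unfolding den[symmetric]
    by (intro measure_uniform_measure) (auto simp: emeasure_eq_measure)
  finally show ?thesis by (simp add: measure_def num den)
qed

section \<open>Exponential tilting of truncated offspring weights\<close>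

lemma integrable_pmf_nat_iff:
  fixes \<xi> :: "nat pmf" and h :: "nat \<Rightarrow> real"
  shows "integrable (measure_pmf \<xi>) h \<longleftrightarrow> summable (\<lambda>n. norm (pmf \<xi> n * h n))"
  by (simp add: measure_pmf_eq_density integrable_density integrable_count_space_nat_iff)

text \<open>For small x this is the quadratic remainder, weakened to the power 1 + \<beta>; for large x the factor
exp X dominates. It allows expanding an exponential moment to first order when only a moment of
order 1 + \<beta> is available.\<close>

lemma exp_taylor_bound:
  fixes x X \<beta> :: real
  assumes "0 < \<beta>" "\<beta> \<le> 1" "x \<le> X" "0 \<le> X"
  shows "\<bar>exp x - 1 - x\<bar> \<le> \<bar>x\<bar> powr (1 + \<beta>) * exp X"
proof -
  have nn: "exp x - 1 - x \<ge> 0" using exp_ge_add_one_self[of x] by linarith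
  consider "\<bar>x\<bar> \<le> 1" | "x > 1" | "x < -1" by linarith
  then have "exp x - 1 - x \<le> \<bar>x\<bar> powr (1 + \<beta>) * exp X"
  proof cases
    case 1
    have "exp x \<le> 1 + x + x\<^sup>2"
    proof (cases "x \<ge> 0")
      case True
      then show ?thesis using exp_bound[of x] 1 by auto
    next
      case False
      have "1 + x + x\<^sup>2 = (x + 1 / 2)\<^sup>2 + 3 / 4" by (simp add: power2_eq_square algebra_simps)
      then have "1 + x + x\<^sup>2 > 0" by (simp add: add_nonneg_pos)
      moreover have "exp (-x) \<ge> 1 - x + x\<^sup>2 / 2" using exp_lower_Taylor_quadratic[of "-x"] False by simp
      moreover have "(1 + x + x\<^sup>2) * (1 - x + x\<^sup>2 / 2) \<ge> 1"
      proof -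
        have "(1 + x + x\<^sup>2) * (1 - x + x\<^sup>2 / 2) - 1 = x\<^sup>2 * (1 / 2 - x / 2 + x\<^sup>2 / 2)"
          by (simp add: field_simps power2_eq_square)
        also have "\<dots> \<ge> 0" using False by (intro mult_nonneg_nonneg) auto
        finally show ?thesis by simp
      qed
      ultimately have "(1 + x + x\<^sup>2) * exp (-x) \<ge> 1"
        by (meson less_imp_le mult_left_mono order_trans)
      then show ?thesis by (simp add: exp_minus field_simps)
    qed
    then have "exp x - 1 - x \<le> \<bar>x\<bar> powr 2" by (cases "x = 0") (auto simp: powr_numeral)
    also have "\<dots> \<le> \<bar>x\<bar> powr (1 + \<beta>)" using 1 assms by (intro powr_mono') auto
    also have "\<dots> \<le> \<bar>x\<bar> powr (1 + \<beta>) * exp X" using assms by (simp add: mult_le_cancel_left1)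
    finally show ?thesis .
  next
    case 2
    have "exp x \<le> exp X" using assms by simp
    then have "exp x - 1 - x \<le> 1 * exp X" using 2 by linarith
    also have "\<dots> \<le> \<bar>x\<bar> powr (1 + \<beta>) * exp X"
      using 2 assms by (intro mult_right_mono ge_one_powr_ge_zero) auto
    finally show ?thesis .
  next
    case 3
    have "exp x - 1 - x \<le> \<bar>x\<bar> powr 1" using 3 exp_le_one_iff[of x] by auto
    also have "\<dots> \<le> \<bar>x\<bar> powr (1 + \<beta>)" using 3 assms by (intro powr_mono) auto
    also have "\<dots> \<le> \<bar>x\<bar> powr (1 + \<beta>) * exp X" using assms by (simp add: mult_le_cancel_left1)
    finally show ?thesis .
  qed
  with nn show ?thesis by simp
qed

text \<open>A subcritical offspring law with regularly varying point probabilities: the regime in which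
conditioning on many nodes creates one node of macroscopic outdegree.\<close>

locale condensing_offspring =
  fixes \<xi> :: "nat pmf" and f :: "real \<Rightarrow> real" and \<alpha> :: real and \<Omega> :: "nat set"
  assumes int: "integrable (measure_pmf \<xi>) real"
    and mean: "measure_pmf.expectation \<xi> real < 1"
    and sv: "slowly_varying f"
    and \<alpha>: "\<alpha> > 1"
    and pmf_tail: "\<forall>\<^sub>F n in sequentially. pmf \<xi> n = f (real n) * real n powr (- 1 - \<alpha>)"
    and prob_pos: "measure_pmf.prob \<xi> \<Omega> > 0"
    and fin: "finite \<Omega> \<or> finite (- \<Omega>)"
begin

abbreviation prob :: "nat set \<Rightarrow> real" where "prob \<equiv> measure_pmf.prob \<xi>"
abbreviation expect :: "(nat \<Rightarrow> real) \<Rightarrow> real" where "expect \<equiv> measure_pmf.expectation \<xi>"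
definition p where "p = prob \<Omega>"

text \<open>A word contains about n / p letters when n of them lie in \<Omega>, and each letter d lowers the height
by 1 - d. So c n is the approximate difference of length and letter sum.\<close>

definition c where "c = (1 - expect real) / p"
abbreviation offspring_weight :: "nat \<Rightarrow> ennreal" where "offspring_weight \<equiv> \<lambda>d. ennreal (pmf \<xi> d)"
abbreviation W :: "nat multiset \<Rightarrow> ennreal" where "W \<equiv> word_weight offspring_weight"

lemma p_pos: "p > 0" and c_pos: "c > 0"
  using prob_pos mean by (auto simp: p_def c_def)

text \<open>By Potter's bounds the probabilities are summable against n^(1 + \<beta>) as soon as \<beta> < \<alpha> - 1.\<close>

lemma moment: "\<exists>\<beta>. 0 < \<beta> \<and> \<beta> \<le> 1 \<and> integrable (measure_pmf \<xi>) (\<lambda>k. real k powr (1 + \<beta>))"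
proof -
  \<comment> \<open>\<eta> is the loss in Potter's bound; \<eta> + \<beta> - \<alpha> < -1 is required for summability\<close>
  define \<eta> where "\<eta> = (\<alpha> - 1) / 3"
  define \<beta> where "\<beta> = min 1 \<eta>"
  have "\<eta> > 0" using \<alpha> by (simp add: \<eta>_def)
  then have \<eta>: "\<eta> > 0" "0 < \<beta>" "\<beta> \<le> 1" "\<beta> \<le> \<eta>" by (auto simp: \<beta>_def)
  obtain X C where X: "X > 0" "C > 0" "\<And>x y. x \<ge> X \<Longrightarrow> y \<ge> x \<Longrightarrow> f x > 0 \<and> f y \<le> C * f x * (y / x) powr \<eta>"
    using slowly_varying_potter[OF sv \<eta>(1)] by blast
  \<comment> \<open>\<open>f n \<le> D * n powr \<eta>\<close> for all large n\<close>
  define D where "D = C * f X * X powr (-\<eta>)"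
  have "\<forall>\<^sub>F n in sequentially. norm (norm (pmf \<xi> n * real n powr (1 + \<beta>))) \<le> D * real n powr (\<eta> + \<beta> - \<alpha>)"
  proof -
    have "\<forall>\<^sub>F n in sequentially. real n \<ge> X" using filterlim_real_sequentially unfolding filterlim_at_top by blast 
    with pmf_tail eventually_gt_at_top[of 0] show ?thesis
    proof eventually_elim
      case (elim n)
      have "f (real n) \<le> D * real n powr \<eta>"
        using X(3)[of X "real n"] elim X(1) by (simp add: D_def powr_divide powr_minus field_simps)
      then have "pmf \<xi> n * real n powr (1 + \<beta>) \<le> D * real n powr \<eta> * real n powr (- 1 - \<alpha>) * real n powr (1 + \<beta>)"
        unfolding elim(1) by (intro mult_right_mono) auto
      also have "\<dots> = D * (real n powr \<eta> * real n powr (- 1 - \<alpha>) * real n powr (1 + \<beta>))" by simp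
      also have "real n powr \<eta> * real n powr (- 1 - \<alpha>) * real n powr (1 + \<beta>) = real n powr (\<eta> + \<beta> - \<alpha>)"
        by (simp add: algebra_simps flip: powr_add)
      finally show ?case by simp
    qed
  qed
  moreover have "\<alpha> = 3 * \<eta> + 1" by (simp add: \<eta>_def field_simps)
  then have "\<eta> + \<beta> - \<alpha> < - 1" using \<eta> by linarith
  then have "summable (\<lambda>n. D * real n powr (\<eta> + \<beta> - \<alpha>))"
    by (intro summable_mult) (simp add: summable_real_powr_iff)
  ultimately have "summable (\<lambda>n. norm (pmf \<xi> n * real n powr (1 + \<beta>)))"
    by (rule summable_comparison_test_ev)
  with \<eta> show ?thesis by (auto simp: integrable_pmf_nat_iff)
qed

text \<open>The offspring weights cut off at L and tilted exponentially; \<theta> = 0 is pure truncation.\<close>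

definition tilted :: "real \<Rightarrow> real \<Rightarrow> nat \<Rightarrow> ennreal" where
  "tilted \<theta> L d = ennreal (pmf \<xi> d * (of_bool (real d \<le> L) * exp (\<theta> * (real d - 1))))"

definition tilted_mass :: "real \<Rightarrow> real \<Rightarrow> nat set \<Rightarrow> real" where
  "tilted_mass \<theta> L S = expect (\<lambda>d. indicator S d * (of_bool (real d \<le> L) * exp (\<theta> * (real d - 1))))"

lemma integrable_tilted_mass: "integrable (measure_pmf \<xi>) (\<lambda>d. indicator S d * (of_bool (real d \<le> L) * exp (\<theta> * (real d - 1))))"
proof (rule measure_pmf.integrable_const_bound[where B = "exp (\<bar>\<theta>\<bar> * (\<bar>L\<bar> + 1))"])
  have "\<theta> * (real d - 1) \<le> \<bar>\<theta>\<bar> * (\<bar>L\<bar> + 1)" if "real d \<le> L" for d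
  proof -
    have "\<theta> * (real d - 1) \<le> \<bar>\<theta>\<bar> * \<bar>real d - 1\<bar>" by (metis abs_ge_self abs_mult)
    also have "\<dots> \<le> \<bar>\<theta>\<bar> * (\<bar>L\<bar> + 1)" using that by (intro mult_left_mono) auto
    finally show ?thesis .
  qed
  then show "AE d in measure_pmf \<xi>. norm (indicator S d * (of_bool (real d \<le> L) * exp (\<theta> * (real d - 1)))) \<le> exp (\<bar>\<theta>\<bar> * (\<bar>L\<bar> + 1))"
    by (intro AE_I2) (auto simp: indicator_def)
qed simp

lemma tilted_mass_nonneg: "tilted_mass \<theta> L S \<ge> 0"
  unfolding tilted_mass_def by (intro integral_nonneg_AE AE_I2) auto

lemma nat_sum_tilted: "nat_sum (\<lambda>d. tilted \<theta> L d * indicator S d) = ennreal (tilted_mass \<theta> L S)"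
proof -
  have "ennreal (tilted_mass \<theta> L S) = (\<integral>\<^sup>+d. ennreal (indicator S d * (of_bool (real d \<le> L) * exp (\<theta> * (real d - 1)))) \<partial>measure_pmf \<xi>)"
    unfolding tilted_mass_def by (rule nn_integral_eq_integral[symmetric, OF integrable_tilted_mass]) auto
  also have "\<dots> = nat_sum (\<lambda>d. tilted \<theta> L d * indicator S d)"
    by (auto simp: nn_integral_measure_pmf tilted_def indicator_def ennreal_mult intro!: nn_integral_cong)
  finally show ?thesis ..
qed

text \<open>The tilt of a whole word depends only on the difference of its letter sum and its length.\<close>

lemma word_weight_tilted: "word_weight (tilted \<theta> L) M = W M * ennreal (of_bool (\<forall>d\<in>#M. real d \<le> L) * exp (\<theta> * (real (sum_mset M) - real (size M))))"
proof (induction M)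
  case (add d M)
  have "exp (\<theta> * (real (sum_mset (add_mset d M)) - real (size (add_mset d M)))) =
    exp (\<theta> * (real d - 1)) * exp (\<theta> * (real (sum_mset M) - real (size M)))"
    by (simp add: exp_add[symmetric] algebra_simps)
  then show ?case using add by (simp add: tilted_def ennreal_mult mult_ac)
qed simp

lemma all_words_tilted:
  assumes "tilted_mass \<theta> L (-\<Omega>) < 1"
  shows "all_words (\<lambda>M. word_weight (tilted \<theta> L) M * of_bool (letters_in \<Omega> M = n)) = ennreal (tilted_mass \<theta> L \<Omega> ^ n / (1 - tilted_mass \<theta> L (-\<Omega>)) ^ Suc n)"
  by (rule all_words_count[OF nat_sum_tilted nat_sum_tilted]) (use tilted_mass_nonneg assms in auto)

text \<open>Letters up to L are expanded by \<open>exp_taylor_bound\<close> with exponent at most s L; letters above L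
are dropped, at a cost controlled by the moment of order 1 + \<beta>.\<close>

lemma tilted_mass_expansion_bound:
  assumes \<beta>: "0 < \<beta>" "\<beta> \<le> 1" and mom: "integrable (measure_pmf \<xi>) (\<lambda>k. real k powr (1 + \<beta>))"
    and L: "L \<ge> 1" and \<theta>: "s \<ge> 0" "\<bar>\<theta>\<bar> = s"
  shows "\<bar>tilted_mass \<theta> L S - prob S - \<theta> * expect (\<lambda>d. indicator S d * (real d - 1))\<bar>
     \<le> expect (\<lambda>k. 1 + real k powr (1 + \<beta>)) * (s powr (1 + \<beta>) * exp (s * L) + L powr (- 1 - \<beta>) + s * L powr (-\<beta>))"
proof -
  let ?R = "s powr (1 + \<beta>) * exp (s * L) + L powr (- 1 - \<beta>) + s * L powr (-\<beta>)"
  let ?g = "\<lambda>d. indicator S d * (of_bool (real d \<le> L) * exp (\<theta> * (real d - 1))) - indicator S d - \<theta> * (indicator S d * (real d - 1))"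
  let ?h = "\<lambda>d. of_bool (real d \<le> L) * exp (\<theta> * (real d - 1)) - 1 - \<theta> * (real d - 1)"
  have i1: "integrable (measure_pmf \<xi>) (\<lambda>d. indicator S d * (real d - 1))"
    by (rule Bochner_Integration.integrable_bound[where f = "\<lambda>d. real d + 1"]) (use int in \<open>auto simp: indicator_def\<close>)
  have i2: "integrable (measure_pmf \<xi>) (\<lambda>d. indicator S d :: real)"
    by (rule measure_pmf.integrable_const_bound[where B = 1]) auto
  have iM: "integrable (measure_pmf \<xi>) (\<lambda>k. 1 + real k powr (1 + \<beta>))" using mom by simp
  have eq: "tilted_mass \<theta> L S - prob S - \<theta> * expect (\<lambda>d. indicator S d * (real d - 1)) =
     expect ?g"
    unfolding tilted_mass_def using i1 i2 integrable_tilted_mass[of S L \<theta>] by simp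
  have "\<bar>expect ?g\<bar> \<le> expect (\<lambda>d. (1 + real d powr (1 + \<beta>)) * ?R)"
    unfolding real_norm_def[symmetric]
  proof (rule order_trans[OF integral_norm_bound], rule integral_mono)
    show "integrable (measure_pmf \<xi>) (\<lambda>d. norm (?g d))"
      using i1 i2 integrable_tilted_mass[of S L \<theta>] by auto
    show "integrable (measure_pmf \<xi>) (\<lambda>d. (1 + real d powr (1 + \<beta>)) * ?R)"
      by (rule integrable_mult_left) (use iM in auto)
    fix d
    have "\<bar>?h d\<bar> \<le> (1 + real d powr (1 + \<beta>)) * ?R"
    proof (cases "real d \<le> L")
      case True
      define x where "x = \<theta> * (real d - 1)"
      have ax: "\<bar>x\<bar> = s * \<bar>real d - 1\<bar>" using \<theta> by (simp add: x_def abs_mult)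
      have "x \<le> s * L"
      proof -
        have "\<bar>x\<bar> \<le> s * L" unfolding ax using True L \<theta> by (intro mult_left_mono) auto
        then show ?thesis by linarith
      qed
      then have "\<bar>?h d\<bar> \<le> \<bar>x\<bar> powr (1 + \<beta>) * exp (s * L)"
        using exp_taylor_bound[OF \<beta>, of x "s * L"] True L \<theta> by (simp add: x_def)
      also have "\<bar>x\<bar> powr (1 + \<beta>) = s powr (1 + \<beta>) * \<bar>real d - 1\<bar> powr (1 + \<beta>)"
        unfolding ax using \<theta> by (simp add: powr_mult)
      also have "\<bar>real d - 1\<bar> powr (1 + \<beta>) \<le> 1 + real d powr (1 + \<beta>)"
      proof (cases "d = 0")
        case False
        then have "\<bar>real d - 1\<bar> powr (1 + \<beta>) \<le> real d powr (1 + \<beta>)" using \<beta> by (intro powr_mono2) auto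
        then show ?thesis by simp
      qed simp
      finally have "\<bar>?h d\<bar> \<le> (1 + real d powr (1 + \<beta>)) * (s powr (1 + \<beta>) * exp (s * L))"
        by (simp add: mult_ac mult_left_mono mult_right_mono)
      also have "\<dots> \<le> (1 + real d powr (1 + \<beta>)) * ?R"
        using \<theta> by (intro mult_left_mono) auto
      finally show ?thesis .
    next
      case False
      then have d: "real d > L" "real d \<ge> 1" using L by auto
      have "\<bar>\<theta> * (real d - 1)\<bar> = s * \<bar>real d - 1\<bar>" using \<theta> by (simp add: abs_mult)
      moreover have "?h d = - 1 - \<theta> * (real d - 1)" using False by simp
      ultimately have "\<bar>?h d\<bar> \<le> 1 + s * \<bar>real d - 1\<bar>" by linarith
      also have "\<dots> \<le> 1 + s * real d" using d \<theta> by (intro add_left_mono mult_left_mono) auto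
      also have "\<dots> \<le> (real d / L) powr (1 + \<beta>) + s * (real d * (real d / L) powr \<beta>)"
      proof -
        have "1 \<le> (real d / L) powr (1 + \<beta>)" "1 \<le> (real d / L) powr \<beta>"
          using d L \<beta> by (auto intro!: ge_one_powr_ge_zero)
        moreover from this(2) have "s * (real d * 1) \<le> s * (real d * (real d / L) powr \<beta>)"
          using \<theta> by (intro mult_left_mono) auto
        ultimately show ?thesis by simp
      qed
      also have "(real d / L) powr (1 + \<beta>) = real d powr (1 + \<beta>) * L powr (- 1 - \<beta>)"
      proof -
        have "L powr (- 1 - \<beta>) = inverse (L powr (1 + \<beta>))" using powr_minus[of L "1 + \<beta>"] by simp
        then show ?thesis using d L by (simp add: powr_divide field_simps)
      qed
      also have "real d * (real d / L) powr \<beta> = real d powr (1 + \<beta>) * L powr (-\<beta>)"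
      proof -
        have "real d powr (1 + \<beta>) = real d * real d powr \<beta>" using d by (simp add: powr_add)
        then show ?thesis using d L by (simp add: powr_divide powr_minus field_simps)
      qed
      also have "real d powr (1 + \<beta>) * L powr (- 1 - \<beta>) + s * (real d powr (1 + \<beta>) * L powr (-\<beta>)) = real d powr (1 + \<beta>) * (L powr (- 1 - \<beta>) + s * L powr (-\<beta>))"
        by (simp add: algebra_simps)
      also have "\<dots> \<le> (1 + real d powr (1 + \<beta>)) * ?R"
        using \<theta> by (intro mult_mono) auto
      finally show ?thesis .
    qed
    moreover have "(1 + real d powr (1 + \<beta>)) * ?R \<ge> 0" using \<theta> by auto
    ultimately show "norm (?g d) \<le> (1 + real d powr (1 + \<beta>)) * ?R"
      by (cases "d \<in> S") auto
  qed
  also have "\<dots> = expect (\<lambda>k. 1 + real k powr (1 + \<beta>)) * ?R"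
    by (rule integral_mult_left_zero)
  finally show ?thesis unfolding eq .
qed

text \<open>With s = K ln n / n and L = \<delta> n the factor exp (s L) is n^(K \<delta>). It loses against s^\<beta> because
K \<delta> \<le> \<beta> / 2, so the remainder is o(s).\<close>

lemma tilted_mass_expansion:
  assumes \<beta>: "0 < \<beta>" "\<beta> \<le> 1" and mom: "integrable (measure_pmf \<xi>) (\<lambda>k. real k powr (1 + \<beta>))"
    and K: "K > 0" "\<delta> > 0" "K * \<delta> \<le> \<beta> / 2" and \<sigma>: "\<sigma> \<in> {1, -1}"
  shows "(\<lambda>n. (tilted_mass (\<sigma> * (K * ln (real n) / real n)) (\<delta> * real n) S - prob S) / (K * ln (real n) / real n))
     \<longlonglongrightarrow> \<sigma> * expect (\<lambda>d. indicator S d * (real d - 1))"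
proof -
  define s where "s n = K * ln (real n) / real n" for n
  let ?m = "expect (\<lambda>d. indicator S d * (real d - 1))"
  let ?C = "expect (\<lambda>k. 1 + real k powr (1 + \<beta>))"
  have C: "?C \<ge> 0" by (rule integral_nonneg_AE) auto
  have lim: "(\<lambda>n. ?C * (s n powr \<beta> * real n powr (\<beta> / 2) + (\<delta> * real n) powr (- 1 - \<beta>) / s n + (\<delta> * real n) powr (-\<beta>))) \<longlonglongrightarrow> ?C * (0 + 0 + 0)"
    unfolding s_def using \<beta> K by (intro tendsto_intros; real_asymp)
  have "(\<lambda>n. (tilted_mass (\<sigma> * s n) (\<delta> * real n) S - prob S) / s n - \<sigma> * ?m) \<longlonglongrightarrow> 0"
  proof (rule Lim_null_comparison)
    have "\<forall>\<^sub>F n::nat in sequentially. \<delta> * real n \<ge> 1" using K by real_asymp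
    moreover have "\<forall>\<^sub>F n in sequentially. s n > 0" unfolding s_def using K by real_asymp
    ultimately show "\<forall>\<^sub>F n in sequentially. norm ((tilted_mass (\<sigma> * s n) (\<delta> * real n) S - prob S) / s n - \<sigma> * ?m)
       \<le> ?C * (s n powr \<beta> * real n powr (\<beta> / 2) + (\<delta> * real n) powr (- 1 - \<beta>) / s n + (\<delta> * real n) powr (-\<beta>))"
      using eventually_gt_at_top[of 0]
    proof eventually_elim
      case (elim n)
      have "exp (s n * (\<delta> * real n)) = real n powr (K * \<delta>)"
        using elim by (simp add: s_def powr_def mult_ac)
      also have "\<dots> \<le> real n powr (\<beta> / 2)" using K elim by (intro powr_mono) auto
      finally have e: "exp (s n * (\<delta> * real n)) \<le> real n powr (\<beta> / 2)" .
      have "\<bar>(tilted_mass (\<sigma> * s n) (\<delta> * real n) S - prob S) / s n - \<sigma> * ?m\<bar> = 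
        \<bar>tilted_mass (\<sigma> * s n) (\<delta> * real n) S - prob S - \<sigma> * s n * ?m\<bar> / s n"
        using elim by (simp add: field_simps flip: abs_mult)
      also have "\<dots> \<le> ?C * (s n powr (1 + \<beta>) * exp (s n * (\<delta> * real n)) + (\<delta> * real n) powr (- 1 - \<beta>) + s n * (\<delta> * real n) powr (-\<beta>)) / s n"
        using elim \<sigma> by (intro divide_right_mono tilted_mass_expansion_bound \<beta> mom) (auto simp: abs_mult)
      also have "\<dots> \<le> ?C * (s n powr (1 + \<beta>) * real n powr (\<beta> / 2) + (\<delta> * real n) powr (- 1 - \<beta>) + s n * (\<delta> * real n) powr (-\<beta>)) / s n"
        using elim C e by (intro divide_right_mono mult_left_mono add_right_mono) auto
      also have "\<dots> = ?C * (s n powr \<beta> * real n powr (\<beta> / 2) + (\<delta> * real n) powr (- 1 - \<beta>) / s n + (\<delta> * real n) powr (-\<beta>))"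
        using elim by (simp add: powr_add field_simps)
      finally show ?case by simp
    qed
  qed (use lim in simp)
  then show ?thesis unfolding s_def by (rule LIM_zero_cancel)
qed

text \<open>The number of letters in \<Omega> that remain when one big letter is removed from a word with n letters in
\<Omega>: large numbers belong to \<Omega> exactly if \<Omega> is cofinite.\<close>

definition rest :: "nat \<Rightarrow> nat" where "rest n = (if finite \<Omega> then n else n - 1)"

lemma rest: "rest n \<le> n" "n \<le> rest n + 1" by (auto simp: rest_def)

lemma prob_compl_Omega: "prob (-\<Omega>) = 1 - p"
  using measure_pmf.prob_compl[of \<Omega> \<xi>] by (simp add: p_def Compl_eq_Diff_UNIV)

lemma p_le_1: "p \<le> 1" by (simp add: p_def)

lemma prob_split: "prob S = prob (S \<inter> \<Omega>) + prob (S - \<Omega>)"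
  by (subst measure_pmf.finite_measure_Union[symmetric]) (auto intro!: arg_cong[where f = "prob"])

definition tilt :: "real \<Rightarrow> nat \<Rightarrow> real" where "tilt K n = K * ln (real n) / real n"

text \<open>The total weight is A^m / (1 - B)^(m+1) with A and B the tilted masses of \<Omega> and its
complement, and A / (1 - B) = 1 - \<sigma> c s + o(s). Raised to a power near n = K ln n / s this
is n^(- \<sigma> K c + o(1)).\<close>

lemma tilted_all_words_bound:
  assumes \<beta>: "0 < \<beta>" "\<beta> \<le> 1" and mom: "integrable (measure_pmf \<xi>) (\<lambda>k. real k powr (1 + \<beta>))"
    and K: "K > 0" "\<delta> > 0" "K * \<delta> \<le> \<beta> / 2" and \<sigma>: "\<sigma> \<in> {1, -1}" and "\<epsilon> > 0"
  shows "\<forall>\<^sub>F n in sequentially. \<forall>m. m \<le> n \<and> n \<le> m + 1 \<longrightarrow>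
     all_words (\<lambda>M. word_weight (tilted (\<sigma> * tilt K n) (\<delta> * real n)) M * of_bool (letters_in \<Omega> M = m)) \<le> ennreal (2 / p * real n powr (K * (\<epsilon> - \<sigma> * c)))"
proof -
  define A where "A n = tilted_mass (\<sigma> * tilt K n) (\<delta> * real n) \<Omega>" for n
  define B where "B n = tilted_mass (\<sigma> * tilt K n) (\<delta> * real n) (-\<Omega>)" for n
  define a where "a = expect (\<lambda>d. indicator \<Omega> d * (real d - 1))"
  define b where "b = expect (\<lambda>d. indicator (-\<Omega>) d * (real d - 1))"
  have A: "(\<lambda>n. (A n - p) / tilt K n) \<longlonglongrightarrow> \<sigma> * a"
    using tilted_mass_expansion[OF \<beta> mom K \<sigma>, of \<Omega>] unfolding A_def tilt_def a_def p_def .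
  have B: "(\<lambda>n. (B n - (1 - p)) / tilt K n) \<longlonglongrightarrow> \<sigma> * b"
    using tilted_mass_expansion[OF \<beta> mom K \<sigma>, of "-\<Omega>"] unfolding B_def tilt_def b_def prob_compl_Omega .
  have ab: "a + b = - (c * p)"
  proof -
    have i: "integrable (measure_pmf \<xi>) (\<lambda>d. indicator S d * (real d - 1))" for S
      by (rule Bochner_Integration.integrable_bound[where f = "\<lambda>d. real d + 1"]) (use int in \<open>auto simp: indicator_def\<close>)
    have "a + b = expect (\<lambda>d. indicator \<Omega> d * (real d - 1) + indicator (-\<Omega>) d * (real d - 1))"
      unfolding a_def b_def by (rule Bochner_Integration.integral_add[symmetric, OF i i])
    also have "(\<lambda>d. indicator \<Omega> d * (real d - 1) + indicator (-\<Omega>) d * (real d - 1)) = (\<lambda>d. real d - 1)"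
      by (auto simp: indicator_def)
    also have "expect (\<lambda>d. real d - 1) = expect real - 1"
      using int by simp
    finally show ?thesis using p_pos by (simp add: c_def)
  qed
  have s0: "tilt K \<longlonglongrightarrow> 0" unfolding tilt_def by real_asymp
  have spos: "\<forall>\<^sub>F n in sequentially. tilt K n > 0" unfolding tilt_def using K by real_asymp
  have B1: "(\<lambda>n. 1 - B n) \<longlonglongrightarrow> p"
  proof -
    have "(\<lambda>n. p - tilt K n * ((B n - (1 - p)) / tilt K n)) \<longlonglongrightarrow> p - 0 * (\<sigma> * b)"
      by (intro tendsto_intros s0 B)
    moreover have "\<forall>\<^sub>F n in sequentially. p - tilt K n * ((B n - (1 - p)) / tilt K n) = 1 - B n"
      using spos by eventually_elim simp
    ultimately show ?thesis by (simp add: Lim_transform_eventually)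
  qed
  define x where "x n = A n / (1 - B n) - 1" for n
  have x: "(\<lambda>n. x n / tilt K n) \<longlonglongrightarrow> - \<sigma> * c"
  proof -
    have "(\<lambda>n. ((A n - p) / tilt K n + (B n - (1 - p)) / tilt K n) / (1 - B n)) \<longlonglongrightarrow> (\<sigma> * a + \<sigma> * b) / p"
      using p_pos by (intro tendsto_intros A B B1) auto
    also have "(\<sigma> * a + \<sigma> * b) / p = - \<sigma> * c"
      using p_pos ab by (simp add: field_simps flip: distrib_left)
    finally show ?thesis
    proof (rule Lim_transform_eventually)
      have "\<forall>\<^sub>F n in sequentially. 1 - B n > 0" using order_tendstoD(1)[OF B1, of 0] p_pos by simp
      with spos show "\<forall>\<^sub>F n in sequentially. ((A n - p) / tilt K n + (B n - (1 - p)) / tilt K n) / (1 - B n) = x n / tilt K n"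
        by eventually_elim (simp add: x_def field_simps)
    qed
  qed
  have "\<forall>\<^sub>F n in sequentially. x n / tilt K n < \<epsilon> / 2 - \<sigma> * c"
    using \<open>\<epsilon> > 0\<close> by (intro order_tendstoD(2)[OF x]) auto
  moreover have "\<forall>\<^sub>F n in sequentially. 1 - B n > p / 2"
    using p_pos by (intro order_tendstoD(1)[OF B1]) auto
  moreover have "\<forall>\<^sub>F n in sequentially. tilt K n * (\<epsilon> + c) \<le> K * (\<epsilon> / 2) * ln (real n)"
    unfolding tilt_def using K \<open>\<epsilon> > 0\<close> c_pos by real_asymp
  ultimately show ?thesis using spos eventually_gt_at_top[of 1]
  proof eventually_elim
    case (elim n)
    show ?case
    proof (intro allI impI)
      fix m assume m: "m \<le> n \<and> n \<le> m + 1"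
      \<comment> \<open>half of \<epsilon> absorbs the o(s), the other half the difference between m and n\<close>
      define g where "g = \<epsilon> / 2 - \<sigma> * c"
      have B': "1 - B n > 0" "B n < 1" using elim p_pos by auto
      have "x n \<le> tilt K n * g" using elim by (simp add: g_def field_simps)
      then have "real m * x n \<le> real m * (tilt K n * g)" by (intro mult_left_mono) auto
      also have "\<dots> \<le> real n * tilt K n * g + tilt K n * (\<epsilon> + c)"
      proof -
        have "(real m - real n) * (tilt K n * g) \<le> \<bar>(real m - real n) * (tilt K n * g)\<bar>" by simp
        also have "\<dots> \<le> 1 * (tilt K n * (\<epsilon> + c))"
          unfolding abs_mult using m elim \<sigma> \<open>\<epsilon> > 0\<close> c_pos by (intro mult_mono) (auto simp: g_def)
        finally show ?thesis by (simp add: algebra_simps)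
      qed
      also have "real n * tilt K n = K * ln (real n)" using elim by (simp add: tilt_def)
      also have "K * ln (real n) * g + tilt K n * (\<epsilon> + c) \<le> K * (\<epsilon> - \<sigma> * c) * ln (real n)"
        using elim by (simp add: g_def algebra_simps)
      finally have mx: "real m * x n \<le> K * (\<epsilon> - \<sigma> * c) * ln (real n)" .
      have "0 \<le> A n / (1 - B n)" unfolding A_def using B' tilted_mass_nonneg by simp
      have "all_words (\<lambda>M. word_weight (tilted (\<sigma> * tilt K n) (\<delta> * real n)) M * of_bool (letters_in \<Omega> M = m)) = ennreal (A n ^ m / (1 - B n) ^ Suc m)"
        unfolding A_def B_def by (rule all_words_tilted) (use B' in \<open>simp add: B_def\<close>)
      also have "A n ^ m / (1 - B n) ^ Suc m = (A n / (1 - B n)) ^ m * (1 / (1 - B n))"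
        by (simp add: power_divide)
      also have "\<dots> \<le> exp (real m * x n) * (2 / p)"
      proof (intro mult_mono)
        have "(A n / (1 - B n)) ^ m \<le> exp (x n) ^ m"
          using \<open>0 \<le> A n / (1 - B n)\<close> exp_ge_add_one_self[of "x n"] by (intro power_mono) (auto simp: x_def)
        then show "(A n / (1 - B n)) ^ m \<le> exp (real m * x n)" by (simp add: exp_of_nat_mult)
        show "1 / (1 - B n) \<le> 2 / p" using elim B' p_pos by (simp add: field_simps)
      qed (use B' in auto)
      also have "\<dots> \<le> exp (K * (\<epsilon> - \<sigma> * c) * ln (real n)) * (2 / p)"
        using mx p_pos by (intro mult_right_mono) auto
      also have "\<dots> = 2 / p * real n powr (K * (\<epsilon> - \<sigma> * c))" using elim by (simp add: powr_def)
      finally show "all_words (\<lambda>M. word_weight (tilted (\<sigma> * tilt K n) (\<delta> * real n)) M * of_bool (letters_in \<Omega> M = m)) \<le> ennreal (2 / p * real n powr (K * (\<epsilon> - \<sigma> * c)))"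
        by (simp add: ennreal_leI)
    qed
  qed
qed

lemma tilted_mass_0: "tilted_mass 0 L S = prob S - prob (S \<inter> {k. L < real k})"
proof -
  have "tilted_mass 0 L S = expect (indicator (S - {k. L < real k}))"
    unfolding tilted_mass_def by (intro Bochner_Integration.integral_cong) (auto simp: indicator_def)
  also have "\<dots> = prob (S - S \<inter> {k. L < real k})"
    by (simp add: Diff_Int_distrib2 Diff_Int)
  also have "\<dots> = prob S - prob (S \<inter> {k. L < real k})"
    by (rule measure_pmf.finite_measure_Diff) auto
  finally show ?thesis .
qed

text \<open>Here A / (1 - B) = 1 - F / (1 - B), where F is the probability of exceeding y n. The limit thus
depends only on the total tail F and not on how it is divided between \<Omega> and its complement.\<close>

lemma truncated_mass:
  assumes y: "(\<lambda>n. real n * prob {k. y n < real k}) \<longlonglongrightarrow> l"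
  shows "\<exists>v. v \<longlonglongrightarrow> exp (- l / p) / p \<and>
    (\<forall>\<^sub>F n in sequentially. all_words (\<lambda>M. word_weight (tilted 0 (y n)) M * of_bool (letters_in \<Omega> M = rest n)) = ennreal (v n))"
proof -
  define F where "F n = prob {k. y n < real k}" for n
  define A where "A n = tilted_mass 0 (y n) \<Omega>" for n
  define B where "B n = tilted_mass 0 (y n) (-\<Omega>)" for n
  have F0: "F \<longlonglongrightarrow> 0"
  proof (rule Lim_transform_eventually)
    show "(\<lambda>n. (real n * F n) * (1 / real n)) \<longlonglongrightarrow> 0"
      using tendsto_mult[OF y lim_1_over_n] by (simp add: F_def)
    show "\<forall>\<^sub>F n in sequentially. real n * F n * (1 / real n) = F n"
      using eventually_gt_at_top[of 0] by eventually_elim simp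
  qed
  have AB: "A n = (1 - B n) - F n" for n
  proof -
    have "{k. y n < real k} \<inter> \<Omega> = \<Omega> \<inter> {k. y n < real k}" "{k. y n < real k} - \<Omega> = (-\<Omega>) \<inter> {k. y n < real k}" by auto
    then show ?thesis unfolding A_def B_def F_def tilted_mass_0 prob_compl_Omega p_def[symmetric]
      by (subst prob_split) simp
  qed
  have Bb: "p \<le> 1 - B n" "1 - B n \<le> p + F n" for n
  proof -
    have "prob (-\<Omega> \<inter> {k. y n < real k}) \<le> F n"
      unfolding F_def by (rule measure_pmf.finite_measure_mono) auto
    then show "p \<le> 1 - B n" "1 - B n \<le> p + F n" unfolding B_def tilted_mass_0 prob_compl_Omega by auto
  qed
  have B1: "(\<lambda>n. 1 - B n) \<longlonglongrightarrow> p"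
    by (rule real_tendsto_sandwich[OF _ _ tendsto_const[of p], of _ _ "\<lambda>n. p + F n"])
       (use Bb tendsto_add[OF tendsto_const[of p] F0] in auto)
  \<comment> \<open>the total weight is (1 - t n)^(rest n) / (1 - B n), and n t n tends to l / p\<close>
  define t where "t n = F n / (1 - B n)" for n
  have t0: "t \<longlonglongrightarrow> 0" unfolding t_def using tendsto_divide[OF F0 B1] p_pos by simp
  have nt: "(\<lambda>n. real n * t n) \<longlonglongrightarrow> l / p"
    unfolding t_def using tendsto_divide[OF y B1] p_pos by (simp add: F_def)
  have mt: "(\<lambda>n. real (rest n) * t n) \<longlonglongrightarrow> l / p"
  proof (rule real_tendsto_sandwich[OF _ _ _ nt])
    have tn: "t n \<ge> 0" for n using Bb(1)[of n] p_pos by (simp add: t_def F_def)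
    show "\<forall>\<^sub>F n in sequentially. real (rest n) * t n \<le> real n * t n"
      using tn rest(1) by (intro always_eventually allI mult_right_mono) auto
    show "\<forall>\<^sub>F n in sequentially. real n * t n - t n \<le> real (rest n) * t n"
    proof (intro always_eventually allI)
      fix n
      have "(real n - 1) * t n \<le> real (rest n) * t n" using rest(2)[of n] tn by (intro mult_right_mono) auto
      then show "real n * t n - t n \<le> real (rest n) * t n" by (simp add: algebra_simps)
    qed
    show "(\<lambda>n. real n * t n - t n) \<longlonglongrightarrow> l / p" using tendsto_diff[OF nt t0] by simp
  qed
  have t1: "\<forall>\<^sub>F n in sequentially. t n < 1" using order_tendstoD(2)[OF t0, of 1] by simp
  have "(\<lambda>n. real (rest n) * ln (1 - t n)) \<longlonglongrightarrow> - (l / p)"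
  proof (rule real_tendsto_sandwich)
    show "\<forall>\<^sub>F n in sequentially. - (real (rest n) * t n) / (1 - t n) \<le> real (rest n) * ln (1 - t n)"
      using t1
    proof eventually_elim
      case (elim n)
      have "ln (1 / (1 - t n)) \<le> 1 / (1 - t n) - 1" using elim by (intro ln_le_minus_one) auto
      also have "1 / (1 - t n) - 1 = t n / (1 - t n)" using elim by (simp add: field_simps)
      finally have "- (t n / (1 - t n)) \<le> ln (1 - t n)" using elim by (simp add: ln_div)
      then have "real (rest n) * - (t n / (1 - t n)) \<le> real (rest n) * ln (1 - t n)" by (intro mult_left_mono) auto
      then show ?case by simp
    qed
    show "\<forall>\<^sub>F n in sequentially. real (rest n) * ln (1 - t n) \<le> - (real (rest n) * t n)"
      using t1
    proof eventually_elim
      case (elim n)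
      have "ln (1 - t n) \<le> (1 - t n) - 1" using elim by (intro ln_le_minus_one) auto
      then have "real (rest n) * ln (1 - t n) \<le> real (rest n) * - t n" by (intro mult_left_mono) auto
      then show ?case by simp
    qed
    show "(\<lambda>n. - (real (rest n) * t n) / (1 - t n)) \<longlonglongrightarrow> - (l / p)"
      using tendsto_divide[OF tendsto_minus[OF mt] tendsto_diff[OF tendsto_const[of 1] t0]] by simp
    show "(\<lambda>n. - (real (rest n) * t n)) \<longlonglongrightarrow> - (l / p)" by (rule tendsto_minus[OF mt])
  qed
  then have "(\<lambda>n. exp (real (rest n) * ln (1 - t n)) * (1 / (1 - B n))) \<longlonglongrightarrow> exp (- (l / p)) * (1 / p)"
    using p_pos by (intro tendsto_intros B1) auto
  moreover have "\<forall>\<^sub>F n in sequentially. all_words (\<lambda>M. word_weight (tilted 0 (y n)) M * of_bool (letters_in \<Omega> M = rest n)) = ennreal (exp (real (rest n) * ln (1 - t n)) * (1 / (1 - B n)))"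
    using t1
  proof eventually_elim
    case (elim n)
    have B': "1 - B n > 0" using Bb(1)[of n] p_pos by linarith
    have "all_words (\<lambda>M. word_weight (tilted 0 (y n)) M * of_bool (letters_in \<Omega> M = rest n)) = ennreal (A n ^ rest n / (1 - B n) ^ Suc (rest n))"
      unfolding A_def B_def by (rule all_words_tilted) (use B' in \<open>simp add: B_def\<close>)
    also have "A n ^ rest n / (1 - B n) ^ Suc (rest n) = (A n / (1 - B n)) ^ rest n * (1 / (1 - B n))"
      by (simp add: power_divide)
    also have "A n / (1 - B n) = exp (ln (1 - t n))"
      using elim B' by (simp add: AB t_def diff_divide_distrib)
    also have "exp (ln (1 - t n)) ^ rest n = exp (real (rest n) * ln (1 - t n))" by (simp only: exp_of_nat_mult)
    finally show ?case .
  qed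
  ultimately show ?thesis by (intro exI[of _ "\<lambda>n. exp (real (rest n) * ln (1 - t n)) * (1 / (1 - B n))"]) simp
qed

lemma total_mass: "all_words (\<lambda>M. W M * of_bool (letters_in \<Omega> M = n)) = ennreal (1 / p)"
proof -
  have e: "nat_sum (\<lambda>d. offspring_weight d * indicator S d) = ennreal (prob S)" for S
  proof -
    have "nat_sum (\<lambda>d. offspring_weight d * indicator S d) = (\<integral>\<^sup>+d. indicator S d \<partial>measure_pmf \<xi>)"
      by (simp add: nn_integral_measure_pmf)
    then show ?thesis by (simp add: measure_pmf.emeasure_eq_measure)
  qed
  have "all_words (\<lambda>M. W M * of_bool (letters_in \<Omega> M = n)) = ennreal (p ^ n / (1 - (1 - p)) ^ Suc n)"
    by (rule all_words_count) (use e[of \<Omega>] e[of "-\<Omega>"] p_pos p_le_1 in \<open>auto simp: prob_compl_Omega p_def[symmetric]\<close>)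
  then show ?thesis using p_pos by simp
qed

section \<open>Local asymptotics of the offspring law\<close>

text \<open>The probability of a jump of the typical size c n, continued to non-integral arguments.\<close>

definition rho :: "nat \<Rightarrow> real" where "rho n = f (c * real n) * (c * real n) powr (- 1 - \<alpha>)"

lemma cn_top: "filterlim (\<lambda>n. c * real n) at_top sequentially"
  using c_pos by (intro filterlim_tendsto_pos_mult_at_top[OF tendsto_const _ filterlim_real_sequentially])

lemma f_pos: "\<forall>\<^sub>F x in at_top. f x > 0"
  using sv by (auto simp: slowly_varying_def eventually_at_top_linorder)

lemma rho_pos: "\<forall>\<^sub>F n in sequentially. rho n > 0"
  using eventually_compose_filterlim[OF f_pos cn_top] eventually_gt_at_top[of 0]
  by eventually_elim (use c_pos in \<open>simp add: rho_def\<close>)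

lemma eventually_real_ge:
  assumes "a > 0" shows "\<forall>\<^sub>F n in sequentially. a * real n \<ge> X"
  using filterlim_tendsto_pos_mult_at_top[OF tendsto_const assms filterlim_real_sequentially]
  unfolding filterlim_at_top by blast

text \<open>Uniform convergence applied with base point c n / 2, so that both k and c n are multiples of the base
point by factors between 1 and 3.\<close>

lemma jump_law_close:
  assumes "\<eta> > 0"
  shows "\<exists>\<epsilon>. 0 < \<epsilon> \<and> \<epsilon> \<le> c / 2 \<and>
    (\<forall>\<^sub>F n in sequentially. \<forall>k. \<bar>real k - c * real n\<bar> \<le> \<epsilon> * real n \<longrightarrow> \<bar>pmf \<xi> k / rho n - 1\<bar> \<le> \<eta>)"
proof -
  \<comment> \<open>it suffices to keep the logarithm of the ratio below \<zeta> in absolute value; f and the power take one half each\<close>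
  define \<zeta> where "\<zeta> = ln (1 + \<eta>)"
  have \<zeta>: "\<zeta> > 0" "exp \<zeta> = 1 + \<eta>" using assms by (auto simp: \<zeta>_def)
  define \<epsilon> where "\<epsilon> = min (c / 2) (c * \<zeta> / (4 * (1 + \<alpha>)))"
  have "\<epsilon> \<le> c / 2" "\<epsilon> \<le> c * \<zeta> / (4 * (1 + \<alpha>))" unfolding \<epsilon>_def by (rule min.cobounded1, rule min.cobounded2)
  moreover have "\<epsilon> > 0" using \<zeta> c_pos \<alpha> by (simp add: \<epsilon>_def)
  ultimately have \<epsilon>: "\<epsilon> > 0" "\<epsilon> \<le> c / 2" "\<epsilon> \<le> c * \<zeta> / (4 * (1 + \<alpha>))" by simp_all
  have \<epsilon>': "(1 + \<alpha>) * (2 * (\<epsilon> / c)) \<le> \<zeta> / 2" using \<epsilon>(3) c_pos \<alpha> by (simp add: field_simps)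
  obtain X where X: "X > 0" "\<And>x t. x \<ge> X \<Longrightarrow> t \<in> {1..3} \<Longrightarrow> f x > 0 \<and> \<bar>ln (f (t * x)) - ln (f x)\<bar> < \<zeta> / 4"
    using slowly_varying_uniform[OF sv, of 3 "\<zeta> / 4"] \<zeta> by auto
  obtain k0 where k0: "\<And>k. k \<ge> k0 \<Longrightarrow> pmf \<xi> k = f (real k) * real k powr (- 1 - \<alpha>)"
    using pmf_tail by (auto simp: eventually_sequentially)
  have "\<forall>\<^sub>F n in sequentially. \<forall>k. \<bar>real k - c * real n\<bar> \<le> \<epsilon> * real n \<longrightarrow> \<bar>pmf \<xi> k / rho n - 1\<bar> \<le> \<eta>"
    using eventually_real_ge[OF half_gt_zero[OF c_pos], of "max X (real k0)"] eventually_gt_at_top[of 0]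
  proof eventually_elim
    case (elim n)
    show ?case
    proof (intro allI impI)
      fix k assume k: "\<bar>real k - c * real n\<bar> \<le> \<epsilon> * real n"
      define x where "x = c / 2 * real n"
      have x: "x \<ge> X" "x \<ge> real k0" "x > 0" using elim X(1) by (auto simp: x_def)
      have cn: "c * real n = 2 * x" by (simp add: x_def)
      have "\<epsilon> * real n \<le> x" unfolding x_def by (rule mult_right_mono[OF \<epsilon>(2)]) simp
      with k cn have kx: "x \<le> real k" "real k \<le> 3 * x" by linarith+
      have "real k / x \<in> {1..3}" using kx x by (auto simp: field_simps)
      from X(2)[OF x(1) this] X(2)[OF x(1), of 2] x
      have fk: "\<bar>ln (f (real k)) - ln (f x)\<bar> < \<zeta> / 4" "\<bar>ln (f (2 * x)) - ln (f x)\<bar> < \<zeta> / 4" by auto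
      have pos: "f (real k) > 0" "f (2 * x) > 0" using X(2)[of "real k" 1] X(2)[of "2 * x" 1] kx x by auto
      have kpos: "real k > 0" using kx x by linarith
      define q where "q = \<epsilon> / c"
      define r where "r = real k / (2 * x)"
      have "\<bar>r - 1\<bar> = \<bar>real k - c * real n\<bar> / (c * real n)"
      proof -
        have "r - 1 = (real k - 2 * x) / (2 * x)" using x by (simp add: r_def field_simps)
        then show ?thesis using x by (simp add: cn abs_divide)
      qed
      also have "\<dots> \<le> \<epsilon> * real n / (c * real n)" using k c_pos by (intro divide_right_mono) auto
      finally have r1: "\<bar>r - 1\<bar> \<le> q" using elim by (simp add: q_def)
      have "r \<ge> 1 / 2" using kx x by (simp add: r_def field_simps)
      have "ln r \<le> q" using ln_le_minus_one[of r] r1 \<open>r \<ge> 1 / 2\<close> by linarith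
      moreover have "- ln r \<le> 2 * q"
      proof -
        have "- ln r = ln (1 / r)" using \<open>r \<ge> 1 / 2\<close> by (simp add: ln_div)
        also have "\<dots> \<le> 1 / r - 1" using \<open>r \<ge> 1 / 2\<close> by (intro ln_le_minus_one) auto
        also have "1 / r - 1 = (1 - r) * (1 / r)" using \<open>r \<ge> 1 / 2\<close> by (simp add: field_simps)
        also have "\<dots> \<le> \<bar>r - 1\<bar> * 2"
          using \<open>r \<ge> 1 / 2\<close> by (intro mult_mono) (auto simp: field_simps)
        also have "\<dots> \<le> q * 2" using r1 by (rule mult_right_mono) simp
        finally show ?thesis by (simp only: mult.commute)
      qed
      moreover have "q > 0" using \<epsilon> c_pos by (simp add: q_def)
      ultimately have "\<bar>ln r\<bar> \<le> 2 * q" by linarith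
      then have "(1 + \<alpha>) * \<bar>ln r\<bar> \<le> (1 + \<alpha>) * (2 * q)" using \<alpha> by (intro mult_left_mono) auto
      with \<epsilon>'[folded q_def] have lr: "(1 + \<alpha>) * \<bar>ln r\<bar> \<le> \<zeta> / 2" by linarith
      define z where "z = (ln (f (real k)) - ln (f (2 * x))) - (1 + \<alpha>) * ln r"
      have "\<bar>(1 + \<alpha>) * ln r\<bar> \<le> \<zeta> / 2" using lr \<alpha> by (simp add: abs_mult)
      then have z: "\<bar>z\<bar> \<le> \<zeta>" using fk unfolding z_def by linarith
      have "k \<ge> k0" using kx x by linarith
      then have "pmf \<xi> k / rho n = f (real k) * real k powr (- 1 - \<alpha>) / (f (2 * x) * (2 * x) powr (- 1 - \<alpha>))"
        by (simp only: k0 rho_def cn)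
      also have "\<dots> = exp (ln (f (real k)) - ln (f (2 * x))) * r powr (- 1 - \<alpha>)"
        using pos x kpos by (simp add: exp_diff r_def powr_divide)
      also have "r powr (- 1 - \<alpha>) = exp (- (1 + \<alpha>) * ln r)"
        using \<open>r \<ge> 1 / 2\<close> by (simp add: powr_def algebra_simps)
      also have "exp (ln (f (real k)) - ln (f (2 * x))) * exp (- (1 + \<alpha>) * ln r) = exp z"
        unfolding exp_add[symmetric] by (rule arg_cong[where f = exp]) (simp add: z_def algebra_simps)
      finally have "pmf \<xi> k / rho n = exp z" .
      moreover have "exp z \<le> 1 + \<eta>" using z \<zeta> by (metis abs_le_iff exp_le_cancel_iff)
      moreover have "exp z \<ge> 1 - \<eta>"
      proof -
        have "1 + (- \<zeta>) \<le> exp (- \<zeta>)" by (rule exp_ge_add_one_self)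
        also have "\<dots> \<le> exp z" using z by simp
        finally show ?thesis using exp_ge_add_one_self[of \<zeta>] \<zeta> by linarith
      qed
      ultimately show "\<bar>pmf \<xi> k / rho n - 1\<bar> \<le> \<eta>" by linarith
    qed
  qed
  with \<epsilon> show ?thesis by blast
qed

text \<open>Potter's bound with exponent 1 + \<alpha> exactly compensates the decay of the power of k.\<close>

lemma jump_law_bound:
  assumes "\<delta> > 0"
  shows "\<exists>C>0. \<forall>\<^sub>F n in sequentially. \<forall>k. real k > \<delta> * real n \<longrightarrow> pmf \<xi> k \<le> C * rho n"
proof -
  obtain X C where X: "X > 0" "C > 0" "\<And>x y. x \<ge> X \<Longrightarrow> y \<ge> x \<Longrightarrow> f x > 0 \<and> f y \<le> C * f x * (y / x) powr (1 + \<alpha>)"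
    using slowly_varying_potter[OF sv, of "1 + \<alpha>"] \<alpha> by (metis add_pos_pos less_trans zero_less_one)
  obtain k0 where k0: "\<And>k. k \<ge> k0 \<Longrightarrow> pmf \<xi> k = f (real k) * real k powr (- 1 - \<alpha>)"
    using pmf_tail by (auto simp: eventually_sequentially)
  define D where "D = C * 2 * (\<delta> / c) powr (- 1 - \<alpha>)"
  have "D > 0" using X c_pos assms by (simp add: D_def)
  have "\<delta> / c > 0" using assms c_pos by simp
  then have "((\<lambda>x. f (\<delta> / c * x) / f x) \<longlongrightarrow> 1) at_top" using sv unfolding slowly_varying_def by blast
  from order_tendstoD(2)[OF this, of 2] have "\<forall>\<^sub>F x in at_top. f (\<delta> / c * x) / f x < 2" by simp
  from eventually_compose_filterlim[OF this cn_top] eventually_compose_filterlim[OF f_pos cn_top]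
  have "\<forall>\<^sub>F n in sequentially. \<forall>k. real k > \<delta> * real n \<longrightarrow> pmf \<xi> k \<le> D * rho n"
    using eventually_real_ge[OF assms, of "max X (real k0)"] eventually_gt_at_top[of 0]
  proof eventually_elim
    case (elim n)
    show ?case
    proof (intro allI impI)
      fix k assume k: "real k > \<delta> * real n"
      define x where "x = \<delta> * real n"
      have x: "x \<ge> X" "x > 0" "x \<ge> real k0" using elim X assms by (auto simp: x_def)
      have fx: "f x \<le> 2 * f (c * real n)"
        using elim c_pos by (simp add: x_def field_simps)
      have kx: "real k > x" "real k > 0" using k x by (auto simp: x_def)
      have "pmf \<xi> k = f (real k) * real k powr (- 1 - \<alpha>)" using k0[of k] kx x by simp
      also have "\<dots> \<le> (C * f x * (real k / x) powr (1 + \<alpha>)) * real k powr (- 1 - \<alpha>)"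
        using X(3)[of x "real k"] x kx by (intro mult_right_mono) auto
      also have "\<dots> = C * f x * x powr (- 1 - \<alpha>)"
      proof -
        have "real k powr (- 1 - \<alpha>) = inverse (real k powr (1 + \<alpha>))" "x powr (- 1 - \<alpha>) = inverse (x powr (1 + \<alpha>))"
          using powr_minus[of "real k" "1 + \<alpha>"] powr_minus[of x "1 + \<alpha>"] by simp_all
        then show ?thesis using kx x by (simp add: powr_divide field_simps)
      qed
      also have "\<dots> \<le> C * (2 * f (c * real n)) * x powr (- 1 - \<alpha>)"
        using fx X by (intro mult_right_mono mult_left_mono) auto
      also have "x powr (- 1 - \<alpha>) = (\<delta> / c) powr (- 1 - \<alpha>) * (c * real n) powr (- 1 - \<alpha>)"
        using c_pos assms by (simp add: x_def flip: powr_mult)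
      also have "C * (2 * f (c * real n)) * ((\<delta> / c) powr (- 1 - \<alpha>) * (c * real n) powr (- 1 - \<alpha>)) = D * rho n"
        by (simp add: D_def rho_def)
      finally show "pmf \<xi> k \<le> D * rho n" .
    qed
  qed
  with \<open>D > 0\<close> show ?thesis by blast
qed

lemma rho_lower: "(\<lambda>n. real n powr (- \<alpha> - 2) / rho n) \<longlonglongrightarrow> 0"
proof -
  obtain X C where X: "X > 0" "C > 0" "\<And>x y. x \<ge> X \<Longrightarrow> y \<ge> x \<Longrightarrow> f x > 0 \<and> f x \<le> C * f y * (y / x) powr (1 / 2)"
    using slowly_varying_potter[OF sv, of "1 / 2"] by (metis half_gt_zero zero_less_one)
  define D where "D = C / f X * (c / X) powr (1 / 2) * c powr (1 + \<alpha>)"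
  show ?thesis
  proof (rule Lim_null_comparison)
    show "(\<lambda>n. D * real n powr (- (1 / 2))) \<longlonglongrightarrow> 0" by real_asymp
    show "\<forall>\<^sub>F n in sequentially. norm (real n powr (- \<alpha> - 2) / rho n) \<le> D * real n powr (- (1 / 2))"
      using eventually_real_ge[OF c_pos, of X] eventually_gt_at_top[of 0] rho_pos
    proof eventually_elim
      case (elim n)
      have fX: "f X > 0" using X(3)[of X X] by simp
      have f: "f (c * real n) > 0" "f X \<le> C * f (c * real n) * (c * real n / X) powr (1 / 2)"
        using X(3)[of X "c * real n"] X(3)[of "c * real n" "c * real n"] elim X by auto
      have "real n powr (- \<alpha> - 2) / rho n = real n powr (- \<alpha> - 2) * inverse ((c * real n) powr (- 1 - \<alpha>)) * (1 / f (c * real n))"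
        by (simp add: rho_def field_simps)
      also have "\<dots> \<le> real n powr (- \<alpha> - 2) * inverse ((c * real n) powr (- 1 - \<alpha>)) * (C / f X * (c * real n / X) powr (1 / 2))"
        using f fX by (intro mult_left_mono) (auto simp: field_simps)
      also have "inverse ((c * real n) powr (- 1 - \<alpha>)) = c powr (1 + \<alpha>) * real n powr (1 + \<alpha>)"
      proof -
        have "(c * real n) powr (- 1 - \<alpha>) = inverse ((c * real n) powr (1 + \<alpha>))"
          using powr_minus[of "c * real n" "1 + \<alpha>"] by simp
        then show ?thesis using c_pos by (simp add: powr_mult)
      qed
      also have "(c * real n / X) powr (1 / 2) = (c / X) powr (1 / 2) * real n powr (1 / 2)"
        using c_pos X by (simp flip: powr_mult)
      also have "real n powr (- \<alpha> - 2) * (c powr (1 + \<alpha>) * real n powr (1 + \<alpha>)) * (C / f X * ((c / X) powr (1 / 2) * real n powr (1 / 2))) =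
         D * (real n powr (- \<alpha> - 2) * real n powr (1 + \<alpha>) * real n powr (1 / 2))"
        by (simp add: D_def mult_ac)
      also have "real n powr (- \<alpha> - 2) * real n powr (1 + \<alpha>) * real n powr (1 / 2) = real n powr (- (1 / 2))"
        unfolding powr_add[symmetric] by (rule arg_cong[where f = "\<lambda>x. _ powr x"]) simp
      finally show ?case using elim by simp
    qed
  qed
qed

definition tail :: "real \<Rightarrow> real" where "tail y = prob {k. y < real k}"

lemma tail_antimono: "x \<le> y \<Longrightarrow> tail y \<le> tail x"
  unfolding tail_def by (rule measure_pmf.finite_measure_mono) auto

lemma tail_pos: "tail y > 0"
proof -
  have "\<forall>\<^sub>F n in sequentially. f (real n) > 0"
    using eventually_compose_filterlim[OF f_pos filterlim_real_sequentially] .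
  moreover have "\<forall>\<^sub>F n in sequentially. real n > y"
    using filterlim_real_sequentially by (simp add: filterlim_at_top_dense)
  ultimately have "\<forall>\<^sub>F n in sequentially. pmf \<xi> n > 0 \<and> real n > y"
    using pmf_tail eventually_gt_at_top[of 0] by eventually_elim simp
  then obtain n where n: "pmf \<xi> n > 0" "real n > y"
    using eventually_happens'[OF sequentially_bot] by blast
  then have "0 < prob {n}" by (simp add: measure_pmf_single)
  also have "\<dots> \<le> tail y" unfolding tail_def using n by (intro measure_pmf.finite_measure_mono) auto
  finally show ?thesis .
qed

lemma tail_tendsto_0: "(tail \<longlongrightarrow> 0) at_top"
proof (rule Lim_null_comparison)
  define E where "E = expect real"
  show "((\<lambda>y. E / y) \<longlongrightarrow> 0) at_top" by real_asymp
  show "\<forall>\<^sub>F y in at_top. norm (tail y) \<le> E / y"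
    using eventually_gt_at_top[of 0]
  proof eventually_elim
    case (elim y)
    have "tail y = expect (indicator {k. y < real k})" by (simp add: tail_def)
    also have "\<dots> \<le> expect (\<lambda>k. real k / y)"
    proof (rule integral_mono)
      show "integrable (measure_pmf \<xi>) (indicator {k. y < real k} :: nat \<Rightarrow> real)"
        by (rule measure_pmf.integrable_const_bound[where B = 1]) auto
      show "integrable (measure_pmf \<xi>) (\<lambda>k. real k / y)" using int by simp
      show "indicator {k. y < real k} k \<le> real k / y" for k
        using elim by (auto simp: indicator_def field_simps)
    qed
    also have "\<dots> = E / y" by (simp add: E_def)
    finally show ?case by (simp add: tail_def)
  qed
qed

lemma nn_mean: "(\<integral>\<^sup>+x. of_nat x \<partial>measure_pmf \<xi>) < 1"
proof -
  have "(\<integral>\<^sup>+x. of_nat x \<partial>measure_pmf \<xi>) = (\<integral>\<^sup>+x. ennreal (real x) \<partial>measure_pmf \<xi>)"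
    by (simp add: ennreal_of_nat_eq_real_of_nat)
  also have "\<dots> = ennreal (expect real)"
    by (rule nn_integral_eq_integral[OF int]) simp
  also have "\<dots> < 1" using mean by (simp add: ennreal_less_one_iff)
  finally show ?thesis .
qed

end

section \<open>Words with and without a big letter\<close>

text \<open>A letter is big if it exceeds \<delta> n. The condition on K \<delta> keeps the tilted weights under
control, \<delta> < c / 2 separates big letters from the forced letter of size c n, and the value of K c makes
words without big letters negligible.\<close>

locale condensing_scale = condensing_offspring +
  fixes \<beta> K \<delta> :: real
  assumes \<beta>: "0 < \<beta>" "\<beta> \<le> 1" and mom: "integrable (measure_pmf \<xi>) (\<lambda>k. real k powr (1 + \<beta>))"
    and K: "K > 0" "\<delta> > 0" "K * \<delta> \<le> \<beta> / 2" and \<delta>c: "\<delta> < c / 2" and Kc: "K * c = 2 * (\<alpha> + 2)"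
begin

lemma word_weight_tilted_0: "word_weight (tilted 0 L) M = W M * of_bool (\<forall>d\<in>#M. real d \<le> L)"
  unfolding word_weight_tilted by simp

lemma n_tail_delta: "(\<lambda>n. real n * prob {k. \<delta> * real n < real k}) \<longlonglongrightarrow> 0"
proof (rule Lim_null_comparison)
  define E where "E = expect (\<lambda>k. real k powr (1 + \<beta>))"
  show "(\<lambda>n. real n * (E * (\<delta> * real n) powr (- 1 - \<beta>))) \<longlonglongrightarrow> 0" using \<beta> K by real_asymp
  show "\<forall>\<^sub>F n in sequentially. norm (real n * prob {k. \<delta> * real n < real k}) \<le> real n * (E * (\<delta> * real n) powr (- 1 - \<beta>))"
    using eventually_gt_at_top[of 0]
  proof eventually_elim
    case (elim n)
    define L where "L = \<delta> * real n"
    have L: "L > 0" using elim K by (simp add: L_def)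
    have "prob {k. L < real k} = expect (indicator {k. L < real k})" by simp
    also have "\<dots> \<le> expect (\<lambda>k. real k powr (1 + \<beta>) * L powr (- 1 - \<beta>))"
    proof (rule integral_mono)
      show "integrable (measure_pmf \<xi>) (indicator {k. L < real k} :: nat \<Rightarrow> real)"
        by (rule measure_pmf.integrable_const_bound[where B = 1]) auto
      show "integrable (measure_pmf \<xi>) (\<lambda>k. real k powr (1 + \<beta>) * L powr (- 1 - \<beta>))"
        by (rule integrable_mult_left) (rule mom)
      show "indicator {k. L < real k} k \<le> real k powr (1 + \<beta>) * L powr (- 1 - \<beta>)" for k
      proof (cases "L < real k")
        case True
        have "1 = L powr (1 + \<beta>) * L powr (- 1 - \<beta>)" using L by (simp flip: powr_add)
        also have "\<dots> \<le> real k powr (1 + \<beta>) * L powr (- 1 - \<beta>)"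
          using True L \<beta> by (intro mult_right_mono powr_mono2) auto
        finally show ?thesis using True by simp
      qed simp
    qed
    also have "\<dots> = E * L powr (- 1 - \<beta>)" unfolding E_def by (rule integral_mult_left_zero)
    finally show ?case by (auto simp: L_def intro!: mult_left_mono)
  qed
qed

text \<open>The value forced upon the distinguished letter by the other letters of the word.\<close>

definition excess :: "nat multiset \<Rightarrow> real" where "excess M = real (size M) - real (sum_mset M)"

lemma word_weight_tilted_excess: "word_weight (tilted \<theta> L) M = W M * ennreal (of_bool (\<forall>d\<in>#M. real d \<le> L) * exp (- \<theta> * excess M))"
  unfolding word_weight_tilted excess_def by (simp add: algebra_simps)

lemma big_letter_mass:
  assumes "r > 0"
  shows "\<forall>\<^sub>F n in sequentially. all_words (\<lambda>M. W M * of_bool (letters_in \<Omega> M = rest n \<and> \<not> (\<forall>d\<in>#M. real d \<le> \<delta> * real n))) \<le> ennreal r"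
proof -
  obtain v where v: "v \<longlonglongrightarrow> exp (- 0 / p) / p"
    "\<forall>\<^sub>F n in sequentially. all_words (\<lambda>M. word_weight (tilted 0 (\<delta> * real n)) M * of_bool (letters_in \<Omega> M = rest n)) = ennreal (v n)"
    using truncated_mass[OF n_tail_delta] by blast
  have "\<forall>\<^sub>F n in sequentially. v n > max 0 (1 / p - r)"
    using assms p_pos by (intro order_tendstoD(1)[OF v(1)]) auto
  with v(2) show ?thesis
  proof eventually_elim
    case (elim n)
    define T where "T = all_words (\<lambda>M. W M * of_bool (letters_in \<Omega> M = rest n \<and> \<not> (\<forall>d\<in>#M. real d \<le> \<delta> * real n)))"
    have "ennreal (v n) + T = all_words (\<lambda>M. W M * of_bool (letters_in \<Omega> M = rest n))"
      unfolding elim(1)[symmetric] T_def word_weight_tilted_0 all_words_add[symmetric] by (rule arg_cong[where f = all_words]) auto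
    also have "\<dots> = ennreal (1 / p)" by (rule total_mass)
    finally have e: "ennreal (v n) + T = ennreal (1 / p)" .
    then have "T \<noteq> \<top>" by (metis ennreal_add_eq_top ennreal_neq_top)
    then obtain t where t: "T = ennreal t" "t \<ge> 0" by (cases T) auto
    with e elim p_pos have "v n + t = 1 / p" by (simp flip: ennreal_plus)
    then show ?case using elim t unfolding T_def[symmetric] by (auto intro!: ennreal_leI)
  qed
qed

text \<open>Markov's inequality for the tilted weights: the event contributes the factor n^(K (\<sigma> c - \<epsilon>)),
the tilted total weight is of order at most n^(K (\<epsilon> / 2 - \<sigma> c)), and the product is n^(- K \<epsilon> / 2).\<close>

lemma excess_deviation:
  assumes \<epsilon>: "\<epsilon> > 0" and \<sigma>: "\<sigma> \<in> {1, -1}"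
  shows "\<forall>\<^sub>F n in sequentially. all_words (\<lambda>M. W M * of_bool (letters_in \<Omega> M = rest n \<and> (\<forall>d\<in>#M. real d \<le> \<delta> * real n)
     \<and> \<sigma> * (excess M - c * real n) < - (\<epsilon> * real n))) \<le> ennreal (2 / p * real n powr (- K * \<epsilon> / 2))"
proof -
  have "\<epsilon> / 2 > 0" using \<epsilon> by simp
  from tilted_all_words_bound[OF \<beta> mom K \<sigma> this] eventually_gt_at_top[of 0] show ?thesis
  proof eventually_elim
    case (elim n)
    define s where "s = tilt K n"
    define L where "L = \<delta> * real n"
    define b where "b = exp (s * ((\<sigma> * c - \<epsilon>) * real n))"
    have tilt: "s * real n = K * ln (real n)" using elim by (simp add: s_def tilt_def)
    have spos: "s \<ge> 0" unfolding s_def tilt_def using K elim by (intro divide_nonneg_nonneg mult_nonneg_nonneg) auto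
    have "all_words (\<lambda>M. W M * of_bool (letters_in \<Omega> M = rest n \<and> (\<forall>d\<in>#M. real d \<le> L) \<and> \<sigma> * (excess M - c * real n) < - (\<epsilon> * real n))) \<le>
       all_words (\<lambda>M. ennreal b * (word_weight (tilted (\<sigma> * s) L) M * of_bool (letters_in \<Omega> M = rest n)))"
    proof (rule all_words_mono)
      fix M
      show "W M * of_bool (letters_in \<Omega> M = rest n \<and> (\<forall>d\<in>#M. real d \<le> L) \<and> \<sigma> * (excess M - c * real n) < - (\<epsilon> * real n)) \<le>
        ennreal b * (word_weight (tilted (\<sigma> * s) L) M * of_bool (letters_in \<Omega> M = rest n))"
      proof (cases "letters_in \<Omega> M = rest n \<and> (\<forall>d\<in>#M. real d \<le> L) \<and> \<sigma> * (excess M - c * real n) < - (\<epsilon> * real n)")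
        case True
        have "s * (\<sigma> * excess M) \<le> s * ((\<sigma> * c - \<epsilon>) * real n)" using True spos by (intro mult_left_mono) (auto simp: algebra_simps)
        then have "1 \<le> b * exp (- (\<sigma> * s) * excess M)" by (simp add: b_def mult_ac flip: exp_add)
        then have "1 \<le> ennreal (b * exp (- (\<sigma> * s) * excess M))" by (metis ennreal_1 ennreal_leI)
        then have "W M * 1 \<le> W M * ennreal (b * exp (- (\<sigma> * s) * excess M))" by (intro mult_left_mono) auto
        also have "\<dots> = ennreal b * (word_weight (tilted (\<sigma> * s) L) M * of_bool (letters_in \<Omega> M = rest n))"
          using True by (simp add: word_weight_tilted_excess ennreal_mult b_def mult_ac)
        finally show ?thesis using True by simp
      qed auto
    qed
    also have "\<dots> \<le> ennreal b * ennreal (2 / p * real n powr (K * (\<epsilon> / 2 - \<sigma> * c)))"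
      unfolding all_words_cmult using elim rest[of n] unfolding s_def L_def by (intro mult_left_mono) auto
    also have "\<dots> = ennreal (b * (2 / p * real n powr (K * (\<epsilon> / 2 - \<sigma> * c))))"
      by (rule ennreal_mult[symmetric]) (use p_pos in \<open>auto simp: b_def\<close>)
    also have "b * (2 / p * real n powr (K * (\<epsilon> / 2 - \<sigma> * c))) = 2 / p * real n powr (- K * \<epsilon> / 2)"
    proof -
      have "b = real n powr (K * (\<sigma> * c - \<epsilon>))" using elim tilt by (simp add: b_def powr_def mult_ac)
      then have "b * real n powr (K * (\<epsilon> / 2 - \<sigma> * c)) = real n powr (- K * \<epsilon> / 2)"
        by (simp only: powr_add[symmetric]) (rule arg_cong[where f = "\<lambda>x. _ powr x"], simp add: field_simps)
      then show ?thesis by simp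
    qed
    finally show ?case unfolding L_def .
  qed
qed

lemma real_excess:
  assumes "excess M > x" "x \<ge> 0"
  shows "real (size M - sum_mset M) = excess M"
proof -
  have "real (sum_mset M) < real (size M)" using assms unfolding excess_def by linarith
  then have "sum_mset M < size M" by (simp only: of_nat_less_iff)
  then show ?thesis unfolding excess_def by (simp only: of_nat_diff less_imp_le)
qed

text \<open>The law of large numbers for free words. The lower tail requires the truncation, since large letters
have no exponential moments; words containing a big letter are rare.\<close>

lemma bad_mass:
  assumes \<epsilon>: "\<epsilon> > 0" and r: "r > 0"
  shows "\<forall>\<^sub>F n in sequentially. all_words (\<lambda>M. W M * of_bool (letters_in \<Omega> M = rest n \<and> \<bar>excess M - c * real n\<bar> > \<epsilon> * real n)) \<le> ennreal r"
proof -
  have "(\<lambda>n. 2 / p * real n powr (- K * \<epsilon> / 2)) \<longlonglongrightarrow> 0" using K \<epsilon> by real_asymp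
  from order_tendstoD(2)[OF this, of "r / 3"] r
  have small: "\<forall>\<^sub>F n in sequentially. 2 / p * real n powr (- K * \<epsilon> / 2) < r / 3" by simp
  have "r / 3 > 0" using r by simp
  have \<sigma>: "(1 :: real) \<in> {1, -1}" "(-1 :: real) \<in> {1, -1}" by auto
  from big_letter_mass[OF \<open>r / 3 > 0\<close>] excess_deviation[OF \<epsilon> \<sigma>(1)] excess_deviation[OF \<epsilon> \<sigma>(2)] small show ?thesis
  proof eventually_elim
    case (elim n)
    let ?a = "\<lambda>M. \<forall>d\<in>#M. real d \<le> \<delta> * real n"
    let ?e = "\<lambda>\<sigma> M. \<sigma> * (excess M - c * real n) < - (\<epsilon> * real n)"
    let ?t = "\<lambda>Q. all_words (\<lambda>M. W M * of_bool (letters_in \<Omega> M = rest n \<and> Q M))"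
    have "?t (\<lambda>M. \<bar>excess M - c * real n\<bar> > \<epsilon> * real n) \<le>
       ?t (\<lambda>M. \<not> ?a M) + (?t (\<lambda>M. ?a M \<and> ?e 1 M) + ?t (\<lambda>M. ?a M \<and> ?e (-1) M))"
      unfolding all_words_add[symmetric] by (rule all_words_mono) (auto simp: abs_real_def split: if_splits)
    also have "\<dots> \<le> ennreal (r / 3) + (ennreal (r / 3) + ennreal (r / 3))"
    proof -
      have le: "ennreal (2 / p * real n powr (- K * \<epsilon> / 2)) \<le> ennreal (r / 3)"
        using elim by (intro ennreal_leI) linarith
      show ?thesis
        by (intro add_mono elim(1) order_trans[OF elim(2) le] order_trans[OF elim(3) le])
    qed
    also have "\<dots> = ennreal (r / 3 + (r / 3 + r / 3))" using r by (simp flip: ennreal_plus)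
    finally show ?case by simp
  qed
qed

text \<open>The probability of the letter that completes the word M, provided that this letter is big.\<close>

definition jump :: "nat \<Rightarrow> nat multiset \<Rightarrow> real" where
  "jump n M = (if excess M > \<delta> * real n then pmf \<xi> (size M - sum_mset M) else 0)"

lemma jump_nonneg: "jump n M \<ge> 0" by (simp add: jump_def)

text \<open>On words with excess close to c n the ratio is close to 1 by \<open>jump_law_close\<close>; on the
remaining words it is bounded by \<open>jump_law_bound\<close>, and these words have small mass.\<close>

lemma jump_deviation:
  assumes r: "r > 0"
  shows "\<forall>\<^sub>F n in sequentially. all_words (\<lambda>M. W M * (of_bool (letters_in \<Omega> M = rest n) * ennreal \<bar>jump n M / rho n - 1\<bar>)) \<le> ennreal r"
proof -
  \<comment> \<open>the total mass is 1 / p, so the good words contribute at most r / 2\<close>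
  define \<eta> where "\<eta> = r * p / 2"
  have \<eta>: "\<eta> > 0" using r p_pos by (simp add: \<eta>_def)
  obtain \<epsilon> where \<epsilon>: "\<epsilon> > 0" "\<epsilon> \<le> c / 2" and close: "\<forall>\<^sub>F n in sequentially. \<forall>k. \<bar>real k - c * real n\<bar> \<le> \<epsilon> * real n \<longrightarrow> \<bar>pmf \<xi> k / rho n - 1\<bar> \<le> \<eta>"
    using jump_law_close[OF \<eta>] by blast
  obtain C where C: "C > 0" and bound: "\<forall>\<^sub>F n in sequentially. \<forall>k. real k > \<delta> * real n \<longrightarrow> pmf \<xi> k \<le> C * rho n"
    using jump_law_bound[OF K(2)] by blast
  have "r / (2 * (C + 1)) > 0" using r C by simp
  from bad_mass[OF \<epsilon>(1) this] close bound rho_pos eventually_gt_at_top[of 0] show ?thesis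
  proof eventually_elim
    case (elim n)
    let ?bad = "\<lambda>M. \<bar>excess M - c * real n\<bar> > \<epsilon> * real n"
    have pt: "\<bar>jump n M / rho n - 1\<bar> \<le> \<eta> + (C + 1) * of_bool (?bad M)" for M
    proof (cases "?bad M")
      case True
      have "0 \<le> jump n M / rho n" using elim by (simp add: jump_nonneg)
      moreover have "jump n M / rho n \<le> C"
      proof (cases "excess M > \<delta> * real n")
        case True
        have "0 \<le> \<delta> * real n" using K by simp
        with True have "real (size M - sum_mset M) = excess M" by (rule real_excess)
        then have "pmf \<xi> (size M - sum_mset M) \<le> C * rho n" using elim True by metis
        then show ?thesis using elim True by (simp add: jump_def field_simps)
      qed (use C in \<open>simp add: jump_def\<close>)
      ultimately show ?thesis using True \<eta> by auto
    next
      case False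
      have "\<delta> * real n < (c - \<epsilon>) * real n" using \<delta>c \<epsilon> elim by (intro mult_strict_right_mono) auto
      with False have big: "excess M > \<delta> * real n" by (simp add: algebra_simps abs_le_iff not_less)
      have "0 \<le> \<delta> * real n" using K by simp
      with big have "real (size M - sum_mset M) = excess M" by (rule real_excess)
      then show ?thesis using elim False big by (simp add: jump_def)
    qed
    have "all_words (\<lambda>M. W M * (of_bool (letters_in \<Omega> M = rest n) * ennreal \<bar>jump n M / rho n - 1\<bar>)) \<le>
      all_words (\<lambda>M. ennreal \<eta> * (W M * of_bool (letters_in \<Omega> M = rest n)) + ennreal (C + 1) * (W M * of_bool (letters_in \<Omega> M = rest n \<and> ?bad M)))"
    proof (rule all_words_mono)
      fix M
      have "ennreal \<bar>jump n M / rho n - 1\<bar> \<le> ennreal (\<eta> + (C + 1) * of_bool (?bad M))" by (rule ennreal_leI[OF pt])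
      also have "\<dots> = ennreal \<eta> + ennreal (C + 1) * of_bool (?bad M)"
        using \<eta> C by (cases "?bad M") (simp_all add: ennreal_plus)
      finally have "W M * (of_bool (letters_in \<Omega> M = rest n) * ennreal \<bar>jump n M / rho n - 1\<bar>) \<le>
        W M * (of_bool (letters_in \<Omega> M = rest n) * (ennreal \<eta> + ennreal (C + 1) * of_bool (?bad M)))"
        by (intro mult_left_mono) auto
      also have "\<dots> = ennreal \<eta> * (W M * of_bool (letters_in \<Omega> M = rest n)) + ennreal (C + 1) * (W M * of_bool (letters_in \<Omega> M = rest n \<and> ?bad M))"
        by (cases "letters_in \<Omega> M = rest n"; cases "?bad M") (simp_all add: distrib_left distrib_right mult.commute del: ennreal_plus)
      finally show "W M * (of_bool (letters_in \<Omega> M = rest n) * ennreal \<bar>jump n M / rho n - 1\<bar>) \<le> \<dots>" .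
    qed
    also have "\<dots> = ennreal \<eta> * ennreal (1 / p) + ennreal (C + 1) * all_words (\<lambda>M. W M * of_bool (letters_in \<Omega> M = rest n \<and> ?bad M))"
      unfolding all_words_add all_words_cmult total_mass ..
    also have "\<dots> \<le> ennreal \<eta> * ennreal (1 / p) + ennreal (C + 1) * ennreal (r / (2 * (C + 1)))"
      using elim by (intro add_left_mono mult_left_mono) auto
    also have "\<dots> = ennreal (\<eta> * (1 / p) + (C + 1) * (r / (2 * (C + 1))))"
      using \<eta> C r p_pos by (simp add: ennreal_mult ennreal_plus del: times_divide_eq_right)
    also have "\<eta> * (1 / p) + (C + 1) * (r / (2 * (C + 1))) = r"
      using p_pos C by (simp add: \<eta>_def field_simps)
    finally show ?case .
  qed
qed

definition second_le_mass :: "nat \<Rightarrow> real \<Rightarrow> ennreal" where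
  "second_le_mass n y = tree_sum (\<lambda>M. W M * of_bool (letters_in \<Omega> M = n \<and> size (filter_mset (\<lambda>d. real d > y) M) \<le> 1))"

definition cond_mass :: "nat \<Rightarrow> ennreal" where
  "cond_mass n = tree_sum (\<lambda>M. W M * of_bool (letters_in \<Omega> M = n))"

definition no_big_mass :: "nat \<Rightarrow> ennreal" where
  "no_big_mass n = tree_sum (\<lambda>M. W M * of_bool (letters_in \<Omega> M = n \<and> (\<forall>d\<in>#M. real d \<le> \<delta> * real n)))"

text \<open>The words that occur here have excess 1, so tilting costs only the factor exp s, while the tilted
total weight is at most of order n^(-K c / 2) = n^(-\<alpha>-2).\<close>

lemma no_big_mass_small:
  assumes r: "r > 0"
  shows "\<forall>\<^sub>F n in sequentially. no_big_mass n \<le> ennreal (r * rho n)"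
proof -
  have "c / 2 > 0" using c_pos by simp
  from tilted_all_words_bound[OF \<beta> mom K _ this, of 1]
  have b: "\<forall>\<^sub>F n in sequentially. \<forall>m. m \<le> n \<and> n \<le> m + 1 \<longrightarrow>
     all_words (\<lambda>M. word_weight (tilted (tilt K n) (\<delta> * real n)) M * of_bool (letters_in \<Omega> M = m)) \<le> ennreal (2 / p * real n powr (K * (c / 2 - c)))" by simp
  have "(\<lambda>n. exp (tilt K n) * (2 / p) * (real n powr (- \<alpha> - 2) / rho n)) \<longlonglongrightarrow> exp 0 * (2 / p) * 0"
    unfolding tilt_def by (intro tendsto_intros rho_lower) (real_asymp | use p_pos in simp)+
  from order_tendstoD(2)[OF this, of r] r
  have small: "\<forall>\<^sub>F n in sequentially. exp (tilt K n) * (2 / p) * (real n powr (- \<alpha> - 2) / rho n) < r" by simp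
  from b small rho_pos show ?thesis
  proof eventually_elim
    case (elim n)
    define L where "L = \<delta> * real n"
    define s where "s = tilt K n"
    have "no_big_mass n \<le> tree_sum (\<lambda>M. ennreal (exp s) * (word_weight (tilted s L) M * of_bool (letters_in \<Omega> M = n)))"
      unfolding no_big_mass_def
    proof (rule tree_sum_mono)
      fix M :: "nat multiset" assume "size M = Suc (sum_mset M)"
      then have "excess M = 1" by (simp add: excess_def)
      then have "ennreal (exp s) * word_weight (tilted s L) M = W M * of_bool (\<forall>d\<in>#M. real d \<le> L) * ennreal (exp s * exp (- s))"
        unfolding word_weight_tilted_excess by (simp add: ennreal_mult mult_ac)
      then show "W M * of_bool (letters_in \<Omega> M = n \<and> (\<forall>d\<in>#M. real d \<le> \<delta> * real n)) \<le> ennreal (exp s) * (word_weight (tilted s L) M * of_bool (letters_in \<Omega> M = n))"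
        by (simp add: exp_minus L_def flip: mult.assoc)
    qed
    also have "\<dots> \<le> all_words (\<lambda>M. ennreal (exp s) * (word_weight (tilted s L) M * of_bool (letters_in \<Omega> M = n)))" by (rule tree_sum_le_all_words)
    also have "\<dots> = ennreal (exp s) * all_words (\<lambda>M. word_weight (tilted s L) M * of_bool (letters_in \<Omega> M = n))" by (rule all_words_cmult)
    also have "\<dots> \<le> ennreal (exp s) * ennreal (2 / p * real n powr (K * (c / 2 - c)))"
      using elim unfolding s_def L_def by (intro mult_left_mono) auto
    also have "\<dots> = ennreal (exp s * (2 / p * real n powr (K * (c / 2 - c))))"
      by (rule ennreal_mult[symmetric]) (use p_pos in auto)
    also have "K * (c / 2 - c) = - \<alpha> - 2" using Kc by (simp add: algebra_simps)
    also have "ennreal (exp s * (2 / p * real n powr (- \<alpha> - 2))) \<le> ennreal (r * rho n)"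
    proof (rule ennreal_leI)
      have "exp s * (2 / p * real n powr (- \<alpha> - 2)) = (exp s * (2 / p) * (real n powr (- \<alpha> - 2) / rho n)) * rho n"
        using elim by simp
      also have "\<dots> \<le> r * rho n" using elim by (intro mult_right_mono) (auto simp: s_def)
      finally show "exp s * (2 / p * real n powr (- \<alpha> - 2)) \<le> r * rho n" .
    qed
    finally show ?case .
  qed
qed

lemma big_letters_Omega: "\<forall>\<^sub>F n in sequentially. n \<ge> 1 \<and> (\<forall>d. real d > \<delta> * real n \<longrightarrow> (d \<in> \<Omega> \<longleftrightarrow> infinite \<Omega>))"
proof -
  define S where "S = (if finite \<Omega> then \<Omega> else - \<Omega>)"
  have "finite S" using fin by (auto simp: S_def)
  then obtain N where N: "\<And>d. d \<in> S \<Longrightarrow> d \<le> N" by (meson finite_nat_set_iff_bounded_le)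
  show ?thesis
    using eventually_real_ge[OF K(2), of "real N"] eventually_ge_at_top[of 1]
  proof eventually_elim
    case (elim n)
    have "d \<in> \<Omega> \<longleftrightarrow> infinite \<Omega>" if "real d > \<delta> * real n" for d
    proof -
      have "d > N" using that elim by linarith
      then have "d \<notin> S" using N by (meson not_le)
      then show ?thesis by (auto simp: S_def split: if_splits)
    qed
    with elim show ?case by blast
  qed
qed

lemma letters_in_add_big:
  assumes "n \<ge> 1" "\<forall>d. real d > \<delta> * real n \<longrightarrow> (d \<in> \<Omega> \<longleftrightarrow> infinite \<Omega>)" "real d > \<delta> * real n"
  shows "letters_in \<Omega> (add_mset d M) = n \<longleftrightarrow> letters_in \<Omega> M = rest n"
  using assms by (auto simp: rest_def)

definition big_count :: "nat \<Rightarrow> nat multiset \<Rightarrow> ennreal" where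
  "big_count n M = (\<Sum>d\<in>#M. of_bool (real d > \<delta> * real n))"

lemma filter_mset_empty_iff: "filter_mset P M = {#} \<longleftrightarrow> (\<forall>d\<in>#M. \<not> P d)"
  by (induction M) auto

lemma size_filter_mset_mono: "(\<And>d. P d \<Longrightarrow> Q d) \<Longrightarrow> size (filter_mset P M) \<le> size (filter_mset Q M)"
  by (induction M) (auto intro: le_SucI)

lemma big_count_eq: "big_count n M = of_nat (size (filter_mset (\<lambda>d. real d > \<delta> * real n) M))"
  unfolding big_count_def by (induction M) auto

text \<open>If g holds for a multiset with a big letter exactly when h holds for the other letters, the
distinguished big letter is integrated out.\<close>

lemma select_big:
  assumes n: "n \<ge> 1" "\<forall>d. real d > \<delta> * real n \<longrightarrow> (d \<in> \<Omega> \<longleftrightarrow> infinite \<Omega>)"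
    and g: "\<And>d M. real d > \<delta> * real n \<Longrightarrow> g (add_mset d M) = h M"
  shows "tree_sum (\<lambda>M. big_count n M * (W M * of_bool (letters_in \<Omega> M = n \<and> g M))) =
    all_words (\<lambda>M. W M * (of_bool (letters_in \<Omega> M = rest n \<and> h M) * ennreal (jump n M)))"
  unfolding big_count_def tree_sum_select_letter
proof (rule arg_cong[where f = all_words], rule ext)
  fix M :: "nat multiset"
  have d0: "\<delta> * real n \<ge> 0" using K by simp
  show "W M * (if sum_mset M \<le> size M then
        (\<lambda>d. of_bool (real d > \<delta> * real n) * offspring_weight d * of_bool (letters_in \<Omega> (add_mset d M) = n \<and> g (add_mset d M))) (size M - sum_mset M) else 0) =
     W M * (of_bool (letters_in \<Omega> M = rest n \<and> h M) * ennreal (jump n M))"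
  proof (cases "sum_mset M \<le> size M")
    case True
    define d where "d = size M - sum_mset M"
    have d: "real d = excess M" using True by (simp only: d_def excess_def of_nat_diff)
    show ?thesis
    proof (cases "real d > \<delta> * real n")
      case big: True
      then have "jump n M = pmf \<xi> d" using d by (simp add: jump_def d_def)
      with True big letters_in_add_big[OF n big] g[OF big] show ?thesis
        unfolding d_def[symmetric] by (simp add: mult_ac)
    next
      case False
      then have "jump n M = 0" using d by (simp add: jump_def)
      with True False show ?thesis unfolding d_def[symmetric] by simp
    qed
  next
    case False
    then have "real (size M) < real (sum_mset M)" by (simp only: of_nat_less_iff not_le)
    then have "excess M \<le> 0" unfolding excess_def by linarith
    with d0 False show ?thesis by (simp add: jump_def)
  qed
qed

definition big_le_mass :: "nat \<Rightarrow> real \<Rightarrow> ennreal" where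
  "big_le_mass n y = all_words (\<lambda>M. word_weight (tilted 0 y) M * (of_bool (letters_in \<Omega> M = rest n) * ennreal (jump n M)))"

definition big_mass :: "nat \<Rightarrow> ennreal" where
  "big_mass n = all_words (\<lambda>M. W M * (of_bool (letters_in \<Omega> M = rest n) * ennreal (jump n M)))"

lemma select_big_le:
  assumes n: "n \<ge> 1" "\<forall>d. real d > \<delta> * real n \<longrightarrow> (d \<in> \<Omega> \<longleftrightarrow> infinite \<Omega>)" and y: "y \<le> \<delta> * real n"
  shows "tree_sum (\<lambda>M. big_count n M * (W M * of_bool (letters_in \<Omega> M = n \<and> size (filter_mset (\<lambda>d. real d > y) M) \<le> 1))) = big_le_mass n y"
proof -
  have "size (filter_mset (\<lambda>d. real d > y) (add_mset d M)) \<le> 1 \<longleftrightarrow> (\<forall>e\<in>#M. real e \<le> y)" if "real d > \<delta> * real n" for d M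
    using that y by (auto simp: filter_mset_eq_conv not_less filter_mset_empty_iff)
  from select_big[OF n, of "\<lambda>M. size (filter_mset (\<lambda>d. real d > y) M) \<le> 1" "\<lambda>M. \<forall>e\<in>#M. real e \<le> y", OF this] show ?thesis
    by (auto simp: big_le_mass_def word_weight_tilted_0 intro!: arg_cong[where f = all_words])
qed

lemma split_by_big:
  assumes "P \<Longrightarrow> letters_in \<Omega> M = n"
  shows "W M * of_bool P \<le> W M * of_bool (letters_in \<Omega> M = n \<and> (\<forall>d\<in>#M. real d \<le> \<delta> * real n)) +
    big_count n M * (W M * of_bool P)"
proof (cases "\<forall>d\<in>#M. real d \<le> \<delta> * real n")
  case True
  then show ?thesis using assms by (cases P) (simp_all add: add_increasing2)
next
  case False
  then have "filter_mset (\<lambda>d. real d > \<delta> * real n) M \<noteq> {#}" by (auto simp: filter_mset_empty_iff)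
  then have "size (filter_mset (\<lambda>d. real d > \<delta> * real n) M) \<noteq> 0"
    unfolding size_eq_0_iff_empty .
  then have "1 \<le> size (filter_mset (\<lambda>d. real d > \<delta> * real n) M)" by linarith
  then have "1 \<le> big_count n M" unfolding big_count_eq by (metis of_nat_1 of_nat_le_iff)
  then have "1 * (W M * of_bool P) \<le> big_count n M * (W M * of_bool P)" by (intro mult_right_mono) auto
  then show ?thesis by (simp add: add_increasing)
qed

text \<open>A word in which at most one letter exceeds y, for y \<le> \<delta> n, has either no big letter or exactly one,
and in the latter case all other letters are at most y.\<close>

lemma second_le_mass_bounds:
  assumes n: "n \<ge> 1" "\<forall>d. real d > \<delta> * real n \<longrightarrow> (d \<in> \<Omega> \<longleftrightarrow> infinite \<Omega>)" and y: "y \<le> \<delta> * real n"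
  shows "big_le_mass n y \<le> second_le_mass n y" "second_le_mass n y \<le> no_big_mass n + big_le_mass n y"
proof -
  show "big_le_mass n y \<le> second_le_mass n y"
    unfolding second_le_mass_def select_big_le[OF n y, symmetric]
  proof (rule tree_sum_mono)
    fix M :: "nat multiset"
    show "big_count n M * (W M * of_bool (letters_in \<Omega> M = n \<and> size (filter_mset (\<lambda>d. real d > y) M) \<le> 1)) \<le>
       W M * of_bool (letters_in \<Omega> M = n \<and> size (filter_mset (\<lambda>d. real d > y) M) \<le> 1)"
    proof (cases "size (filter_mset (\<lambda>d. real d > y) M) \<le> 1")
      case True
      have "size (filter_mset (\<lambda>d. real d > \<delta> * real n) M) \<le> size (filter_mset (\<lambda>d. real d > y) M)"
        using y by (intro size_filter_mset_mono) auto
      with True have "size (filter_mset (\<lambda>d. real d > \<delta> * real n) M) \<le> 1" by linarith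
      then have "big_count n M \<le> 1" unfolding big_count_eq by (metis of_nat_1 of_nat_le_iff)
      then show ?thesis by (metis mult_right_mono mult_1 zero_le)
    qed simp
  qed
  show "second_le_mass n y \<le> no_big_mass n + big_le_mass n y"
    unfolding second_le_mass_def select_big_le[OF n y, symmetric] no_big_mass_def tree_sum_add[symmetric]
  proof (rule tree_sum_mono)
    fix M :: "nat multiset"
    show "W M * of_bool (letters_in \<Omega> M = n \<and> size (filter_mset (\<lambda>d. real d > y) M) \<le> 1) \<le>
      W M * of_bool (letters_in \<Omega> M = n \<and> (\<forall>d\<in>#M. real d \<le> \<delta> * real n)) +
      big_count n M * (W M * of_bool (letters_in \<Omega> M = n \<and> size (filter_mset (\<lambda>d. real d > y) M) \<le> 1))"
      by (rule split_by_big) simp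
  qed
qed

text \<open>Words with several big letters are counted repeatedly in the upper bound and left out in the
lower bound; the two bounds agree asymptotically.\<close>

lemma cond_mass_bounds:
  assumes n: "n \<ge> 1" "\<forall>d. real d > \<delta> * real n \<longrightarrow> (d \<in> \<Omega> \<longleftrightarrow> infinite \<Omega>)"
  shows "big_le_mass n (\<delta> * real n) \<le> cond_mass n" "cond_mass n \<le> no_big_mass n + big_mass n"
proof -
  have "big_le_mass n (\<delta> * real n) \<le> second_le_mass n (\<delta> * real n)" by (rule second_le_mass_bounds[OF n]) simp
  also have "\<dots> \<le> cond_mass n"
    unfolding second_le_mass_def cond_mass_def by (intro tree_sum_mono mult_left_mono) auto
  finally show "big_le_mass n (\<delta> * real n) \<le> cond_mass n" .
  have J: "big_mass n = tree_sum (\<lambda>M. big_count n M * (W M * of_bool (letters_in \<Omega> M = n)))"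
    using select_big[OF n, of "\<lambda>_. True" "\<lambda>_. True"] by (simp add: big_mass_def)
  show "cond_mass n \<le> no_big_mass n + big_mass n"
    unfolding J cond_mass_def no_big_mass_def tree_sum_add[symmetric]
    by (intro tree_sum_mono split_by_big) simp
qed

text \<open>Replacing the factor \<open>jump n M\<close> by the constant \<open>rho n\<close>.\<close>

lemma jump_mass_bounds:
  assumes \<rho>: "rho n > 0" and w: "\<And>M. w M \<le> W M" and r: "r \<ge> 0" "v \<ge> 0"
    and dev: "all_words (\<lambda>M. W M * (of_bool (letters_in \<Omega> M = rest n) * ennreal \<bar>jump n M / rho n - 1\<bar>)) \<le> ennreal r"
    and v: "all_words (\<lambda>M. w M * of_bool (letters_in \<Omega> M = rest n)) = ennreal v"
  shows "all_words (\<lambda>M. w M * (of_bool (letters_in \<Omega> M = rest n) * ennreal (jump n M))) \<le> ennreal (rho n * (v + r))"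
    and "ennreal (rho n * (v - r)) \<le> all_words (\<lambda>M. w M * (of_bool (letters_in \<Omega> M = rest n) * ennreal (jump n M)))"
proof -
  let ?N = "\<lambda>M. of_bool (letters_in \<Omega> M = rest n) :: ennreal"
  let ?D = "\<lambda>M. ennreal \<bar>jump n M / rho n - 1\<bar>"
  let ?T = "all_words (\<lambda>M. w M * (?N M * ennreal (jump n M)))"
  have dev': "all_words (\<lambda>M. w M * (?N M * ?D M)) \<le> ennreal r"
    by (rule order_trans[OF all_words_mono dev]) (intro mult_right_mono w, simp)
  have "?T \<le> all_words (\<lambda>M. ennreal (rho n) * (w M * ?N M) + ennreal (rho n) * (w M * (?N M * ?D M)))"
  proof (rule all_words_mono)
    fix M
    have "jump n M \<le> rho n + rho n * \<bar>jump n M / rho n - 1\<bar>"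
    proof -
      have "rho n * (jump n M / rho n - 1) \<le> rho n * \<bar>jump n M / rho n - 1\<bar>" using \<rho> by (intro mult_left_mono) auto
      then show ?thesis using \<rho> by (simp add: algebra_simps)
    qed
    then have "ennreal (jump n M) \<le> ennreal (rho n + rho n * \<bar>jump n M / rho n - 1\<bar>)" by (rule ennreal_leI)
    also have "\<dots> = ennreal (rho n) + ennreal (rho n) * ?D M" using \<rho> by (simp add: ennreal_mult)
    finally have "w M * (?N M * ennreal (jump n M)) \<le> w M * (?N M * (ennreal (rho n) + ennreal (rho n) * ?D M))"
      by (intro mult_left_mono) auto
    also have "\<dots> = ennreal (rho n) * (w M * ?N M) + ennreal (rho n) * (w M * (?N M * ?D M))"
      by (simp add: distrib_left mult_ac)
    finally show "w M * (?N M * ennreal (jump n M)) \<le> \<dots>" .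
  qed
  also have "\<dots> = ennreal (rho n) * ennreal v + ennreal (rho n) * all_words (\<lambda>M. w M * (?N M * ?D M))"
    unfolding all_words_add all_words_cmult v ..
  also have "\<dots> \<le> ennreal (rho n) * ennreal v + ennreal (rho n) * ennreal r"
    by (intro add_left_mono mult_left_mono dev') auto
  also have "\<dots> = ennreal (rho n * (v + r))" using \<rho> r by (simp add: distrib_left ennreal_mult)
  finally show "?T \<le> ennreal (rho n * (v + r))" .
  have "ennreal (rho n) * ennreal v = all_words (\<lambda>M. ennreal (rho n) * (w M * ?N M))" unfolding all_words_cmult v ..
  also have "\<dots> \<le> all_words (\<lambda>M. w M * (?N M * ennreal (jump n M)) + ennreal (rho n) * (w M * (?N M * ?D M)))"
  proof (rule all_words_mono)
    fix M
    have "rho n \<le> jump n M + rho n * \<bar>jump n M / rho n - 1\<bar>"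
    proof -
      have "rho n * (1 - jump n M / rho n) \<le> rho n * \<bar>jump n M / rho n - 1\<bar>" using \<rho> by (intro mult_left_mono) auto
      then show ?thesis using \<rho> by (simp add: algebra_simps)
    qed
    then have "ennreal (rho n) \<le> ennreal (jump n M + rho n * \<bar>jump n M / rho n - 1\<bar>)" by (rule ennreal_leI)
    also have "\<dots> = ennreal (jump n M) + ennreal (rho n) * ?D M" using \<rho> jump_nonneg by (simp add: ennreal_mult)
    finally have "w M * (?N M * ennreal (rho n)) \<le> w M * (?N M * (ennreal (jump n M) + ennreal (rho n) * ?D M))"
      by (intro mult_left_mono) auto
    also have "\<dots> = w M * (?N M * ennreal (jump n M)) + ennreal (rho n) * (w M * (?N M * ?D M))"
      by (simp add: distrib_left mult_ac)
    finally show "ennreal (rho n) * (w M * ?N M) \<le> \<dots>" by (simp add: mult_ac)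
  qed
  also have "\<dots> = ?T + ennreal (rho n) * all_words (\<lambda>M. w M * (?N M * ?D M))" unfolding all_words_add all_words_cmult ..
  also have "\<dots> \<le> ?T + ennreal (rho n) * ennreal r" by (intro add_left_mono mult_left_mono dev') auto
  finally have "ennreal (rho n * v) \<le> ?T + ennreal (rho n * r)" using \<rho> r by (simp add: ennreal_mult)
  then have "ennreal (rho n * v) - ennreal (rho n * r) \<le> ?T" by (simp add: ennreal_minus_le_iff add.commute)
  also have "ennreal (rho n * v) - ennreal (rho n * r) = ennreal (rho n * (v - r))"
    using \<rho> r by (simp add: ennreal_minus right_diff_distrib)
  finally show "ennreal (rho n * (v - r)) \<le> ?T" .
qed

lemma enn2real_ratio_tendsto:
  fixes X :: "nat \<Rightarrow> ennreal" and R l u :: "nat \<Rightarrow> real"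
  assumes R: "\<forall>\<^sub>F n in sequentially. R n > 0"
    and b: "\<And>r. r > 0 \<Longrightarrow> \<forall>\<^sub>F n in sequentially. ennreal (R n * (l n - r)) \<le> X n \<and> X n \<le> ennreal (R n * (u n + r))"
    and l: "l \<longlonglongrightarrow> L" and u: "u \<longlonglongrightarrow> L" and "L \<ge> 0"
  shows "(\<lambda>n. enn2real (X n) / R n) \<longlonglongrightarrow> L"
proof (rule tendstoI)
  fix e :: real assume e: "e > 0"
  have "\<forall>\<^sub>F n in sequentially. l n > L - e / 2" "\<forall>\<^sub>F n in sequentially. u n < L + e / 2" "\<forall>\<^sub>F n in sequentially. u n > - e / 4"
    using e \<open>L \<ge> 0\<close> by (auto intro!: order_tendstoD(1)[OF l] order_tendstoD(2)[OF u] order_tendstoD(1)[OF u])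
  moreover have "e / 4 > 0" using e by simp
  note b[OF this]
  ultimately show "\<forall>\<^sub>F n in sequentially. dist (enn2real (X n) / R n) L < e"
    using R
  proof eventually_elim
    case (elim n)
    have fin: "X n < \<top>" using elim by (meson ennreal_less_top le_less_trans)
    then obtain x where x: "X n = ennreal x" "x \<ge> 0" by (cases "X n") auto
    have "0 \<le> R n * (u n + e / 4)" using elim by simp
    then have "x \<le> R n * (u n + e / 4)" using elim x by (simp add: ennreal_le_iff)
    moreover have "R n * (l n - e / 4) \<le> x"
    proof (cases "R n * (l n - e / 4) \<ge> 0")
      case True
      then show ?thesis using elim x by (simp add: ennreal_le_iff)
    qed (use x in simp)
    ultimately have "l n - e / 4 \<le> x / R n" "x / R n \<le> u n + e / 4" using elim by (simp_all add: field_simps)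
    with elim e have "L - e < x / R n" "x / R n < L + e" by linarith+
    then show ?case using x by (simp add: dist_real_def abs_less_iff)
  qed
qed

lemma word_weight_tilted_0_le: "word_weight (tilted 0 y) M \<le> W M"
  unfolding word_weight_tilted_0 by (simp add: mult_le_one)

lemma second_le_mass_asymp:
  assumes y: "(\<lambda>n. real n * prob {k. y n < real k}) \<longlonglongrightarrow> l"
    and y_le: "\<forall>\<^sub>F n in sequentially. y n \<le> \<delta> * real n"
  shows "(\<lambda>n. enn2real (second_le_mass n (y n)) / rho n) \<longlonglongrightarrow> exp (- l / p) / p"
proof -
  obtain v where v: "v \<longlonglongrightarrow> exp (- l / p) / p"
    "\<forall>\<^sub>F n in sequentially. all_words (\<lambda>M. word_weight (tilted 0 (y n)) M * of_bool (letters_in \<Omega> M = rest n)) = ennreal (v n)"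
    using truncated_mass[OF y] by blast
  have vpos: "\<forall>\<^sub>F n in sequentially. v n > 0" using p_pos by (intro order_tendstoD(1)[OF v(1)]) auto
  show ?thesis
  proof (rule enn2real_ratio_tendsto[OF rho_pos _ v(1) v(1)])
    fix r :: real assume "r > 0"
    then have r: "r / 2 > 0" by simp
    show "\<forall>\<^sub>F n in sequentially. ennreal (rho n * (v n - r)) \<le> second_le_mass n (y n) \<and> second_le_mass n (y n) \<le> ennreal (rho n * (v n + r))"
      using jump_deviation[OF r] no_big_mass_small[OF r] big_letters_Omega rho_pos vpos v(2) y_le
    proof eventually_elim
      case (elim n)
      have J: "big_le_mass n (y n) \<le> ennreal (rho n * (v n + r / 2))" "ennreal (rho n * (v n - r / 2)) \<le> big_le_mass n (y n)"
        unfolding big_le_mass_def using elim r by (intro jump_mass_bounds[OF _ word_weight_tilted_0_le]; simp)+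
      have w: "big_le_mass n (y n) \<le> second_le_mass n (y n)" "second_le_mass n (y n) \<le> no_big_mass n + big_le_mass n (y n)"
        using elim by (intro second_le_mass_bounds; blast)+
      have "ennreal (rho n * (v n - r)) \<le> ennreal (rho n * (v n - r / 2))"
        using elim r by (intro ennreal_leI mult_left_mono) auto
      moreover have "no_big_mass n + big_le_mass n (y n) \<le> ennreal (r / 2 * rho n) + ennreal (rho n * (v n + r / 2))"
        using elim J by (intro add_mono) auto
      moreover have "ennreal (r / 2 * rho n) + ennreal (rho n * (v n + r / 2)) = ennreal (r / 2 * rho n + rho n * (v n + r / 2))"
        using elim r by (intro ennreal_plus[symmetric]) auto
      moreover have "r / 2 * rho n + rho n * (v n + r / 2) = rho n * (v n + r)" by (simp add: algebra_simps)
      ultimately show ?case using J w by (metis order_trans)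
    qed
  qed (use p_pos in simp)
qed

lemma cond_mass_asymp: "(\<lambda>n. enn2real (cond_mass n) / rho n) \<longlonglongrightarrow> 1 / p"
proof -
  obtain v where v: "v \<longlonglongrightarrow> exp (- 0 / p) / p"
    "\<forall>\<^sub>F n in sequentially. all_words (\<lambda>M. word_weight (tilted 0 (\<delta> * real n)) M * of_bool (letters_in \<Omega> M = rest n)) = ennreal (v n)"
    using truncated_mass[OF n_tail_delta] by blast
  have vpos: "\<forall>\<^sub>F n in sequentially. v n > 0" using p_pos by (intro order_tendstoD(1)[OF v(1)]) auto
  show ?thesis
  proof (rule enn2real_ratio_tendsto[OF rho_pos _ _ tendsto_const[of "1 / p"]])
    show "v \<longlonglongrightarrow> 1 / p" using v(1) by simp
    fix r :: real assume "r > 0"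
    then have r: "r / 2 > 0" by simp
    show "\<forall>\<^sub>F n in sequentially. ennreal (rho n * (v n - r)) \<le> cond_mass n \<and> cond_mass n \<le> ennreal (rho n * (1 / p + r))"
      using jump_deviation[OF r] no_big_mass_small[OF r] big_letters_Omega rho_pos vpos v(2)
    proof eventually_elim
      case (elim n)
      have J: "ennreal (rho n * (v n - r / 2)) \<le> big_le_mass n (\<delta> * real n)"
        unfolding big_le_mass_def using elim r by (intro jump_mass_bounds[OF _ word_weight_tilted_0_le]; simp)
      have J': "big_mass n \<le> ennreal (rho n * (1 / p + r / 2))"
        unfolding big_mass_def using elim r p_pos total_mass by (intro jump_mass_bounds[OF _ order_refl]; simp)
      have w: "big_le_mass n (\<delta> * real n) \<le> cond_mass n" "cond_mass n \<le> no_big_mass n + big_mass n"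
        using elim by (intro cond_mass_bounds; blast)+
      have "ennreal (rho n * (v n - r)) \<le> ennreal (rho n * (v n - r / 2))"
        using elim r by (intro ennreal_leI mult_left_mono) auto
      moreover have "no_big_mass n + big_mass n \<le> ennreal (r / 2 * rho n) + ennreal (rho n * (1 / p + r / 2))"
        using elim J' by (intro add_mono) auto
      moreover have "ennreal (r / 2 * rho n) + ennreal (rho n * (1 / p + r / 2)) = ennreal (r / 2 * rho n + rho n * (1 / p + r / 2))"
        using elim r p_pos by (intro ennreal_plus[symmetric]) auto
      moreover have "r / 2 * rho n + rho n * (1 / p + r / 2) = rho n * (1 / p + r)" by (simp add: algebra_simps)
      ultimately show ?case using J w by (metis order_trans)
    qed
  qed (use p_pos in simp)
qed

lemma second_le_ratio:
  assumes y: "(\<lambda>n. real n * prob {k. y n < real k}) \<longlonglongrightarrow> l"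
    and y_le: "\<forall>\<^sub>F n in sequentially. y n \<le> \<delta> * real n"
  shows "(\<lambda>n. enn2real (second_le_mass n (y n)) / enn2real (cond_mass n)) \<longlonglongrightarrow> exp (- l / p)"
proof -
  have "(\<lambda>n. (enn2real (second_le_mass n (y n)) / rho n) / (enn2real (cond_mass n) / rho n)) \<longlonglongrightarrow> (exp (- l / p) / p) / (1 / p)"
    using p_pos by (intro tendsto_divide second_le_mass_asymp[OF y y_le] cond_mass_asymp) simp
  also have "(exp (- l / p) / p) / (1 / p) = exp (- l / p)" using p_pos by simp
  finally show ?thesis
    by (rule Lim_transform_eventually) (use rho_pos in eventually_elim, simp)
qed

lemma cond_mass_pos: "\<forall>\<^sub>F n in sequentially. 0 < enn2real (cond_mass n)"
proof -
  have "\<forall>\<^sub>F n in sequentially. enn2real (cond_mass n) / rho n > 0"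
    using p_pos by (intro order_tendstoD(1)[OF cond_mass_asymp]) auto
  with rho_pos show ?thesis by eventually_elim (simp add: zero_less_divide_iff)
qed

section \<open>Convergence to the Frechet distribution\<close>

text \<open>The tail at y n is of order 1 / n, but it is o(1 / n) at \<delta> n.\<close>

lemma below_delta:
  assumes "(\<lambda>n. real n * tail (y n)) \<longlonglongrightarrow> l" "l > 0"
  shows "\<forall>\<^sub>F n in sequentially. y n \<le> \<delta> * real n"
proof -
  have "\<forall>\<^sub>F n in sequentially. l / 2 < real n * tail (y n)"
    using assms by (intro order_tendstoD(1)[OF assms(1)]) auto
  moreover have "\<forall>\<^sub>F n in sequentially. real n * tail (\<delta> * real n) < l / 2"
    using assms unfolding tail_def by (intro order_tendstoD(2)[OF n_tail_delta]) auto
  ultimately show ?thesis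
  proof eventually_elim
    case (elim n)
    then have "real n * tail (\<delta> * real n) < real n * tail (y n)" by linarith
    then have "tail (\<delta> * real n) < tail (y n)" by (rule mult_left_less_imp_less) simp
    then show ?case using tail_antimono[of "\<delta> * real n" "y n"] by linarith
  qed
qed

lemma second_outdegree_cdf_tendsto:
  assumes a: "\<forall>\<^sub>F n in sequentially. a n > 0"
    and lim: "\<And>x. x > 0 \<Longrightarrow> (\<lambda>n. real n * tail (x * a n)) \<longlonglongrightarrow> p * x powr (-\<alpha>)"
  shows "(\<lambda>n. cdf (distr (gw_cond_space \<xi> \<Omega> n) borel (\<lambda>\<omega>. real (kth_outdegree 2 (gw_tree \<omega>)) / a n)) x) \<longlonglongrightarrow> frechet_cdf \<alpha> x"
proof -
  let ?cdf = "\<lambda>n x. cdf (distr (gw_cond_space \<xi> \<Omega> n) borel (\<lambda>\<omega>. real (kth_outdegree 2 (gw_tree \<omega>)) / a n)) x"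
  have eq: "\<forall>\<^sub>F n in sequentially. ?cdf n x = enn2real (second_le_mass n (x * a n)) / enn2real (cond_mass n)" if "x \<ge> 0" for x
    using a cond_mass_pos
  proof eventually_elim
    case (elim n)
    then have "cond_mass n > 0" by (metis enn2real_0 less_irrefl zero_less_iff_neq_zero)
    from cdf_second_outdegree[OF nn_mean elim(1) that this[unfolded cond_mass_def]]
    show ?case by (simp only: second_le_mass_def cond_mass_def)
  qed
  have pos: "(\<lambda>n. ?cdf n x) \<longlonglongrightarrow> exp (- (x powr (-\<alpha>)))" if x: "x > 0" for x
  proof -
    have "p * x powr (-\<alpha>) > 0" using p_pos x by simp
    from second_le_ratio[OF lim[OF x, unfolded tail_def] below_delta[OF lim[OF x] this]]
    have "(\<lambda>n. enn2real (second_le_mass n (x * a n)) / enn2real (cond_mass n)) \<longlonglongrightarrow> exp (- (x powr (-\<alpha>)))"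
      using p_pos by simp
    then show ?thesis
      by (rule Lim_transform_eventually) (use eq[OF less_imp_le[OF x]] in eventually_elim, simp)
  qed
  consider "x > 0" | "x = 0" | "x < 0" by linarith
  then show ?thesis
  proof cases
    case 1
    with pos show ?thesis by (simp add: frechet_cdf_def)
  next
    case 2
    have "(\<lambda>n. ?cdf n 0) \<longlonglongrightarrow> 0"
    proof (rule tendstoI)
      fix e :: real assume "e > 0"
      have "((\<lambda>z. exp (- (z powr (- \<alpha>)))) \<longlongrightarrow> 0) (at_right 0)" using \<alpha> by real_asymp
      from order_tendstoD(2)[OF this \<open>e > 0\<close>] eventually_at_right_less[of 0]
      have "\<forall>\<^sub>F z in at_right 0. z > 0 \<and> exp (- (z powr (- \<alpha>))) < e" by eventually_elim simp
      \<comment> \<open>the limit is continuous at 0, so that small levels z > 0 bound the distribution function at 0\<close>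
      then obtain z where z: "z > 0" "exp (- (z powr (- \<alpha>))) < e"
        using eventually_happens'[OF trivial_limit_at_right_real] by blast
      show "\<forall>\<^sub>F n in sequentially. dist (?cdf n 0) 0 < e"
      proof -
        have "\<forall>\<^sub>F n in sequentially. ?cdf n z < e" by (rule order_tendstoD(2)[OF pos[OF z(1)] z(2)])
        moreover have "\<forall>\<^sub>F n in sequentially. ?cdf n z = enn2real (second_le_mass n (z * a n)) / enn2real (cond_mass n)"
          using eq[of z] z(1) by simp
        moreover have "\<forall>\<^sub>F n in sequentially. ?cdf n 0 = enn2real (second_le_mass n (0 * a n)) / enn2real (cond_mass n)"
          using eq[of 0] by simp
        ultimately show ?thesis using a cond_mass_pos
        proof eventually_elim
          case (elim n)
          have "second_le_mass n 0 \<le> second_le_mass n (z * a n)"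
            unfolding second_le_mass_def
          proof (intro tree_sum_mono mult_left_mono)
            fix M :: "nat multiset"
            have "size (filter_mset (\<lambda>d. z * a n < real d) M) \<le> size (filter_mset (\<lambda>d. 0 < real d) M)"
              using mult_pos_pos[OF z(1) elim(4)] by (intro size_filter_mset_mono) linarith
            then show "of_bool (letters_in \<Omega> M = n \<and> size (filter_mset (\<lambda>d. 0 < real d) M) \<le> 1)
                \<le> (of_bool (letters_in \<Omega> M = n \<and> size (filter_mset (\<lambda>d. z * a n < real d) M) \<le> 1) :: ennreal)" by auto
          qed simp
          moreover have "second_le_mass n (z * a n) < \<top>"
          proof -
            have "cond_mass n < \<top>" using elim(5) by (metis enn2real_top less_irrefl top.not_eq_extremum)
            moreover have "second_le_mass n (z * a n) \<le> cond_mass n"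
              unfolding second_le_mass_def cond_mass_def by (intro tree_sum_mono mult_left_mono) auto
            ultimately show ?thesis by (rule order_le_less_trans[rotated])
          qed
          ultimately have "enn2real (second_le_mass n 0) \<le> enn2real (second_le_mass n (z * a n))" by (rule enn2real_mono)
          then have "?cdf n 0 \<le> ?cdf n z" using elim by (simp add: divide_right_mono)
          moreover have "?cdf n 0 \<ge> 0" by (simp add: cdf_def)
          ultimately show ?case using elim(1) by simp
        qed
      qed
    qed
    with 2 show ?thesis by (simp add: frechet_cdf_def)
  next
    case 3
    have "\<forall>\<^sub>F n in sequentially. ?cdf n x = 0"
      using a
    proof eventually_elim
      case (elim n)
      have m: "(\<lambda>\<omega>. real (kth_outdegree 2 (gw_tree \<omega>)) / a n) \<in> measurable (gw_cond_space \<xi> \<Omega> n) borel"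
        unfolding gw_cond_space_def by measurable
      have "0 \<le> real (kth_outdegree 2 (gw_tree \<omega>)) / a n" for \<omega> using elim by simp
      then have "\<not> real (kth_outdegree 2 (gw_tree \<omega>)) / a n \<le> x" for \<omega>
        using 3 by (meson leD order_le_less_trans)
      then show ?case unfolding cdf_def by (subst measure_distr[OF m]) (auto simp: vimage_def)
    qed
    then have "(\<lambda>n. ?cdf n x) \<longlonglongrightarrow> 0" by (rule tendsto_eventually)
    with 3 show ?thesis by (simp add: frechet_cdf_def)
  qed
qed

end

theorem corollary1p12:
  fixes \<xi> :: "nat pmf" and f :: "real \<Rightarrow> real" and \<alpha> :: real and \<Omega> :: "nat set"
  assumes "measure_pmf.prob \<xi> {0} > 0"
    and "measure_pmf.prob \<xi> {..1} < 1"
    and "integrable (measure_pmf \<xi>) real"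
    and "measure_pmf.expectation \<xi> real < 1"
    and "slowly_varying f"
    and "\<alpha> > 1"
    and "\<forall>\<^sub>F n in sequentially. pmf \<xi> n = f (real n) * real n powr (- 1 - \<alpha>)"
    and "\<Omega> \<noteq> {}"
    and "measure_pmf.prob \<xi> \<Omega> > 0"
    and "finite \<Omega> \<or> finite (- \<Omega>)"
  shows "\<exists>f\<^sub>2. slowly_varying f\<^sub>2 \<and>
    weak_conv_m
      (\<lambda>n. distr (gw_cond_space \<xi> \<Omega> n) borel
        (\<lambda>\<omega>. real (kth_outdegree 2 (gw_tree \<omega>)) / (f\<^sub>2 (real n) * real n powr (1 / \<alpha>))))
      (frechet \<alpha>)"
proof -
  interpret condensing_offspring \<xi> f \<alpha> \<Omega>
    using assms by unfold_locales
  obtain \<beta> where \<beta>: "0 < \<beta>" "\<beta> \<le> 1" "integrable (measure_pmf \<xi>) (\<lambda>k. real k powr (1 + \<beta>))"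
    using moment by blast
  \<comment> \<open>first K is taken large, then \<delta> small depending on K\<close>
  define K where "K = 2 * (\<alpha> + 2) / c"
  define \<delta> where "\<delta> = min (\<beta> / (2 * K)) (c / 4)"
  have K: "K > 0" "K * c = 2 * (\<alpha> + 2)" using c_pos \<alpha> by (auto simp: K_def)
  have "\<delta> \<le> \<beta> / (2 * K)" "\<delta> \<le> c / 4" unfolding \<delta>_def by (rule min.cobounded1, rule min.cobounded2)
  moreover have "\<delta> > 0" using K \<beta> c_pos by (simp add: \<delta>_def)
  ultimately have \<delta>: "\<delta> > 0" "K * \<delta> \<le> \<beta> / 2" "\<delta> < c / 2" using K c_pos by (auto simp: field_simps)
  interpret condensing_scale \<xi> f \<alpha> \<Omega> \<beta> K \<delta>
    by unfold_locales (fact \<beta> K \<delta>)+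
  have RV: "((\<lambda>y. tail (t * y) / tail y) \<longlongrightarrow> t powr (- \<alpha>)) at_top" if "t > 0" for t
    unfolding tail_def using pmf_tail_regularly_varying[OF sv _ pmf_tail that] \<alpha> by simp
  obtain f\<^sub>2 where f2: "slowly_varying f\<^sub>2" "filterlim (\<lambda>u. f\<^sub>2 u * u powr (1 / \<alpha>)) at_top at_top"
    "\<And>x. x > 0 \<Longrightarrow> ((\<lambda>u. u * tail (x * (f\<^sub>2 u * u powr (1 / \<alpha>)))) \<longlongrightarrow> p * x powr (-\<alpha>)) at_top"
    using regularly_varying_inverse[OF tail_antimono tail_pos tail_tendsto_0 RV _ p_pos] \<alpha> by auto
  define a where "a n = f\<^sub>2 (real n) * real n powr (1 / \<alpha>)" for n
  have "\<forall>\<^sub>F n in sequentially. a n > 0"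
    using filterlim_compose[OF f2(2) filterlim_real_sequentially] by (simp add: a_def filterlim_at_top_dense)
  moreover have "(\<lambda>n. real n * tail (x * a n)) \<longlonglongrightarrow> p * x powr (-\<alpha>)" if "x > 0" for x
    using filterlim_compose[OF f2(3)[OF that] filterlim_real_sequentially] by (simp add: a_def)
  ultimately have "weak_conv_m (\<lambda>n. distr (gw_cond_space \<xi> \<Omega> n) borel (\<lambda>\<omega>. real (kth_outdegree 2 (gw_tree \<omega>)) / a n)) (frechet \<alpha>)"
    unfolding weak_conv_m_def weak_conv_def using second_outdegree_cdf_tendsto cdf_frechet[of \<alpha>] \<alpha> by simp
  with f2(1) show ?thesis unfolding a_def by blast
qed

end
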